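(* Let $\beta\in(0,\beta_c)$, where $\beta_c=\sqrt{2\ln 2}$, and write $\gamma=(\beta_c/\beta)^2>1$. (1) There exist constants $C,c>0$ depending only on $\beta$ such that $$\sup_{x\in\mathbb{R}}\mathbf{P}\bigl(D_\infty^{[x]}(\beta)<-y\bigr)\le C\exp(-cy^{\gamma}),\qquad y\ge 1.$$ (2) For every $x\in\mathbb{R}$ there exists a constant $0<c<\infty$ depending only on $\beta$ and $x$ such that for any $y\ge 1$, $$\mathbf{P}\Bigl(\frac{D^{[x]}_\infty(\beta)}{W^{[x]}_\infty(\beta)}<-y\Bigr)\le \exp\bigl(-c\,y^{\gamma\wedge 2}\bigr),$$ and in particular $\mathbf{E}\left[\exp\left\{-K\,D^{[x]}_\infty(\beta)/W^{[x]}_\infty(\beta)\right\}\right]<\infty$ for all $K>0$.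
   Context: Let $\mathbb{T}$ be the infinite (rooted) binary tree with root $\rho$ (every vertex has exactly two children); $|u|$ denotes the generation of $u\in\mathbb{T}$, i.e. its graph distance to $\rho$, and $v\preceq u$ (resp. $v\prec u$) means that $v$ is an ancestor of $u$ or $v=u$ (resp. $v$ is an ancestor of $u$ and $v\neq u$). Let $(\xi_v)_{v\in\mathbb{T}}$ be i.i.d. standard Gaussian random variables, and let $S_u=\sum_{\rho\prec v\preceq u}\xi_v$ for $u\in\mathbb{T}$ (so $S_\rho=0$). For $x\in\mathbb{R}$ the binary Gaussian branching random walk started at $x$ is $(x+S_u)_{u\in\mathbb{T}}$. For $x\in\mathbb{R}$, $\beta\ge0$, $n\ge 0$ define its additive and derivative martingales $$W^{[x]}_n(\beta)=\frac1{2^n}\sum_{|u|=n}e^{\beta (x+S_u)-\frac{\beta^2}{2}n},\qquad D^{[x]}_n(\beta)=\frac{1}{2^n}\sum_{|u|=n}(x+S_u-\beta n)e^{\beta (x+S_u)-\frac{\beta^2}{2}n}.$$ Let $\beta_c=\sqrt{2\ln 2}$. For $\beta\in[0,\beta_c)$ these converge almost surely as $n\to\infty$ to limits denoted $W^{[x]}_\infty(\beta)$ and $D^{[x]}_\infty(\beta)$, and $W^{[x]}_\infty(\beta)>0$ almost surely. Notation: $a\wedge b=\min\{a,b\}$. *)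

theory Defs
  imports "HOL-Probability.Probability" "HOL-Library.Sublist"
begin

(* Vertices of the rooted binary tree are finite words over bool: the root is [], the children of u
   are u @ [False] and u @ [True], the generation of u is its length, and v is an ancestor of u or
   equal to u iff v is a prefix of u. *)
type_synonym vertex = "bool list"

locale gaussian_labels = prob_space M for M :: "'a measure" +
  fixes \<xi> :: "vertex \<Rightarrow> 'a \<Rightarrow> real"
  assumes indep_labels: "indep_vars (\<lambda>_. borel) \<xi> UNIV"
    and std_normal_labels: "\<And>v. distributed M lborel (\<xi> v) std_normal_density"

definition brw_pos :: "(vertex \<Rightarrow> 'a \<Rightarrow> real) \<Rightarrow> vertex \<Rightarrow> 'a \<Rightarrow> real" where
  "brw_pos \<xi> u \<omega> = (\<Sum>v | strict_prefix [] v \<and> prefix v u. \<xi> v \<omega>)"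

definition additive_mart :: "(vertex \<Rightarrow> 'a \<Rightarrow> real) \<Rightarrow> real \<Rightarrow> real \<Rightarrow> nat \<Rightarrow> 'a \<Rightarrow> real" where
  "additive_mart \<xi> x \<beta> n \<omega> =
     1 / 2 ^ n * (\<Sum>u | length u = n. exp (\<beta> * (x + brw_pos \<xi> u \<omega>) - \<beta>\<^sup>2 / 2 * real n))"

definition derivative_mart :: "(vertex \<Rightarrow> 'a \<Rightarrow> real) \<Rightarrow> real \<Rightarrow> real \<Rightarrow> nat \<Rightarrow> 'a \<Rightarrow> real" where
  "derivative_mart \<xi> x \<beta> n \<omega> =
     1 / 2 ^ n * (\<Sum>u | length u = n. (x + brw_pos \<xi> u \<omega> - \<beta> * real n) *
       exp (\<beta> * (x + brw_pos \<xi> u \<omega>) - \<beta>\<^sup>2 / 2 * real n))"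

(* Pathwise limits. They exist almost surely for 0 \<le> \<beta> < beta_c; where a sequence diverges, lim is
   some unspecified constant. *)
definition additive_limit :: "(vertex \<Rightarrow> 'a \<Rightarrow> real) \<Rightarrow> real \<Rightarrow> real \<Rightarrow> 'a \<Rightarrow> real" where
  "additive_limit \<xi> x \<beta> \<omega> = lim (\<lambda>n. additive_mart \<xi> x \<beta> n \<omega>)"

definition derivative_limit :: "(vertex \<Rightarrow> 'a \<Rightarrow> real) \<Rightarrow> real \<Rightarrow> real \<Rightarrow> 'a \<Rightarrow> real" where
  "derivative_limit \<xi> x \<beta> \<omega> = lim (\<lambda>n. derivative_mart \<xi> x \<beta> n \<omega>)"

definition beta_c :: real where
  "beta_c = sqrt (2 * ln 2)"

end

theory Submission
  imports Defs
begin

text \<open>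
  Put \<open>scale = exp (\<beta>\<^sup>2 / 2) / 2\<close> and \<open>X = \<xi> - \<beta>\<close> with \<open>\<xi>\<close> standard Gaussian. Splitting the tree
  at the root gives, for the derivative martingale (and likewise for the additive one),
  \<open>D\<^bsub>n+1\<^esub>[x] = scale * (D\<^bsub>n\<^esub>[x + X] + D'\<^bsub>n\<^esub>[x + X'])\<close> with independent ingredients on the right
  (lemmas \<open>mart_Suc\<close>, \<open>nn_integral_branching\<close>). All tail estimates are proved for finite \<open>n\<close>, with
  constants that depend on \<open>\<beta>\<close> alone (for the ratio also on \<open>x\<close>), and are passed to the limit by Fatou's lemma
  (\<open>limit_tail_le\<close>).

  Left tail of \<open>D\<close>. The Laplace transform \<open>V\<^bsub>n\<^esub>(\<theta>, x) = E exp (- \<theta> D\<^bsub>n\<^esub>[x])\<close> satisfies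
  \<open>V\<^bsub>n+1\<^esub>(\<theta>, x) = (E V\<^bsub>n\<^esub>(scale * \<theta>, x + X))\<^sup>2\<close>. The key point is that this monotone recursion has a
  supersolution \<open>exp (- v(\<theta>, x))\<close> with \<open>v \<ge> -1\<close> for all \<open>x\<close> and all small \<open>\<theta>\<close>
  (\<open>exponent_step\<close>). The exponent is \<open>\<theta> x exp (\<beta> x)\<close>, which is exactly preserved to first order,
  minus a correction of order \<open>\<theta>\<^sup>p\<close> that pays for the second-order error; here \<open>1 < p < \<gamma>\<close>, and
  subcriticality is what makes the correction contract. Far to the right the correction would win, and
  there \<open>v\<close> is cut off at \<open>0\<close>; this is allowed since from such a point a Gaussian step lands
  in a window where \<open>v \<ge> scale * \<theta>\<close> much more often than further left, where \<open>v\<close> may be negative.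
  So \<open>E exp (- \<theta> D\<^bsub>n\<^esub>[x])\<close> is bounded by \<open>e\<close> uniformly in \<open>n\<close> and \<open>x\<close>. Running the recursion
  for \<open>k\<close> more generations turns this into \<open>E exp (- \<theta> scale\<^sup>-\<^sup>k D\<^bsub>n+k\<^esub>[x]) \<le> exp (2\<^sup>k)\<close>, and since
  \<open>(2 * scale) powr \<gamma> = 2\<close>, Chernoff's bound with \<open>y\<close> of order \<open>(2 * scale)\<^sup>k\<close> yields
  \<open>exp (- c y powr \<gamma>)\<close> (\<open>derivative_left_tail\<close>).

  Ratio. Since \<open>D[x + y] = exp (\<beta> y) (D[x] + y W[x])\<close>, the event \<open>D[x] / W[x] < - y\<close> is
  \<open>D[x + y] < 0\<close>. With \<open>z = x + y\<close>, \<open>D[z] < 0\<close> forces either \<open>W[0] < exp (- \<beta> z / 4)\<close> or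
  \<open>D[z/2] < - (z/2) exp (\<beta> z / 4)\<close>. The second event is negligible by the uniform exponential moment. The
  first has probability at most \<open>C exp (- c z\<^sup>2)\<close>: both children must be small, which in the Laplace
  recursion for \<open>W\<close> squares the bound each time the scale grows by \<open>4/3\<close>, and \<open>2 > (4/3)\<^sup>2\<close>
  (\<open>additive_lower_tail\<close>). So the ratio has a Gaussian left tail, which is at
  least as strong as the exponent \<open>min \<gamma> 2\<close>. The prefactor \<open>C\<close> is removed because \<open>D[z] < 0\<close> has
  probability bounded away from \<open>1\<close> (\<open>derivative_nonneg_likely\<close>).

  Almost sure convergence of the martingales is needed because the limits are defined pathwise; it follows
  from \<open>E \<bar>D\<^bsub>n+1\<^esub>[x] - D\<^bsub>n\<^esub>[x]\<bar>\<^sup>p \<le> C rate\<^sup>n\<close> with \<open>rate < 1\<close>, a consequence of the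
  von Bahr--Esseen inequality applied to the last generation (\<open>derivative_increment_moment\<close>).
\<close>

section \<open>Gaussian integrals\<close>

abbreviation stdN :: "real measure" where "stdN \<equiv> density lborel (\<lambda>x. ennreal (std_normal_density x))"

lemma prob_space_stdN: "prob_space stdN"
  by (simp add: prob_space_normal_density)

text \<open>Exponential tilting shifts the mean; all moments below come from this identity.\<close>

lemma exp_times_std_normal:
  "exp (t * x) * std_normal_density x = exp (t\<^sup>2 / 2) * normal_density t 1 x"
  by (simp add: normal_density_def exp_add[symmetric] field_simps power2_eq_square)

lemma gauss_exp:
  "integrable stdN (\<lambda>x. exp (t * x))" "(\<integral>x. exp (t * x) \<partial>stdN) = exp (t\<^sup>2 / 2)"
proof -
  have e: "std_normal_density x *\<^sub>R exp (t * x) = exp (t\<^sup>2 / 2) * normal_density t 1 x" for x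
    using exp_times_std_normal[of t x] by (simp add: mult.commute)
  show "integrable stdN (\<lambda>x. exp (t * x))"
    by (subst integrable_density) (simp_all only: e, auto)
  show "(\<integral>x. exp (t * x) \<partial>stdN) = exp (t\<^sup>2 / 2)"
    by (subst integral_density) (simp_all only: e, auto)
qed

lemma gauss_id_exp:
  "integrable stdN (\<lambda>x. x * exp (t * x))" "(\<integral>x. x * exp (t * x) \<partial>stdN) = t * exp (t\<^sup>2 / 2)"
proof -
  have e: "std_normal_density x *\<^sub>R (x * exp (t * x)) = exp (t\<^sup>2 / 2) * (normal_density t 1 x * x)" for x
    using exp_times_std_normal[of t x] by (simp add: mult_ac)
  show "integrable stdN (\<lambda>x. x * exp (t * x))"
    by (subst integrable_density) (simp_all only: e, auto intro!: integrable_normal_moment_nz_1)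
  show "(\<integral>x. x * exp (t * x) \<partial>stdN) = t * exp (t\<^sup>2 / 2)"
    by (subst integral_density) (simp_all only: e, auto simp: integral_normal_moment_nz_1)
qed

lemma nn_gauss_exp: "(\<integral>\<^sup>+x. ennreal (exp (t * x)) \<partial>stdN) = ennreal (exp (t\<^sup>2 / 2))"
  using gauss_exp[of t] by (subst nn_integral_eq_integral) auto

lemma gauss_lower_tail:
  assumes "s \<ge> 0"
  shows "measure stdN {x. x \<le> - s} \<le> exp (- s\<^sup>2 / 2)"
proof -
  interpret prob_space stdN by (rule prob_space_stdN)
  have "emeasure stdN {x. x \<le> - s} = (\<integral>\<^sup>+x. indicator {x. x \<le> - s} x \<partial>stdN)"
    by (subst nn_integral_indicator) (auto simp: borel_closed closed_Collect_le)
  also have "\<dots> \<le> (\<integral>\<^sup>+x. ennreal (exp (- s\<^sup>2)) * ennreal (exp (- s * x)) \<partial>stdN)"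
  proof (rule nn_integral_mono)
    fix x
    show "indicator {x. x \<le> - s} x \<le> ennreal (exp (- s\<^sup>2)) * ennreal (exp (- s * x))"
    proof (cases "x \<le> -s")
      case True
      have "s * (x + s) \<le> 0" using True assms by (simp add: mult_nonneg_nonpos)
      hence "1 \<le> exp (- s\<^sup>2 - s * x)" by (simp add: power2_eq_square algebra_simps)
      also have "exp (- s\<^sup>2 - s * x) = exp (- s\<^sup>2) * exp (- s * x)" by (simp add: exp_add[symmetric])
      finally show ?thesis using True
        by (simp add: ennreal_mult'[symmetric] ennreal_1[symmetric] del: ennreal_1)
    qed simp
  qed
  also have "\<dots> = ennreal (exp (- s\<^sup>2)) * ennreal (exp (s\<^sup>2 / 2))"
    using nn_gauss_exp[of "-s"] by (subst nn_integral_cmult) auto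
  also have "\<dots> = ennreal (exp (- s\<^sup>2 / 2))"
    by (simp add: ennreal_mult'[symmetric] exp_add[symmetric])
  finally show ?thesis by (simp add: emeasure_eq_measure)
qed

text \<open>The crude lower bound: on the window the density is at least its value at distance \<open>m\<close> from the origin.\<close>

lemma gauss_window:
  assumes "\<bar>a\<bar> \<le> m" "\<bar>a + 1\<bar> \<le> m"
  shows "exp (- m\<^sup>2 / 2) / sqrt (2 * pi) \<le> measure stdN {a .. a + 1}"
proof -
  interpret prob_space stdN by (rule prob_space_stdN)
  have "ennreal (exp (- m\<^sup>2 / 2) / sqrt (2 * pi)) = (\<integral>\<^sup>+x. ennreal (exp (- m\<^sup>2 / 2) / sqrt (2 * pi)) * indicator {a..a+1} x \<partial>lborel)"
    by (subst nn_integral_cmult_indicator) auto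
  also have "\<dots> \<le> (\<integral>\<^sup>+x. ennreal (std_normal_density x) * indicator {a..a+1} x \<partial>lborel)"
  proof (rule nn_integral_mono)
    fix x
    show "ennreal (exp (- m\<^sup>2 / 2) / sqrt (2 * pi)) * indicator {a..a+1} x
      \<le> ennreal (std_normal_density x) * indicator {a..a+1} x"
    proof (cases "x \<in> {a..a+1}")
      case True
      hence "\<bar>x\<bar> \<le> \<bar>m\<bar>" using assms by auto
      hence "x\<^sup>2 \<le> m\<^sup>2" by (rule abs_le_square_iff[THEN iffD1])
      hence "exp (- m\<^sup>2 / 2) / sqrt (2 * pi) \<le> std_normal_density x"
        by (simp add: std_normal_density_def divide_simps)
      thus ?thesis using True by (simp add: ennreal_leI)
    qed simp
  qed
  also have "\<dots> = emeasure stdN {a..a+1}"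
    by (subst emeasure_density) auto
  finally show ?thesis by (simp add: emeasure_eq_measure)
qed

section \<open>Branching at the root\<close>

abbreviation subtree :: "(vertex \<Rightarrow> 'a \<Rightarrow> real) \<Rightarrow> bool \<Rightarrow> vertex \<Rightarrow> 'a \<Rightarrow> real" where
  "subtree \<xi> b \<equiv> (\<lambda>v. \<xi> (b # v))"

lemma finite_prefixes: "finite {v. P v \<and> prefix v u}"
  by (rule finite_subset[of _ "set (prefixes u)"]) auto

lemma finite_words [simp]: "finite {u :: bool list. length u = n}"
  using finite_lists_length_eq[of "UNIV :: bool set" n] by simp

lemma brw_pos_Nil [simp]: "brw_pos \<xi> [] \<omega> = 0"
  unfolding brw_pos_def by (rule sum.neutral) auto

lemma brw_pos_Cons: "brw_pos \<xi> (b # u) \<omega> = \<xi> [b] \<omega> + brw_pos (subtree \<xi> b) u \<omega>"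
proof -
  have "{v. strict_prefix [] v \<and> prefix v (b # u)} = insert [b] ((#) b ` {v. strict_prefix [] v \<and> prefix v u})"
    by (auto simp: prefix_Cons strict_prefix_def)
  hence "brw_pos \<xi> (b # u) \<omega> = (\<Sum>v\<in>insert [b] ((#) b ` {v. strict_prefix [] v \<and> prefix v u}). \<xi> v \<omega>)"
    unfolding brw_pos_def by simp
  also have "\<dots> = \<xi> [b] \<omega> + (\<Sum>v\<in>(#) b ` {v. strict_prefix [] v \<and> prefix v u}. \<xi> v \<omega>)"
    by (subst sum.insert) (auto intro: finite_prefixes)
  also have "(\<Sum>v\<in>(#) b ` {v. strict_prefix [] v \<and> prefix v u}. \<xi> v \<omega>) = brw_pos (subtree \<xi> b) u \<omega>"
    unfolding brw_pos_def by (subst sum.reindex) auto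
  finally show ?thesis .
qed

lemma brw_pos_snoc: "brw_pos \<xi> (u @ [b]) \<omega> = brw_pos \<xi> u \<omega> + \<xi> (u @ [b]) \<omega>"
  by (induction u arbitrary: \<xi>) (simp_all add: brw_pos_Cons)

lemma words_Suc_Cons: "{u :: bool list. length u = Suc n} = (#) False ` {u. length u = n} \<union> (#) True ` {u. length u = n}"
  by (auto simp: length_Suc_conv image_iff)

lemma sum_words_Suc_Cons:
  fixes f :: "bool list \<Rightarrow> real"
  shows "(\<Sum>u | length u = Suc n. f u) = (\<Sum>u | length u = n. f (False # u)) + (\<Sum>u | length u = n. f (True # u))"
  unfolding words_Suc_Cons by (subst sum.union_disjoint) (auto simp: sum.reindex)

lemma words_Suc_snoc: "{u :: bool list. length u = Suc n} = (\<lambda>u. u @ [False]) ` {u. length u = n} \<union> (\<lambda>u. u @ [True]) ` {u. length u = n}"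
  by (auto simp: length_Suc_conv_rev image_iff)

lemma sum_words_Suc_snoc:
  fixes f :: "bool list \<Rightarrow> real"
  shows "(\<Sum>u | length u = Suc n. f u) = (\<Sum>u | length u = n. f (u @ [False]) + f (u @ [True]))"
  unfolding words_Suc_snoc
  by (subst sum.union_disjoint) (auto simp: sum.reindex inj_on_def sum.distrib)

lemma additive_mart_0 [simp]: "additive_mart \<xi> x \<beta> 0 \<omega> = exp (\<beta> * x)"
  by (simp add: additive_mart_def)

lemma derivative_mart_0 [simp]: "derivative_mart \<xi> x \<beta> 0 \<omega> = x * exp (\<beta> * x)"
  by (simp add: derivative_mart_def)

lemma additive_mart_pos: "additive_mart \<xi> x \<beta> n \<omega> > 0"
proof -
  have "replicate n True \<in> {u. length u = n}" by simp
  hence "{u :: bool list. length u = n} \<noteq> {}" by blast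
  hence "(\<Sum>u | length u = n. exp (\<beta> * (x + brw_pos \<xi> u \<omega>) - \<beta>\<^sup>2 / 2 * real n)) > 0"
    by (intro sum_pos) auto
  thus ?thesis unfolding additive_mart_def by simp
qed

text \<open>Moving the starting point mixes the two martingales. This turns statements about the ratio into statements about signs.\<close>

lemma mart_shift:
  "additive_mart \<xi> (x + h) \<beta> n \<omega> = exp (\<beta> * h) * additive_mart \<xi> x \<beta> n \<omega>"
  "derivative_mart \<xi> (x + h) \<beta> n \<omega> =
     exp (\<beta> * h) * (derivative_mart \<xi> x \<beta> n \<omega> + h * additive_mart \<xi> x \<beta> n \<omega>)"
proof -
  have e: "exp (\<beta> * (x + h + s) - c) = exp (\<beta> * h) * exp (\<beta> * (x + s) - c)" for s c
    by (simp add: exp_add[symmetric] algebra_simps)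
  show "additive_mart \<xi> (x + h) \<beta> n \<omega> = exp (\<beta> * h) * additive_mart \<xi> x \<beta> n \<omega>"
    by (simp add: additive_mart_def e sum_distrib_left[symmetric])
  show "derivative_mart \<xi> (x + h) \<beta> n \<omega> =
     exp (\<beta> * h) * (derivative_mart \<xi> x \<beta> n \<omega> + h * additive_mart \<xi> x \<beta> n \<omega>)"
    unfolding derivative_mart_def additive_mart_def e
    by (simp add: sum_distrib_left sum.distrib[symmetric] algebra_simps)
qed

text \<open>A child at \<open>\<xi>\<close> is treated as a new root started at \<open>x + \<xi> - \<beta>\<close>: subtracting the drift makes the recursion time-homogeneous and the factor \<open>exp (\<beta>\<^sup>2 / 2) / 2\<close> constant.\<close>

lemma mart_Suc:
  "additive_mart \<xi> x \<beta> (Suc n) \<omega> = exp (\<beta>\<^sup>2 / 2) / 2 *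
     (additive_mart (subtree \<xi> False) (x + \<xi> [False] \<omega> - \<beta>) \<beta> n \<omega> +
      additive_mart (subtree \<xi> True) (x + \<xi> [True] \<omega> - \<beta>) \<beta> n \<omega>)"
  "derivative_mart \<xi> x \<beta> (Suc n) \<omega> = exp (\<beta>\<^sup>2 / 2) / 2 *
     (derivative_mart (subtree \<xi> False) (x + \<xi> [False] \<omega> - \<beta>) \<beta> n \<omega> +
      derivative_mart (subtree \<xi> True) (x + \<xi> [True] \<omega> - \<beta>) \<beta> n \<omega>)"
proof -
  have e: "exp (\<beta> * (x + (s + t)) - \<beta>\<^sup>2 / 2 * real (Suc n)) = exp (\<beta>\<^sup>2 / 2) * exp (\<beta> * (x + s - \<beta> + t) - \<beta>\<^sup>2 / 2 * real n)" for s t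
    by (simp add: exp_add[symmetric] algebra_simps power2_eq_square)
  have f: "x + (s + t) - \<beta> * real (Suc n) = x + s - \<beta> + t - \<beta> * real n" for s t
    by (simp add: algebra_simps)
  show "additive_mart \<xi> x \<beta> (Suc n) \<omega> = exp (\<beta>\<^sup>2 / 2) / 2 *
     (additive_mart (subtree \<xi> False) (x + \<xi> [False] \<omega> - \<beta>) \<beta> n \<omega> +
      additive_mart (subtree \<xi> True) (x + \<xi> [True] \<omega> - \<beta>) \<beta> n \<omega>)"
    unfolding additive_mart_def sum_words_Suc_Cons brw_pos_Cons e sum_distrib_left[symmetric] by (simp add: field_simps)
  have g: "p * (exp (\<beta>\<^sup>2 / 2) * q) = exp (\<beta>\<^sup>2 / 2) * (p * q)" for p q by simp
  show "derivative_mart \<xi> x \<beta> (Suc n) \<omega> = exp (\<beta>\<^sup>2 / 2) / 2 *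
     (derivative_mart (subtree \<xi> False) (x + \<xi> [False] \<omega> - \<beta>) \<beta> n \<omega> +
      derivative_mart (subtree \<xi> True) (x + \<xi> [True] \<omega> - \<beta>) \<beta> n \<omega>)"
    unfolding derivative_mart_def sum_words_Suc_Cons brw_pos_Cons e f g sum_distrib_left[symmetric] by (simp add: field_simps)
qed

lemma (in prob_space) nn_integral_indep_var:
  assumes ind: "indep_var S X T Y" and f: "f \<in> borel_measurable (S \<Otimes>\<^sub>M T)"
  shows "(\<integral>\<^sup>+\<omega>. f (X \<omega>, Y \<omega>) \<partial>M) = (\<integral>\<^sup>+s. \<integral>\<^sup>+\<omega>. f (s, Y \<omega>) \<partial>M \<partial>distr M S X)"
proof -
  have X[measurable]: "X \<in> measurable M S" and Y[measurable]: "Y \<in> measurable M T"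
    using ind by (blast dest: indep_var_rv1 indep_var_rv2)+
  interpret Y: prob_space "distr M T Y" by (rule prob_space_distr) simp
  note f[measurable]
  have "(\<integral>\<^sup>+\<omega>. f (X \<omega>, Y \<omega>) \<partial>M) = (\<integral>\<^sup>+z. f z \<partial>distr M (S \<Otimes>\<^sub>M T) (\<lambda>\<omega>. (X \<omega>, Y \<omega>)))"
    by (subst nn_integral_distr) auto
  also have "\<dots> = (\<integral>\<^sup>+z. f z \<partial>(distr M S X \<Otimes>\<^sub>M distr M T Y))"
    using ind by (simp add: indep_var_distribution_eq)
  also have "\<dots> = (\<integral>\<^sup>+s. \<integral>\<^sup>+t. f (s, t) \<partial>distr M T Y \<partial>distr M S X)"
    by (subst Y.nn_integral_fst) auto
  also have "\<dots> = (\<integral>\<^sup>+s. \<integral>\<^sup>+\<omega>. f (s, Y \<omega>) \<partial>M \<partial>distr M S X)"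
    by (intro nn_integral_cong) (subst nn_integral_distr, auto)
  finally show ?thesis .
qed

context gaussian_labels
begin

lemma labels_measurable [measurable]: "\<xi> v \<in> borel_measurable M"
  using indep_labels by (simp add: indep_vars_def)

lemma distr_label: "distr M borel (\<xi> v) = stdN"
proof -
  have "distr M borel (\<xi> v) = distr M lborel (\<xi> v)" by (rule distr_cong) auto
  thus ?thesis using distributed_distr_eq_density[OF std_normal_labels[of v]] by simp
qed

lemma brw_pos_measurable [measurable]: "brw_pos \<xi> u \<in> borel_measurable M"
  unfolding brw_pos_def[abs_def] by measurable

lemma additive_mart_measurable [measurable]: "additive_mart \<xi> x \<beta> n \<in> borel_measurable M"
  unfolding additive_mart_def[abs_def] by measurable

lemma derivative_mart_measurable [measurable]: "derivative_mart \<xi> x \<beta> n \<in> borel_measurable M"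
  unfolding derivative_mart_def[abs_def] by measurable

text \<open>The label \<open>\<xi> [b]\<close> becomes the label of the root of the subtree, on which no position depends; this makes the subtree independent of the step that leads to it.\<close>

lemma gaussian_labels_subtree: "gaussian_labels M (subtree \<xi> b)"
proof (intro gaussian_labels.intro gaussian_labels_axioms.intro)
  show "prob_space M" by (rule prob_space_axioms)
  show "distributed M lborel (\<xi> (b # v)) std_normal_density" for v by (rule std_normal_labels)
  have "indep_vars (\<lambda>v. PiM {b # v} (\<lambda>_. borel)) (\<lambda>v \<omega>. restrict (\<lambda>i. \<xi> i \<omega>) {b # v}) UNIV"
    by (rule indep_vars_restrict[OF indep_labels]) (auto simp: disjoint_family_on_def)
  hence "indep_vars (\<lambda>v. borel) (\<lambda>v \<omega>. (\<lambda>f. f (b # v)) (restrict (\<lambda>i. \<xi> i \<omega>) {b # v})) UNIV"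
    by (rule indep_vars_compose2) auto
  thus "indep_vars (\<lambda>_. borel) (subtree \<xi> b) UNIV" by simp
qed

end

text \<open>The two label families may live on different sample spaces; this allows a martingale of the tree to be read as a function on a product space of labels.\<close>

lemma mart_cong:
  assumes "\<And>v. v \<noteq> [] \<Longrightarrow> \<xi> v \<omega> = \<zeta> v \<eta>"
  shows "brw_pos \<xi> u \<omega> = brw_pos \<zeta> u \<eta>" "additive_mart \<xi> x \<beta> n \<omega> = additive_mart \<zeta> x \<beta> n \<eta>"
    "derivative_mart \<xi> x \<beta> n \<omega> = derivative_mart \<zeta> x \<beta> n \<eta>"
proof -
  show *: "brw_pos \<xi> u \<omega> = brw_pos \<zeta> u \<eta>" for u
    unfolding brw_pos_def by (rule sum.cong) (auto intro!: assms)
  show "additive_mart \<xi> x \<beta> n \<omega> = additive_mart \<zeta> x \<beta> n \<eta>"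
    "derivative_mart \<xi> x \<beta> n \<omega> = derivative_mart \<zeta> x \<beta> n \<eta>"
    by (simp_all add: additive_mart_def derivative_mart_def *)
qed

text \<open>Here the sample point \<open>f\<close> is the label configuration itself, so that independence of blocks of labels applies to the martingales of a subtree.\<close>

lemma coordinate_mart_measurable:
  assumes "\<And>v. v \<noteq> [] \<Longrightarrow> b # v \<in> A"
  shows "(\<lambda>f. additive_mart (\<lambda>v f. f (b # v)) x \<beta> n f) \<in> borel_measurable (PiM A (\<lambda>_. borel))"
    "(\<lambda>f. derivative_mart (\<lambda>v f. f (b # v)) x \<beta> n f) \<in> borel_measurable (PiM A (\<lambda>_. borel))"
proof -
  have [measurable]: "(\<lambda>f. brw_pos (\<lambda>v f. f (b # v)) u f) \<in> borel_measurable (PiM A (\<lambda>_. borel))" for u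
    unfolding brw_pos_def by (intro borel_measurable_sum measurable_component_singleton) (auto intro: assms)
  show "(\<lambda>f. additive_mart (\<lambda>v f. f (b # v)) x \<beta> n f) \<in> borel_measurable (PiM A (\<lambda>_. borel))"
    "(\<lambda>f. derivative_mart (\<lambda>v f. f (b # v)) x \<beta> n f) \<in> borel_measurable (PiM A (\<lambda>_. borel))"
    unfolding additive_mart_def derivative_mart_def by measurable
qed

context gaussian_labels
begin

lemma nn_integral_child_subtree:
  assumes F[measurable]: "F \<in> borel_measurable (borel \<Otimes>\<^sub>M borel \<Otimes>\<^sub>M borel)"
  shows "(\<integral>\<^sup>+\<omega>. F (\<xi> [b] \<omega>, additive_mart (subtree \<xi> b) 0 \<beta> n \<omega>, derivative_mart (subtree \<xi> b) 0 \<beta> n \<omega>) \<partial>M)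
    = (\<integral>\<^sup>+s. \<integral>\<^sup>+\<omega>. F (s, additive_mart (subtree \<xi> b) 0 \<beta> n \<omega>, derivative_mart (subtree \<xi> b) 0 \<beta> n \<omega>) \<partial>M \<partial>stdN)"
proof -
  define B where "B = {b # v | v. v \<noteq> []}"
  have ind: "indep_var (PiM {[b]} (\<lambda>_. borel)) (\<lambda>\<omega>. restrict (\<lambda>i. \<xi> i \<omega>) {[b]}) (PiM B (\<lambda>_. borel)) (\<lambda>\<omega>. restrict (\<lambda>i. \<xi> i \<omega>) B)"
    by (rule indep_var_restrict[OF indep_labels]) (auto simp: B_def)
  define h where "h = (\<lambda>f. (additive_mart (\<lambda>v f. f (b # v)) 0 \<beta> n f, derivative_mart (\<lambda>v f. f (b # v)) 0 \<beta> n f))"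
  have h[measurable]: "h \<in> measurable (PiM B (\<lambda>_. borel)) (borel \<Otimes>\<^sub>M borel)"
    unfolding h_def by (intro measurable_Pair coordinate_mart_measurable) (auto simp: B_def)
  have hY: "h (restrict (\<lambda>i. \<xi> i \<omega>) B) = (additive_mart (subtree \<xi> b) 0 \<beta> n \<omega>, derivative_mart (subtree \<xi> b) 0 \<beta> n \<omega>)" for \<omega>
    by (auto simp: h_def B_def intro!: mart_cong)
  have [measurable]: "(\<lambda>f. f [b]) \<in> borel_measurable (PiM {[b]} (\<lambda>_. borel))" by simp
  have Fm: "(\<lambda>(f, g). F (f [b], h g)) \<in> borel_measurable (PiM {[b]} (\<lambda>_. borel) \<Otimes>\<^sub>M PiM B (\<lambda>_. borel))"
    by measurable
  have "(\<integral>\<^sup>+\<omega>. F (\<xi> [b] \<omega>, h (restrict (\<lambda>i. \<xi> i \<omega>) B)) \<partial>M) =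
      (\<integral>\<^sup>+f. \<integral>\<^sup>+\<omega>. F (f [b], h (restrict (\<lambda>i. \<xi> i \<omega>) B)) \<partial>M \<partial>distr M (PiM {[b]} (\<lambda>_. borel)) (\<lambda>\<omega>. restrict (\<lambda>i. \<xi> i \<omega>) {[b]}))"
    using nn_integral_indep_var[OF ind Fm] by simp
  also have "\<dots> = (\<integral>\<^sup>+\<eta>. \<integral>\<^sup>+\<omega>. F (\<xi> [b] \<eta>, h (restrict (\<lambda>i. \<xi> i \<omega>) B)) \<partial>M \<partial>M)"
    by (subst nn_integral_distr) auto
  also have "\<dots> = (\<integral>\<^sup>+s. \<integral>\<^sup>+\<omega>. F (s, h (restrict (\<lambda>i. \<xi> i \<omega>) B)) \<partial>M \<partial>distr M borel (\<xi> [b]))"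
    by (subst nn_integral_distr) auto
  finally show ?thesis by (simp add: hY distr_label)
qed

lemma nn_integral_sibling_subtrees:
  fixes \<beta> :: real and n :: nat
  assumes F[measurable]: "F \<in> borel_measurable (borel \<Otimes>\<^sub>M borel \<Otimes>\<^sub>M borel)"
  defines "Z \<equiv> \<lambda>b \<omega>. F (\<xi> [b] \<omega>, additive_mart (subtree \<xi> b) 0 \<beta> n \<omega>, derivative_mart (subtree \<xi> b) 0 \<beta> n \<omega>)"
  shows "(\<integral>\<^sup>+\<omega>. Z False \<omega> * Z True \<omega> \<partial>M) = (\<integral>\<^sup>+\<omega>. Z False \<omega> \<partial>M) * (\<integral>\<^sup>+\<omega>. Z True \<omega> \<partial>M)"
proof -
  define B where "B = (\<lambda>b::bool. range ((#) b))"
  have ind: "indep_var (PiM (B False) (\<lambda>_. borel)) (\<lambda>\<omega>. restrict (\<lambda>i. \<xi> i \<omega>) (B False)) (PiM (B True) (\<lambda>_. borel)) (\<lambda>\<omega>. restrict (\<lambda>i. \<xi> i \<omega>) (B True))"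
    by (rule indep_var_restrict[OF indep_labels]) (auto simp: B_def)
  define h where "h = (\<lambda>b f. F (f [b], additive_mart (\<lambda>v f. f (b # v)) 0 \<beta> n f, derivative_mart (\<lambda>v f. f (b # v)) 0 \<beta> n f))"
  have h: "h b \<in> borel_measurable (PiM (B b) (\<lambda>_. borel))" for b
    unfolding h_def
    by (intro measurable_compose[OF _ F] measurable_Pair coordinate_mart_measurable measurable_component_singleton) (auto simp: B_def)
  have Z: "Z b = h b \<circ> (\<lambda>\<omega>. restrict (\<lambda>i. \<xi> i \<omega>) (B b))" for b
  proof
    fix \<omega>
    have "additive_mart (subtree \<xi> b) 0 \<beta> n \<omega> = additive_mart (\<lambda>v f. f (b # v)) 0 \<beta> n (restrict (\<lambda>i. \<xi> i \<omega>) (B b))"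
      "derivative_mart (subtree \<xi> b) 0 \<beta> n \<omega> = derivative_mart (\<lambda>v f. f (b # v)) 0 \<beta> n (restrict (\<lambda>i. \<xi> i \<omega>) (B b))"
      by (rule mart_cong, simp add: B_def)+
    thus "Z b \<omega> = (h b \<circ> (\<lambda>\<omega>. restrict (\<lambda>i. \<xi> i \<omega>) (B b))) \<omega>"
      by (simp add: Z_def h_def B_def)
  qed
  have ind: "indep_var borel (Z False) borel (Z True)"
    unfolding Z by (rule indep_var_compose[OF ind]) (rule h)+
  have [measurable]: "Z b \<in> borel_measurable M" for b
    using indep_var_rv1[OF ind] indep_var_rv2[OF ind] by (cases b) simp_all
  have "(\<integral>\<^sup>+\<omega>. Z False \<omega> * Z True \<omega> \<partial>M) = (\<integral>\<^sup>+s. \<integral>\<^sup>+\<omega>. s * Z True \<omega> \<partial>M \<partial>distr M borel (Z False))"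
    using nn_integral_indep_var[OF ind, of "\<lambda>(s, t). s * t"] by simp
  also have "\<dots> = (\<integral>\<^sup>+s. s * (\<integral>\<^sup>+\<omega>. Z True \<omega> \<partial>M) \<partial>distr M borel (Z False))"
    by (intro nn_integral_cong nn_integral_cmult) auto
  also have "\<dots> = (\<integral>\<^sup>+s. s \<partial>distr M borel (Z False)) * (\<integral>\<^sup>+\<omega>. Z True \<omega> \<partial>M)"
    by (rule nn_integral_multc) auto
  also have "(\<integral>\<^sup>+s. s \<partial>distr M borel (Z False)) = (\<integral>\<^sup>+\<omega>. Z False \<omega> \<partial>M)"
    by (subst nn_integral_distr) auto
  finally show ?thesis .
qed

text \<open>The probabilistic content of the recursion \<open>mart_Suc\<close>: the two halves are independent, and in each of them the first step may be integrated separately with the subtree started at the resulting position.\<close>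

lemma nn_integral_branching:
  fixes G :: "real \<times> real \<Rightarrow> ennreal" and \<beta> :: real and n :: nat
  assumes G[measurable]: "G \<in> borel_measurable (borel \<Otimes>\<^sub>M borel)"
  defines "Y \<equiv> \<lambda>b z \<omega>. G (additive_mart (subtree \<xi> b) z \<beta> n \<omega>, derivative_mart (subtree \<xi> b) z \<beta> n \<omega>)"
  shows "(\<integral>\<^sup>+\<omega>. Y False (x + \<xi> [False] \<omega> - \<beta>) \<omega> * Y True (x + \<xi> [True] \<omega> - \<beta>) \<omega> \<partial>M) =
    (\<integral>\<^sup>+s. \<integral>\<^sup>+\<omega>. Y False (x + s - \<beta>) \<omega> \<partial>M \<partial>stdN) * (\<integral>\<^sup>+s. \<integral>\<^sup>+\<omega>. Y True (x + s - \<beta>) \<omega> \<partial>M \<partial>stdN)"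
proof -
  define F where "F = (\<lambda>(s, w, d). G (exp (\<beta> * (x + s - \<beta>)) * w, exp (\<beta> * (x + s - \<beta>)) * (d + (x + s - \<beta>) * w)))"
  have F: "F \<in> borel_measurable (borel \<Otimes>\<^sub>M borel \<Otimes>\<^sub>M borel)"
    unfolding F_def by measurable
  have Y: "Y b (x + s - \<beta>) \<omega> = F (s, additive_mart (subtree \<xi> b) 0 \<beta> n \<omega>, derivative_mart (subtree \<xi> b) 0 \<beta> n \<omega>)" for b s \<omega>
    using mart_shift[of "subtree \<xi> b" 0 "x + s - \<beta>" \<beta> n \<omega>] by (simp add: Y_def F_def)
  show ?thesis
    unfolding Y nn_integral_sibling_subtrees[OF F] nn_integral_child_subtree[OF F] ..
qed

end

section \<open>Subcritical parameters and contraction of moments\<close>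

lemma powr_add_le:
  fixes a b p :: real
  assumes "0 \<le> a" "0 \<le> b" "0 \<le> p" "p \<le> 2"
  shows "(a + b) powr p \<le> 4 * (a powr p + b powr p)"
proof -
  define m where "m = max a b"
  have "(a + b) powr p \<le> (2 * m) powr p"
    using assms by (intro powr_mono2) (auto simp: m_def)
  also have "\<dots> = 2 powr p * m powr p" using assms by (simp add: powr_mult m_def)
  also have "\<dots> \<le> 4 * m powr p"
  proof (rule mult_right_mono)
    have "(2::real) powr p \<le> 2 powr 2" using assms by (intro powr_mono) auto
    thus "(2::real) powr p \<le> 4" by simp
  qed auto
  also have "m powr p \<le> a powr p + b powr p"
    by (auto simp: m_def max_def)
  finally show ?thesis by simp
qed

text \<open>A second-order Taylor bound with the exponent lowered to \<open>p\<close>, since moments of order two need not contract. For large positive \<open>t\<close> the power dominates the negative linear term.\<close>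

lemma exp_minus_le_powr:
  fixes t p :: real
  assumes "- 1 \<le> t" "1 \<le> p" "p \<le> 2"
  shows "exp (- t) \<le> 1 - t + \<bar>t\<bar> powr p"
proof (cases "t \<le> 1")
  case True
  have "exp (- t) \<le> 1 + (- t) + (- t)\<^sup>2"
  proof (cases "t \<le> 0")
    case True
    thus ?thesis using exp_bound[of "-t"] assms by simp
  next
    case False
    have "1 \<le> (1 - t + t\<^sup>2) * (1 + t)" using False by (simp add: algebra_simps power2_eq_square)
    also have "\<dots> \<le> (1 - t + t\<^sup>2) * exp t"
    proof (rule mult_left_mono)
      show "0 \<le> 1 - t + t\<^sup>2" using sum_power2_ge_zero[of "t - 1/2" 0] by (simp add: power2_eq_square algebra_simps)
    qed (rule exp_ge_add_one_self)
    finally show ?thesis by (simp add: exp_minus field_simps)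
  qed
  also have "(- t)\<^sup>2 \<le> \<bar>t\<bar> powr p"
  proof (cases "t = 0")
    case False
    have "(- t)\<^sup>2 = \<bar>t\<bar> powr 2" using False by simp
    also have "\<dots> \<le> \<bar>t\<bar> powr p" using assms True by (intro powr_mono') auto
    finally show ?thesis .
  qed simp
  finally show ?thesis by simp
next
  case False
  have "t powr 1 \<le> t powr p" using False assms by (intro powr_mono) auto
  hence "t \<le> \<bar>t\<bar> powr p" using False by simp
  moreover have "exp (-t) \<le> 1" using False by simp
  ultimately show ?thesis by linarith
qed

text \<open>For \<open>r = p\<close> the quantity below equals \<open>exp ((p - 1) (p \<beta>\<^sup>2 / 2 - ln 2))\<close>, which is less than 1 for \<open>1 < p < \<gamma>\<close>: it is the
  factor by which a \<open>p\<close>-th moment changes per generation. Perturbing the exponential to \<open>p \<plusminus> \<epsilon>\<close> makes room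
  for the polynomial factor of the derivative martingale.\<close>

locale subcritical =
  fixes \<beta> p \<epsilon> :: real
  assumes \<beta>_pos: "0 < \<beta>" and p_gt_1: "1 < p" and p_le_2: "p \<le> 2"
    and \<epsilon>_pos: "0 < \<epsilon>" and \<epsilon>_less_p: "\<epsilon> < p"
    and rate_less_1: "\<And>r. r \<in> {p - \<epsilon>, p + \<epsilon>} \<Longrightarrow>
      2 * (exp (\<beta>\<^sup>2 / 2) / 2) powr p * exp (\<beta>\<^sup>2 * (r\<^sup>2 / 2 - r)) < 1"

lemma subcritical_exists:
  assumes "0 < \<beta>" "\<beta> < beta_c"
  obtains p \<epsilon> where "subcritical \<beta> p \<epsilon>"
proof -
  have b2: "\<beta>\<^sup>2 < 2 * ln 2"
  proof -
    have "\<beta>\<^sup>2 < beta_c\<^sup>2" using assms by (intro power_strict_mono) auto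
    thus ?thesis by (simp add: beta_c_def)
  qed
  define p where "p = min 2 ((1 + 2 * ln 2 / \<beta>\<^sup>2) / 2)"
  have g: "2 * ln 2 / \<beta>\<^sup>2 > 1" using b2 assms by (simp add: field_simps)
  have p: "1 < p" "p \<le> 2" using g by (auto simp: p_def)
  have "p < 2 * ln 2 / \<beta>\<^sup>2" using g by (auto simp: p_def min_def)
  hence pb: "p * \<beta>\<^sup>2 / 2 - ln 2 < 0" using assms by (simp add: field_simps)
  define f where "f = (\<lambda>r. ln 2 + p * (\<beta>\<^sup>2 / 2 - ln 2) + \<beta>\<^sup>2 * (r\<^sup>2 / 2 - r) :: real)"
  have fp: "f p < 0"
  proof -
    have "f p = (p - 1) * (p * \<beta>\<^sup>2 / 2 - ln 2)" by (simp add: f_def power2_eq_square field_simps)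
    thus ?thesis using p pb by (simp add: mult_pos_neg)
  qed
  have "isCont f p" unfolding f_def by (intro continuous_intros) auto
  hence "(f \<longlongrightarrow> f p) (at p)" by (simp add: isCont_def)
  hence "eventually (\<lambda>r. f r < 0) (at p)" using fp by (rule order_tendstoD)
  then obtain d where d: "d > 0" "\<And>r. r \<noteq> p \<Longrightarrow> dist r p < d \<Longrightarrow> f r < 0"
    by (auto simp: eventually_at)
  define e where "e = min (d / 2) (1 / 2)"
  have e: "0 < e" "e < d" "e < p" using d p by (auto simp: e_def)
  have ef: "2 * (exp (\<beta>\<^sup>2 / 2) / 2) powr p * exp (\<beta>\<^sup>2 * (r\<^sup>2 / 2 - r)) = exp (f r)" for r
  proof -
    have "(exp (\<beta>\<^sup>2 / 2) / 2) = exp (\<beta>\<^sup>2 / 2 - ln 2)" by (simp add: exp_diff)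
    hence "(exp (\<beta>\<^sup>2 / 2) / 2) powr p = exp (p * (\<beta>\<^sup>2 / 2 - ln 2))"
      by (simp add: powr_def)
    moreover have "(2::real) = exp (ln 2)" by simp
    ultimately show ?thesis by (simp only: f_def exp_add)
  qed
  have "subcritical \<beta> p e"
  proof
    fix r assume r: "r \<in> {p - e, p + e}"
    have "f r < 0" using r e by (intro d) (auto simp: dist_real_def)
    thus "2 * (exp (\<beta>\<^sup>2 / 2) / 2) powr p * exp (\<beta>\<^sup>2 * (r\<^sup>2 / 2 - r)) < 1"
      unfolding ef by simp
  qed (use assms p e in auto)
  thus ?thesis by (rule that)
qed

lemma tilted_gauss:
  "integrable stdN (\<lambda>s. exp (r * (x + s - \<beta>)))"
  "(\<integral>s. exp (r * (x + s - \<beta>)) \<partial>stdN) = exp (r * x) * exp (r\<^sup>2 / 2 - r * \<beta>)"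
proof -
  have e: "exp (r * (x + s - \<beta>)) = exp (r * x - r * \<beta>) * exp (r * s)" for s
    by (simp add: exp_add[symmetric] algebra_simps)
  show "integrable stdN (\<lambda>s. exp (r * (x + s - \<beta>)))"
    unfolding e by (intro integrable_mult_right gauss_exp)
  show "(\<integral>s. exp (r * (x + s - \<beta>)) \<partial>stdN) = exp (r * x) * exp (r\<^sup>2 / 2 - r * \<beta>)"
    unfolding e integral_mult_right_zero gauss_exp by (simp add: exp_add[symmetric] algebra_simps)
qed

text \<open>Under the tilted measure the step \<open>s - \<beta>\<close> is centred, so \<open>x exp (\<beta> x)\<close> is an eigenfunction of the step.\<close>

lemma tilted_gauss_id:
  "integrable stdN (\<lambda>s. (x + s - \<beta>) * exp (\<beta> * (x + s - \<beta>)))"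
  "(\<integral>s. (x + s - \<beta>) * exp (\<beta> * (x + s - \<beta>)) \<partial>stdN) = x * exp (\<beta> * x) * exp (- \<beta>\<^sup>2 / 2)"
proof -
  have e: "(x + s - \<beta>) * exp (\<beta> * (x + s - \<beta>)) =
     (x - \<beta>) * exp (\<beta> * (x + s - \<beta>)) + exp (\<beta> * x - \<beta>\<^sup>2) * (s * exp (\<beta> * s))" for s
  proof -
    have "exp (\<beta> * (x + s - \<beta>)) = exp (\<beta> * x - \<beta>\<^sup>2) * exp (\<beta> * s)"
      by (simp add: exp_add[symmetric] algebra_simps power2_eq_square)
    thus ?thesis by (simp add: algebra_simps)
  qed
  have i: "integrable stdN (\<lambda>s. (x - \<beta>) * exp (\<beta> * (x + s - \<beta>)))" "integrable stdN (\<lambda>s. exp (\<beta> * x - \<beta>\<^sup>2) * (s * exp (\<beta> * s)))"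
    by (intro integrable_mult_right tilted_gauss gauss_id_exp)+
  show "integrable stdN (\<lambda>s. (x + s - \<beta>) * exp (\<beta> * (x + s - \<beta>)))"
    unfolding e using i by (rule Bochner_Integration.integrable_add)
  have "(\<integral>s. (x + s - \<beta>) * exp (\<beta> * (x + s - \<beta>)) \<partial>stdN)
     = (x - \<beta>) * (exp (\<beta> * x) * exp (\<beta>\<^sup>2 / 2 - \<beta> * \<beta>)) + exp (\<beta> * x - \<beta>\<^sup>2) * (\<beta> * exp (\<beta>\<^sup>2 / 2))"
    unfolding e using i by (subst Bochner_Integration.integral_add) (simp_all add: tilted_gauss gauss_id_exp)
  also have "\<dots> = (x - \<beta>) * exp (\<beta> * x - \<beta>\<^sup>2 / 2) + \<beta> * exp (\<beta> * x - \<beta>\<^sup>2 / 2)"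
  proof -
    have "exp (\<beta> * x) * exp (\<beta>\<^sup>2 / 2 - \<beta> * \<beta>) = exp (\<beta> * x - \<beta>\<^sup>2 / 2)" "exp (\<beta> * x - \<beta>\<^sup>2) * exp (\<beta>\<^sup>2 / 2) = exp (\<beta> * x - \<beta>\<^sup>2 / 2)"
      by (simp_all add: exp_add[symmetric] power2_eq_square)
    thus ?thesis by (simp add: mult.left_commute)
  qed
  also have "\<dots> = x * (exp (\<beta> * x) * exp (- \<beta>\<^sup>2 / 2))"
    by (simp add: exp_add[symmetric] algebra_simps)
  finally show "(\<integral>s. (x + s - \<beta>) * exp (\<beta> * (x + s - \<beta>)) \<partial>stdN) = x * exp (\<beta> * x) * exp (- \<beta>\<^sup>2 / 2)" by simp
qed

lemma minus_le_id_exp: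
  fixes \<beta> x :: real
  assumes "\<beta> > 0" shows "- 1 / \<beta> \<le> x * exp (\<beta> * x)"
proof -
  have "- (\<beta> * x) \<le> exp (- (\<beta> * x))" using exp_ge_add_one_self[of "-(\<beta>*x)"] by linarith
  hence "- (\<beta> * x) * exp (\<beta> * x) \<le> exp (- (\<beta> * x)) * exp (\<beta> * x)" by (intro mult_right_mono) auto
  hence "- (\<beta> * x) * exp (\<beta> * x) \<le> 1" by (simp add: exp_add[symmetric])
  thus ?thesis using assms by (simp add: field_simps)
qed

context subcritical
begin

definition scale :: real where "scale = exp (\<beta>\<^sup>2 / 2) / 2"

lemma scale_pos: "0 < scale" by (simp add: scale_def)

text \<open>The dominating function for \<open>p\<close>-th moments: it absorbs \<open>\<bar>x\<bar>\<^sup>p exp (p \<beta> x)\<close> and contracts under one generation.\<close>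

definition tilt :: "real \<Rightarrow> real" where
  "tilt x = exp ((p - \<epsilon>) * \<beta> * x) + exp ((p + \<epsilon>) * \<beta> * x)"

lemma tilt_pos: "0 < tilt x" by (simp add: tilt_def add_pos_pos)

lemma tilt_mono: "x \<le> y \<Longrightarrow> tilt x \<le> tilt y"
  using \<beta>_pos p_gt_1 \<epsilon>_pos \<epsilon>_less_p unfolding tilt_def
  by (intro add_mono) (auto intro!: mult_left_mono)

definition rate :: real where
  "rate = Max ((\<lambda>r. 2 * scale powr p * exp (\<beta>\<^sup>2 * (r\<^sup>2 / 2 - r))) ` {p - \<epsilon>, p + \<epsilon>})"

lemma rate_less: "rate < 1"
  using rate_less_1 unfolding rate_def scale_def by auto

lemma rate_ge: "r \<in> {p - \<epsilon>, p + \<epsilon>} \<Longrightarrow> 2 * scale powr p * exp (\<beta>\<^sup>2 * (r\<^sup>2 / 2 - r)) \<le> rate"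
  unfolding rate_def by (rule Max_ge) auto

lemma rate_pos: "0 < rate"
proof -
  have "0 < 2 * scale powr p * exp (\<beta>\<^sup>2 * ((p + \<epsilon>)\<^sup>2 / 2 - (p + \<epsilon>)))" using scale_pos by simp
  also have "\<dots> \<le> rate" by (rule rate_ge) simp
  finally show ?thesis .
qed

lemma tilt_step:
  "integrable stdN (\<lambda>s. tilt (x + s - \<beta>))"
  "2 * scale powr p * (\<integral>s. tilt (x + s - \<beta>) \<partial>stdN) \<le> rate * tilt x"
proof -
  have i: "integrable stdN (\<lambda>s. exp (r * \<beta> * (x + s - \<beta>)))" for r
    by (rule tilted_gauss)
  show "integrable stdN (\<lambda>s. tilt (x + s - \<beta>))" unfolding tilt_def by (intro Bochner_Integration.integrable_add i)
  have I: "2 * scale powr p * (\<integral>s. exp (r * \<beta> * (x + s - \<beta>)) \<partial>stdN) \<le> rate * exp (r * \<beta> * x)"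
    if "r \<in> {p - \<epsilon>, p + \<epsilon>}" for r
  proof -
    have "2 * scale powr p * (\<integral>s. exp (r * \<beta> * (x + s - \<beta>)) \<partial>stdN) =
      (2 * scale powr p * exp (\<beta>\<^sup>2 * (r\<^sup>2 / 2 - r))) * exp (r * \<beta> * x)"
      by (subst tilted_gauss) (simp add: power2_eq_square algebra_simps)
    also have "\<dots> \<le> rate * exp (r * \<beta> * x)" by (intro mult_right_mono rate_ge that) auto
    finally show ?thesis .
  qed
  have "(\<integral>s. tilt (x + s - \<beta>) \<partial>stdN) = (\<integral>s. exp ((p - \<epsilon>) * \<beta> * (x + s - \<beta>)) \<partial>stdN) + (\<integral>s. exp ((p + \<epsilon>) * \<beta> * (x + s - \<beta>)) \<partial>stdN)"
    unfolding tilt_def by (intro Bochner_Integration.integral_add i)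
  thus "2 * scale powr p * (\<integral>s. tilt (x + s - \<beta>) \<partial>stdN) \<le> rate * tilt x"
    using I[of "p - \<epsilon>"] I[of "p + \<epsilon>"] unfolding tilt_def by (simp add: algebra_simps)
qed

text \<open>On the scale \<open>1 / (\<epsilon> \<beta>)\<close> the polynomial factor is absorbed by the two exponentials.\<close>

lemma x_exp_powr_le_tilt:
  "\<bar>x * exp (\<beta> * x)\<bar> powr p \<le> (1 + 2 / (\<epsilon> * \<beta>)\<^sup>2) * tilt x"
proof -
  define c where "c = \<epsilon> * \<beta>"
  have c: "c > 0" using \<beta>_pos \<epsilon>_pos by (simp add: c_def)
  have "\<bar>x\<bar> powr p \<le> 1 + x\<^sup>2"
  proof (cases "\<bar>x\<bar> \<le> 1")
    case True
    have "\<bar>x\<bar> powr p \<le> 1 powr p" using True p_gt_1 by (intro powr_mono2) auto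
    thus ?thesis by (simp add: add_increasing2)
  next
    case False
    have "\<bar>x\<bar> powr p \<le> \<bar>x\<bar> powr 2" using False p_le_2 by (intro powr_mono) auto
    also have "\<dots> = x\<^sup>2" using False by simp
    finally show ?thesis by simp
  qed
  also have "\<dots> \<le> (1 + 2 / c\<^sup>2) * (1 + (c * x)\<^sup>2 / 2)"
    using c by (simp add: field_simps power2_eq_square)
  also have "\<dots> \<le> (1 + 2 / c\<^sup>2) * (exp (c * x) + exp (- (c * x)))"
  proof (rule mult_left_mono)
    have *: "1 + t + t\<^sup>2 / 2 \<le> exp t" if "t \<ge> 0" for t :: real
      using exp_lower_Taylor_quadratic[OF that] .
    have "1 + (c * x)\<^sup>2 / 2 \<le> exp \<bar>c * x\<bar>" using *[of "\<bar>c * x\<bar>"] by simp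
    also have "\<dots> \<le> exp (c * x) + exp (- (c * x))"
      by (cases "c * x \<ge> 0") auto
    finally show "1 + (c * x)\<^sup>2 / 2 \<le> exp (c * x) + exp (- (c * x))" .
  qed auto
  finally have 1: "\<bar>x\<bar> powr p \<le> (1 + 2 / c\<^sup>2) * (exp (c * x) + exp (- (c * x)))" .
  have "\<bar>x * exp (\<beta> * x)\<bar> powr p = \<bar>x\<bar> powr p * exp (p * \<beta> * x)"
    by (simp add: abs_mult powr_mult) (simp add: powr_def algebra_simps)
  also have "\<dots> \<le> ((1 + 2 / c\<^sup>2) * (exp (c * x) + exp (- (c * x)))) * exp (p * \<beta> * x)"
    by (intro mult_right_mono 1) auto
  also have "\<dots> = (1 + 2 / c\<^sup>2) * ((exp (c * x) + exp (- (c * x))) * exp (p * \<beta> * x))" by simp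
  also have "(exp (c * x) + exp (- (c * x))) * exp (p * \<beta> * x) = tilt x"
    unfolding tilt_def c_def by (simp add: distrib_right exp_add[symmetric] algebra_simps)
  finally show ?thesis by (simp add: c_def)
qed

end

section \<open>A supersolution of the Laplace recursion\<close>

context subcritical
begin

text \<open>Convexity: \<open>r\<^sup>2 / 2 - r \<ge> -1/2\<close>, so every rate is at least \<open>scale powr (p - 1)\<close>.\<close>

lemma scale_less_1: "scale < 1"
proof -
  define r where "r = p + \<epsilon>"
  have "scale powr (p - 1) = 2 * scale powr p * exp (- \<beta>\<^sup>2 / 2)"
  proof -
    have "scale powr (p - 1) * (2 * scale * exp (- \<beta>\<^sup>2 / 2)) = 2 * scale powr p * exp (- \<beta>\<^sup>2 / 2)"
      using scale_pos by (simp add: powr_diff)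
    moreover have "2 * scale * exp (- \<beta>\<^sup>2 / 2) = 1" by (simp add: scale_def exp_minus)
    ultimately show ?thesis by (metis mult.right_neutral)
  qed
  also have "\<dots> \<le> 2 * scale powr p * exp (\<beta>\<^sup>2 * (r\<^sup>2 / 2 - r))"
  proof -
    have "- 1 / 2 \<le> r\<^sup>2 / 2 - r" using zero_le_power2[of "r - 1"] by (simp add: power2_eq_square field_simps)
    hence "\<beta>\<^sup>2 * (- 1 / 2) \<le> \<beta>\<^sup>2 * (r\<^sup>2 / 2 - r)" by (intro mult_left_mono) auto
    thus ?thesis using scale_pos by simp
  qed
  also have "\<dots> < 1" using rate_ge[of r] rate_less by (simp add: r_def)
  finally have "scale powr (p - 1) < 1" .
  thus ?thesis using p_gt_1 scale_pos ge_one_powr_ge_zero[of scale "p - 1"] by linarith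
qed

definition moment_const :: real where "moment_const = 1 + 2 / (\<epsilon> * \<beta>)\<^sup>2"

lemma moment_const_pos: "moment_const > 0" by (simp add: moment_const_def add_pos_nonneg)

text \<open>Large enough that the gain \<open>1 - rate\<close> from the contraction of the correction term covers the new second-order error in each generation.\<close>

definition penalty :: real where "penalty = 8 * moment_const / (1 - rate)"

lemma penalty_pos: "penalty > 0" using moment_const_pos rate_less by (simp add: penalty_def)

text \<open>First-order term \<open>\<theta> E D[x]\<close> minus the correction of order \<open>\<theta>\<^sup>p\<close>.\<close>

definition raw_exponent :: "real \<Rightarrow> real \<Rightarrow> real" where
  "raw_exponent \<theta> x = \<theta> * (x * exp (\<beta> * x)) - penalty * \<theta> powr p * tilt x"

text \<open>The cut-off at \<open>0\<close> cannot start at the origin: just right of it the first-order term is still too small to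
  beat the correction. From \<open>1\<close> on it is harmless, because for small \<open>\<theta>\<close> the raw exponent becomes negative again
  only beyond \<open>far\<close>.\<close>

definition exponent :: "real \<Rightarrow> real \<Rightarrow> real" where
  "exponent \<theta> x = (if 1 \<le> x then max 0 (raw_exponent \<theta> x) else raw_exponent \<theta> x)"

text \<open>Left of \<open>1\<close> the exponent is at least \<open>- edge_slope * \<theta>\<close>.\<close>

definition edge_slope :: real where "edge_slope = 1 / \<beta> + penalty * tilt 1"

text \<open>Beyond this point the Gaussian comparison \<open>gauss_left_vs_window\<close> holds.\<close>

definition far :: real where "far = \<beta> + 3 + 4 * edge_slope * sqrt (2 * pi)"

text \<open>For \<open>\<theta>\<close> in the unit interval the last three conditions say, in this order: the exponent stays above \<open>-1\<close> left of \<open>1\<close>; there the \<open>p\<close>-th power of the correction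
  is a small fraction of the correction itself; and the raw exponent is nonnegative between \<open>1\<close> and \<open>far\<close>.\<close>

definition admissible :: "real \<Rightarrow> bool" where
  "admissible \<theta> \<longleftrightarrow> 0 < \<theta> \<and> \<theta> \<le> 1 \<and> edge_slope * \<theta> \<le> 1 \<and>
     8 * rate * (penalty * tilt 1 * \<theta>) powr (p - 1) \<le> 1 - rate \<and> penalty * tilt far * \<theta> powr (p - 1) \<le> 1"

lemma edge_slope_pos: "edge_slope > 0" using \<beta>_pos penalty_pos tilt_pos[of 1] by (simp add: edge_slope_def add_pos_pos)

lemma admissible_mono: assumes "admissible \<theta>" "0 < \<eta>" "\<eta> \<le> \<theta>" shows "admissible \<eta>"
proof -
  have s: "0 < \<theta>" "\<theta> \<le> 1" "edge_slope * \<theta> \<le> 1" "8 * rate * (penalty * tilt 1 * \<theta>) powr (p - 1) \<le> 1 - rate" "penalty * tilt far * \<theta> powr (p - 1) \<le> 1"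
    using assms(1) by (auto simp: admissible_def)
  have "edge_slope * \<eta> \<le> edge_slope * \<theta>" using edge_slope_pos assms by simp
  moreover have "8 * rate * (penalty * tilt 1 * \<eta>) powr (p - 1) \<le> 8 * rate * (penalty * tilt 1 * \<theta>) powr (p - 1)"
    using rate_pos penalty_pos tilt_pos[of 1] assms p_gt_1 by (intro mult_left_mono powr_mono2) auto
  moreover have "penalty * tilt far * \<eta> powr (p - 1) \<le> penalty * tilt far * \<theta> powr (p - 1)"
    using penalty_pos tilt_pos[of far] assms p_gt_1 by (intro mult_left_mono powr_mono2) auto
  ultimately show ?thesis using s assms unfolding admissible_def by linarith
qed

lemma admissible_exists: "\<exists>\<theta>. admissible \<theta>"
proof -
  have t: "((\<lambda>\<theta>. A * (B * \<theta>) powr (p - 1)) \<longlongrightarrow> A * (B * 0) powr (p - 1)) (at_right 0)" if "B > 0" for A B :: real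
  proof (rule tendsto_mult[OF tendsto_const])
    show "((\<lambda>\<theta>. (B * \<theta>) powr (p - 1)) \<longlongrightarrow> (B * 0) powr (p - 1)) (at_right 0)"
      using p_gt_1 that
      by (intro tendsto_powr' tendsto_intros) (auto simp: eventually_at_right_less intro!: eventually_mono[OF eventually_at_right_less])
  qed
  have "eventually (\<lambda>\<theta>. 8 * rate * (penalty * tilt 1 * \<theta>) powr (p - 1) < 1 - rate) (at_right 0)"
    using penalty_pos tilt_pos[of 1] rate_less by (intro order_tendstoD(2)[OF t]) auto
  moreover have "eventually (\<lambda>\<theta>. penalty * tilt far * (1 * \<theta>) powr (p - 1) < 1) (at_right 0)"
    by (intro order_tendstoD(2)[OF t]) auto
  moreover have "eventually (\<lambda>\<theta>::real. \<theta> < min 1 (1 / edge_slope)) (at_right 0)"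
    using edge_slope_pos by (intro order_tendstoD(2)[OF tendsto_ident_at]) auto
  moreover have "eventually (\<lambda>\<theta>::real. 0 < \<theta>) (at_right 0)" by (rule eventually_at_right_less)
  ultimately have "eventually admissible (at_right 0)"
    by eventually_elim (use edge_slope_pos in \<open>auto simp: admissible_def field_simps\<close>)
  thus ?thesis by (metis eventually_happens' trivial_limit_at_right_real)
qed

lemma raw_exponent_ge_left:
  assumes "admissible \<theta>" "x \<le> 1" shows "- (edge_slope * \<theta>) \<le> raw_exponent \<theta> x" "- 1 \<le> raw_exponent \<theta> x"
proof -
  have s: "0 < \<theta>" "\<theta> \<le> 1" "edge_slope * \<theta> \<le> 1" using assms by (auto simp: admissible_def)
  have "\<theta> * (- 1 / \<beta>) \<le> \<theta> * (x * exp (\<beta> * x))"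
    using s minus_le_id_exp[OF \<beta>_pos, of x] by (intro mult_left_mono) auto
  moreover have "penalty * \<theta> powr p * tilt x \<le> penalty * \<theta> * tilt 1"
  proof (intro mult_mono mult_left_mono tilt_mono)
    have "\<theta> powr p \<le> \<theta> powr 1" using s p_gt_1 by (intro powr_mono') auto
    thus "\<theta> powr p \<le> \<theta>" using s by simp
  qed (use assms s penalty_pos tilt_pos[of x] in auto)
  ultimately show "- (edge_slope * \<theta>) \<le> raw_exponent \<theta> x"
    unfolding raw_exponent_def edge_slope_def by (simp add: algebra_simps)
  thus "- 1 \<le> raw_exponent \<theta> x" using s by linarith
qed

lemma exponent_ge: assumes "admissible \<theta>" shows "- 1 \<le> exponent \<theta> x"
  using raw_exponent_ge_left[OF assms, of x] by (auto simp: exponent_def)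

lemma exponent_le_initial: assumes "0 < \<theta>" shows "exponent \<theta> x \<le> \<theta> * (x * exp (\<beta> * x))"
proof -
  have "raw_exponent \<theta> x \<le> \<theta> * (x * exp (\<beta> * x))" using penalty_pos tilt_pos[of x] by (simp add: raw_exponent_def)
  thus ?thesis using assms by (auto simp: exponent_def)
qed

lemma raw_exponent_ge_middle:
  assumes "admissible \<theta>" "1 \<le> x" "x \<le> far" shows "\<theta> * (x - 1) \<le> raw_exponent \<theta> x"
proof -
  have s: "0 < \<theta>" "penalty * tilt far * \<theta> powr (p - 1) \<le> 1" using assms by (auto simp: admissible_def)
  have "1 \<le> exp (\<beta> * x)" using \<beta>_pos assms by simp
  hence "\<theta> * x * 1 \<le> \<theta> * x * exp (\<beta> * x)"
    using s assms by (intro mult_left_mono) auto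
  moreover have "penalty * \<theta> powr p * tilt x \<le> \<theta>"
  proof -
    have "\<theta> powr p = \<theta> * \<theta> powr (p - 1)" using s by (simp add: powr_diff)
    hence "penalty * \<theta> powr p * tilt x = \<theta> * (penalty * tilt x * \<theta> powr (p - 1))" by simp
    also have "\<dots> \<le> \<theta> * (penalty * tilt far * \<theta> powr (p - 1))"
      using s assms penalty_pos by (intro mult_left_mono mult_right_mono tilt_mono) auto
    also have "\<dots> \<le> \<theta> * 1" using s by (intro mult_left_mono) auto
    finally show ?thesis by simp
  qed
  ultimately show ?thesis unfolding raw_exponent_def by (simp add: algebra_simps)
qed

text \<open>The pointwise second-order bound. The coefficient \<open>penalty / rate\<close> in front of the correction is what one generation can
  afford, since integrating \<open>tilt\<close> returns a factor \<open>rate\<close>. A coefficient close to \<open>penalty\<close> is attainable because left of \<open>1\<close>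
  the correction is small, and right of \<open>1\<close> the exponent is nonnegative, so that only the first-order term enters the \<open>p\<close>-th power.\<close>

lemma exp_exponent_le:
  assumes "admissible \<theta>"
  shows "exp (- exponent \<theta> y) \<le> 1 - \<theta> * (y * exp (\<beta> * y)) + penalty / rate * \<theta> powr p * tilt y"
proof -
  define A where "A = \<theta> * (y * exp (\<beta> * y))"
  define B where "B = penalty * \<theta> powr p * tilt y"
  have s: "0 < \<theta>" "\<theta> \<le> 1" "8 * rate * (penalty * tilt 1 * \<theta>) powr (p - 1) \<le> 1 - rate" using assms by (auto simp: admissible_def)
  have B: "0 \<le> B" using penalty_pos tilt_pos[of y] by (simp add: B_def)
  have raw_exponent: "raw_exponent \<theta> y = A - B" by (simp add: raw_exponent_def A_def B_def)
  have "\<bar>A\<bar> powr p = \<theta> powr p * \<bar>y * exp (\<beta> * y)\<bar> powr p"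
    using s by (simp add: A_def abs_mult powr_mult)
  also have "\<dots> \<le> \<theta> powr p * (moment_const * tilt y)"
    unfolding moment_const_def by (intro mult_left_mono x_exp_powr_le_tilt) auto
  also have "\<dots> = (1 - rate) / 8 * B" using rate_less by (simp add: B_def penalty_def)
  finally have A: "\<bar>A\<bar> powr p \<le> (1 - rate) / 8 * B" .
  have fin: "B + 4 * \<bar>A\<bar> powr p + (1 - rate) / (2 * rate) * B \<le> B / rate"
  proof -
    have "(1 - rate) / 2 * B \<le> (1 - rate) / (2 * rate) * B"
      using rate_less rate_pos B by (intro mult_right_mono divide_left_mono) auto
    hence "B + 4 * \<bar>A\<bar> powr p + (1 - rate) / (2 * rate) * B \<le> B + 2 * ((1 - rate) / (2 * rate) * B)"
      using A by linarith
    also have "\<dots> = B / rate" using rate_pos by (simp add: field_simps)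
    finally show ?thesis .
  qed
  have pos: "0 \<le> (1 - rate) / (2 * rate) * B" using rate_less rate_pos B by auto
  have "exp (- exponent \<theta> y) \<le> 1 - A + (B + 4 * \<bar>A\<bar> powr p + (1 - rate) / (2 * rate) * B)"
  proof (cases "1 \<le> y")
    case False
    have "exp (- raw_exponent \<theta> y) \<le> 1 - raw_exponent \<theta> y + \<bar>raw_exponent \<theta> y\<bar> powr p"
      using raw_exponent_ge_left[OF assms, of y] False p_gt_1 p_le_2 by (intro exp_minus_le_powr) auto
    also have "\<bar>raw_exponent \<theta> y\<bar> powr p \<le> (\<bar>A\<bar> + B) powr p"
      unfolding raw_exponent using B p_gt_1 by (intro powr_mono2) auto
    also have "\<dots> \<le> 4 * (\<bar>A\<bar> powr p + B powr p)"
      using B p_gt_1 p_le_2 by (intro powr_add_le) auto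
    also have "B powr p \<le> B * ((1 - rate) / (8 * rate))"
    proof (cases "B = 0")
      case False
      hence "B powr p = B * B powr (p - 1)" using B by (simp add: powr_diff)
      also have "\<dots> \<le> B * ((1 - rate) / (8 * rate))"
      proof (rule mult_left_mono)
        have "B \<le> penalty * tilt 1 * \<theta>"
        proof -
          have "\<theta> powr p \<le> \<theta> powr 1" using s p_gt_1 by (intro powr_mono') auto
          hence "\<theta> powr p \<le> \<theta>" using s by simp
          hence "\<theta> powr p * tilt y \<le> \<theta> * tilt 1" using \<open>\<not> 1 \<le> y\<close> tilt_pos[of y] s by (intro mult_mono tilt_mono) auto
          thus ?thesis using penalty_pos by (simp add: B_def mult_ac)
        qed
        hence "B powr (p - 1) \<le> (penalty * tilt 1 * \<theta>) powr (p - 1)" using B p_gt_1 by (intro powr_mono2) auto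
        also have "\<dots> \<le> (1 - rate) / (8 * rate)" using s rate_pos by (simp add: field_simps)
        finally show "B powr (p - 1) \<le> (1 - rate) / (8 * rate)" .
      qed (rule B)
      finally show ?thesis .
    qed simp
    finally have "exp (- raw_exponent \<theta> y) \<le> 1 - raw_exponent \<theta> y + 4 * (\<bar>A\<bar> powr p + B * ((1 - rate) / (8 * rate)))" by simp
    also have "\<dots> = 1 - A + (B + 4 * \<bar>A\<bar> powr p + (1 - rate) / (2 * rate) * B)"
      using rate_pos by (simp add: raw_exponent field_simps)
    finally show ?thesis using False by (simp add: exponent_def)
  next
    case y: True
    have A0: "0 \<le> A" using s y by (simp add: A_def)
    show ?thesis
    proof (cases "raw_exponent \<theta> y \<le> 0")
      case True
      have "exponent \<theta> y = 0" using True y by (simp add: exponent_def)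
      moreover have "0 \<le> B - A" using True raw_exponent by simp
      moreover have "0 \<le> \<bar>A\<bar> powr p" by simp
      moreover have "exp (- exponent \<theta> y) = 1" using \<open>exponent \<theta> y = 0\<close> by simp
      ultimately show ?thesis using pos by linarith
    next
      case False
      have "exp (- raw_exponent \<theta> y) \<le> 1 - raw_exponent \<theta> y + \<bar>raw_exponent \<theta> y\<bar> powr p"
        using False p_gt_1 p_le_2 by (intro exp_minus_le_powr) auto
      also have "\<bar>raw_exponent \<theta> y\<bar> powr p \<le> \<bar>A\<bar> powr p" using False B A0 p_gt_1 unfolding raw_exponent by (intro powr_mono2) auto
      also have "\<dots> \<le> 4 * \<bar>A\<bar> powr p" by simp
      finally have "exp (- raw_exponent \<theta> y) \<le> 1 - raw_exponent \<theta> y + 4 * \<bar>A\<bar> powr p" by simp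
      moreover have "exp (- exponent \<theta> y) = exp (- raw_exponent \<theta> y)" using False y by (simp add: exponent_def)
      ultimately show ?thesis using pos unfolding raw_exponent by linarith
    qed
  qed
  also have "\<dots> \<le> 1 - A + B / rate" using fin by linarith
  finally show ?thesis by (simp add: A_def B_def)
qed

lemma exponent_measurable [measurable]: "exponent \<theta> \<in> borel_measurable borel"
  unfolding exponent_def[abs_def] raw_exponent_def tilt_def by measurable

text \<open>Where the exponent is not cut off, integrate the pointwise bound: the first-order terms match exactly and the correction terms balance by the choice of \<open>penalty\<close>.\<close>

lemma exponent_step_main:
  assumes "admissible \<theta>"
  shows "(\<integral>\<^sup>+s. ennreal (exp (- exponent (scale * \<theta>) (x + s - \<beta>))) \<partial>stdN) \<le> ennreal (exp (- raw_exponent \<theta> x / 2))"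
proof -
  interpret prob_space stdN by (rule prob_space_stdN)
  define \<eta> where "\<eta> = scale * \<theta>"
  have s: "0 < \<theta>" using assms by (simp add: admissible_def)
  have \<eta>: "admissible \<eta>" using assms scale_pos scale_less_1 s unfolding \<eta>_def by (intro admissible_mono[OF assms]) auto
  define R where "R = (\<lambda>s. 1 - \<eta> * ((x + s - \<beta>) * exp (\<beta> * (x + s - \<beta>))) + penalty / rate * \<eta> powr p * tilt (x + s - \<beta>))"
  have i: "integrable stdN (\<lambda>s. \<eta> * ((x + s - \<beta>) * exp (\<beta> * (x + s - \<beta>))))" "integrable stdN (\<lambda>s. penalty / rate * \<eta> powr p * tilt (x + s - \<beta>))"
    by (intro integrable_mult_right tilted_gauss_id tilt_step)+
  have R: "integrable stdN R" unfolding R_def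
    by (intro Bochner_Integration.integrable_add Bochner_Integration.integrable_diff i) auto
  have le: "exp (- exponent \<eta> (x + s - \<beta>)) \<le> R s" for s unfolding R_def by (rule exp_exponent_le[OF \<eta>])
  have R0: "0 \<le> R s" for s using le[of s] exp_ge_zero[of "- exponent \<eta> (x + s - \<beta>)"] by linarith
  have "(\<integral>s. R s \<partial>stdN) = 1 - \<eta> * (x * exp (\<beta> * x) * exp (- \<beta>\<^sup>2 / 2)) + penalty / rate * \<eta> powr p * (\<integral>s. tilt (x + s - \<beta>) \<partial>stdN)"
    unfolding R_def using i
    by (subst Bochner_Integration.integral_add, simp, simp, subst Bochner_Integration.integral_diff) (simp_all add: tilted_gauss_id prob_space[simplified])
  also have "\<eta> * (x * exp (\<beta> * x) * exp (- \<beta>\<^sup>2 / 2)) = \<theta> * (x * exp (\<beta> * x)) / 2"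
    by (simp add: \<eta>_def scale_def exp_minus field_simps)
  also have "penalty / rate * \<eta> powr p * (\<integral>s. tilt (x + s - \<beta>) \<partial>stdN) \<le> penalty * \<theta> powr p * tilt x / 2"
  proof -
    have "penalty / rate * \<eta> powr p * (\<integral>s. tilt (x + s - \<beta>) \<partial>stdN) =
       penalty / rate * \<theta> powr p / 2 * (2 * scale powr p * (\<integral>s. tilt (x + s - \<beta>) \<partial>stdN))"
      using s scale_pos by (simp add: \<eta>_def powr_mult)
    also have "\<dots> \<le> penalty / rate * \<theta> powr p / 2 * (rate * tilt x)"
      using penalty_pos rate_pos by (intro mult_left_mono tilt_step) auto
    also have "\<dots> = penalty * \<theta> powr p * tilt x / 2" using rate_pos by simp
    finally show ?thesis .
  qed
  finally have "(\<integral>s. R s \<partial>stdN) \<le> 1 + (- raw_exponent \<theta> x / 2)" unfolding raw_exponent_def by (simp add: field_simps)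
  also have "\<dots> \<le> exp (- raw_exponent \<theta> x / 2)" by (rule exp_ge_add_one_self)
  finally have I: "(\<integral>s. R s \<partial>stdN) \<le> exp (- raw_exponent \<theta> x / 2)" .
  have "(\<integral>\<^sup>+s. ennreal (exp (- exponent \<eta> (x + s - \<beta>))) \<partial>stdN) \<le> (\<integral>\<^sup>+s. ennreal (R s) \<partial>stdN)"
    by (intro nn_integral_mono ennreal_leI le)
  also have "\<dots> = ennreal (\<integral>s. R s \<partial>stdN)" using R R0 by (intro nn_integral_eq_integral) auto
  also have "\<dots> \<le> ennreal (exp (- raw_exponent \<theta> x / 2))" by (rule ennreal_leI[OF I])
  finally show ?thesis by (simp add: \<eta>_def)
qed

text \<open>The window is closer to the mean of the step by a distance of order one, which for \<open>m = x - \<beta>\<close> is worth a factor \<open>exp (m - 3/2)\<close> in the Gaussian density.\<close>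

lemma gauss_left_vs_window:
  assumes "far < x"
  shows "4 * edge_slope * measure stdN {s. x + s - \<beta> < 1} \<le> measure stdN {s. 2 \<le> x + s - \<beta> \<and> x + s - \<beta> \<le> 3}"
proof -
  interpret prob_space stdN by (rule prob_space_stdN)
  define m where "m = x - \<beta>"
  have m: "m \<ge> 3 + 4 * edge_slope * sqrt (2 * pi)" "m \<ge> 3"
  proof -
    show 1: "m \<ge> 3 + 4 * edge_slope * sqrt (2 * pi)" using assms unfolding far_def m_def by simp
    have "0 \<le> 4 * edge_slope * sqrt (2 * pi)" using edge_slope_pos by simp
    thus "m \<ge> 3" using 1 by linarith
  qed
  have "measure stdN {s. x + s - \<beta> < 1} \<le> measure stdN {s. s \<le> - (m - 1)}"
    by (intro finite_measure_mono) (auto simp: m_def)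
  also have "\<dots> \<le> exp (- (m - 1)\<^sup>2 / 2)" using m by (intro gauss_lower_tail) auto
  finally have 1: "measure stdN {s. x + s - \<beta> < 1} \<le> exp (- (m - 1)\<^sup>2 / 2)" .
  have "4 * edge_slope * sqrt (2 * pi) \<le> exp (m - 3 / 2)"
    using m exp_ge_add_one_self[of "m - 3/2"] by linarith
  hence "4 * edge_slope * sqrt (2 * pi) * exp (- (m - 1)\<^sup>2 / 2) \<le> exp (m - 3 / 2) * exp (- (m - 1)\<^sup>2 / 2)"
    by (intro mult_right_mono) auto
  also have "\<dots> = exp (- (m - 2)\<^sup>2 / 2)"
    by (simp add: exp_add[symmetric] power2_eq_square field_simps)
  finally have 2: "4 * edge_slope * exp (- (m - 1)\<^sup>2 / 2) \<le> exp (- (m - 2)\<^sup>2 / 2) / sqrt (2 * pi)"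
    by (simp add: field_simps)
  have "4 * edge_slope * measure stdN {s. x + s - \<beta> < 1} \<le> 4 * edge_slope * exp (- (m - 1)\<^sup>2 / 2)"
    using 1 edge_slope_pos by simp
  also note 2
  also have "exp (- (m - 2)\<^sup>2 / 2) / sqrt (2 * pi) \<le> measure stdN {- (m - 2) .. - (m - 2) + 1}"
    using m by (intro gauss_window) auto
  also have "{- (m - 2) .. - (m - 2) + 1} = {s. 2 \<le> x + s - \<beta> \<and> x + s - \<beta> \<le> 3}"
    by (auto simp: m_def)
  finally show ?thesis .
qed

text \<open>Where the exponent is cut off, the loss of order \<open>\<theta>\<close> left of \<open>1\<close> is outweighed by the gain of order \<open>\<theta>\<close> on the window between 2 and 3.\<close>

lemma exponent_step_zero:
  assumes "admissible \<theta>" "far < x"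
  shows "(\<integral>\<^sup>+s. ennreal (exp (- exponent (scale * \<theta>) (x + s - \<beta>))) \<partial>stdN) \<le> 1"
proof -
  interpret prob_space stdN by (rule prob_space_stdN)
  define \<eta> where "\<eta> = scale * \<theta>"
  have s: "0 < \<theta>" using assms by (simp add: admissible_def)
  have \<eta>: "admissible \<eta>" using assms scale_pos scale_less_1 s unfolding \<eta>_def by (intro admissible_mono[OF assms(1)]) auto
  have \<eta>1: "0 < \<eta>" "\<eta> \<le> 1" "edge_slope * \<eta> \<le> 1" using \<eta> by (auto simp: admissible_def)
  define L where "L = {s. x + s - \<beta> < 1}"
  define W where "W = {s. 2 \<le> x + s - \<beta> \<and> x + s - \<beta> \<le> 3}"
  have [measurable]: "L \<in> sets borel" "W \<in> sets borel" unfolding L_def W_def by measurable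
  define R where "R = (\<lambda>s. 1 + 2 * edge_slope * \<eta> * indicator L s - \<eta> / 2 * indicator W s)"
  have le: "exp (- exponent \<eta> (x + s - \<beta>)) \<le> R s" for s
  proof -
    define y where "y = x + s - \<beta>"
    consider "y < 1" | "2 \<le> y" "y \<le> 3" | "1 \<le> y" "\<not> (2 \<le> y \<and> y \<le> 3)" by linarith
    thus ?thesis
    proof cases
      case 1
      have "exp (- exponent \<eta> y) \<le> exp (edge_slope * \<eta>)" using 1 raw_exponent_ge_left[OF \<eta>, of y] by (simp add: exponent_def)
      also have "\<dots> \<le> 1 + edge_slope * \<eta> + (edge_slope * \<eta>)\<^sup>2" using \<eta>1 edge_slope_pos by (intro exp_bound) auto
      also have "(edge_slope * \<eta>)\<^sup>2 \<le> edge_slope * \<eta>" using \<eta>1 edge_slope_pos by (simp add: power2_eq_square mult_left_le)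
      finally show ?thesis using 1 by (simp add: R_def L_def W_def y_def mult_ac)
    next
      case 2
      have xs: "3 \<le> far" using \<beta>_pos edge_slope_pos by (simp add: far_def)
      have "\<eta> * 1 \<le> \<eta> * (y - 1)" using 2 \<eta>1 by (intro mult_left_mono) auto
      also have "\<dots> \<le> raw_exponent \<eta> y" using 2 xs by (intro raw_exponent_ge_middle \<eta>) auto
      finally have "\<eta> \<le> exponent \<eta> y" using 2 by (simp add: exponent_def)
      hence "exp (- exponent \<eta> y) \<le> exp (- \<eta>)" by simp
      also have "\<dots> \<le> 1 - \<eta> / 2"
      proof -
        have "exp (- \<eta>) \<le> 1 / (1 + \<eta>)" using exp_ge_add_one_self[of \<eta>] \<eta>1 by (simp add: exp_minus field_simps)
        also have "\<dots> \<le> 1 - \<eta> / 2" using \<eta>1 mult_left_le[of \<eta> \<eta>] by (simp add: field_simps)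
        finally show ?thesis .
      qed
      finally show ?thesis using 2 by (simp add: R_def L_def W_def y_def)
    next
      case 3
      thus ?thesis by (auto simp: R_def L_def W_def y_def exponent_def)
    qed
  qed
  have R0: "0 \<le> R s" for s using le[of s] exp_ge_zero[of "- exponent \<eta> (x + s - \<beta>)"] by linarith
  have i: "integrable stdN (\<lambda>s. 2 * edge_slope * \<eta> * indicator L s)" "integrable stdN (\<lambda>s. \<eta> / 2 * indicator W s)"
    by (intro integrable_mult_right integrable_real_indicator; simp add: emeasure_eq_measure)+
  have R: "integrable stdN R" unfolding R_def
    by (intro Bochner_Integration.integrable_add Bochner_Integration.integrable_diff i) auto
  have "(\<integral>s. R s \<partial>stdN) = 1 + 2 * edge_slope * \<eta> * measure stdN L - \<eta> / 2 * measure stdN W"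
    unfolding R_def using i
    by (subst Bochner_Integration.integral_diff, simp, simp, subst Bochner_Integration.integral_add) (simp_all add: prob_space[simplified])
  also have "\<dots> = 1 - \<eta> / 2 * (measure stdN W - 4 * edge_slope * measure stdN L)" by (simp add: field_simps)
  also have "\<dots> \<le> 1" using gauss_left_vs_window[OF assms(2)] \<eta>1 by (simp add: L_def W_def)
  finally have I: "(\<integral>s. R s \<partial>stdN) \<le> 1" .
  have "(\<integral>\<^sup>+s. ennreal (exp (- exponent \<eta> (x + s - \<beta>))) \<partial>stdN) \<le> (\<integral>\<^sup>+s. ennreal (R s) \<partial>stdN)"
    by (intro nn_integral_mono ennreal_leI le)
  also have "\<dots> = ennreal (\<integral>s. R s \<partial>stdN)" using R R0 by (intro nn_integral_eq_integral) auto
  also have "\<dots> \<le> 1" using I by simp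
  finally show ?thesis by (simp add: \<eta>_def)
qed

text \<open>The supersolution property; the square root on the right matches the two children in the recursion.\<close>

lemma exponent_step:
  assumes "admissible \<theta>"
  shows "(\<integral>\<^sup>+s. ennreal (exp (- exponent (scale * \<theta>) (x + s - \<beta>))) \<partial>stdN) \<le> ennreal (exp (- exponent \<theta> x / 2))"
proof (cases "1 \<le> x \<and> raw_exponent \<theta> x < 0")
  case True
  have "far < x"
  proof (rule ccontr)
    assume "\<not> far < x"
    hence "\<theta> * (x - 1) \<le> raw_exponent \<theta> x" using True by (intro raw_exponent_ge_middle assms) auto
    moreover have "0 \<le> \<theta> * (x - 1)" using True assms by (auto simp: admissible_def)
    ultimately show False using True by linarith
  qed
  thus ?thesis using exponent_step_zero[OF assms] True by (simp add: exponent_def)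
next
  case False
  hence "exponent \<theta> x = raw_exponent \<theta> x" by (auto simp: exponent_def)
  thus ?thesis using exponent_step_main[OF assms] by simp
qed

end

section \<open>Left tail of the derivative martingale\<close>

lemma (in prob_space) chernoff_lower:
  assumes [measurable]: "X \<in> borel_measurable M" and B: "(\<integral>\<^sup>+\<omega>. ennreal (exp (- \<theta> * X \<omega>)) \<partial>M) \<le> ennreal B"
    and "0 \<le> B" "0 \<le> \<theta>"
  shows "measure M {\<omega> \<in> space M. X \<omega> < - y} \<le> exp (- \<theta> * y) * B"
proof -
  have "emeasure M {\<omega> \<in> space M. X \<omega> < - y} = (\<integral>\<^sup>+\<omega>. indicator {\<omega> \<in> space M. X \<omega> < - y} \<omega> \<partial>M)" by simp
  also have "\<dots> \<le> (\<integral>\<^sup>+\<omega>. ennreal (exp (- \<theta> * y)) * ennreal (exp (- \<theta> * X \<omega>)) \<partial>M)"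
  proof (rule nn_integral_mono)
    fix \<omega>
    show "indicator {\<omega> \<in> space M. X \<omega> < - y} \<omega> \<le> ennreal (exp (- \<theta> * y)) * ennreal (exp (- \<theta> * X \<omega>))"
    proof (cases "X \<omega> < - y")
      case True
      have "\<theta> * (X \<omega> + y) \<le> 0" using True assms by (simp add: mult_nonneg_nonpos)
      hence "1 \<le> exp (- \<theta> * y + - \<theta> * X \<omega>)" by (simp add: algebra_simps)
      hence "1 \<le> exp (- \<theta> * y) * exp (- \<theta> * X \<omega>)" by (simp only: exp_add)
      thus ?thesis by (simp add: ennreal_mult'[symmetric] ennreal_1[symmetric] indicator_def del: ennreal_1)
    qed simp
  qed
  also have "\<dots> = ennreal (exp (- \<theta> * y)) * (\<integral>\<^sup>+\<omega>. ennreal (exp (- \<theta> * X \<omega>)) \<partial>M)"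
    by (rule nn_integral_cmult) measurable
  also have "\<dots> \<le> ennreal (exp (- \<theta> * y)) * ennreal B" by (intro mult_left_mono B) auto
  also have "\<dots> = ennreal (exp (- \<theta> * y) * B)" using assms by (simp add: ennreal_mult)
  finally show ?thesis using assms by (simp add: emeasure_eq_measure)
qed

lemma power_powr: "0 < b \<Longrightarrow> (b ^ m) powr g = (b powr g) ^ m" for b g :: real
  by (simp add: powr_realpow[symmetric] powr_powr mult.commute)

lemma power_bracket:
  fixes A b y :: real
  assumes "1 < b" "0 < A" "A \<le> y"
  obtains k where "A * b ^ k \<le> y" "y < A * b ^ Suc k"
proof -
  obtain m where m: "y / A < b ^ m" using real_arch_pow[OF assms(1)] by blast
  define j where "j = (LEAST m. y / A < b ^ m)"
  have j: "y / A < b ^ j" unfolding j_def using m by (rule LeastI)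
  have "j \<noteq> 0" using j assms by (auto simp: field_simps intro!: Nat.gr0I)
  then obtain k where jk: "j = Suc k" by (cases j) auto
  have "\<not> y / A < b ^ k" using not_less_Least[of k "\<lambda>m. y / A < b ^ m"] jk j_def by simp
  thus ?thesis using that[of k] j jk assms by (simp add: field_simps)
qed

context subcritical
begin

lemma laplace_derivative_Suc:
  assumes "gaussian_labels M \<xi>"
  shows "(\<integral>\<^sup>+\<omega>. ennreal (exp (- \<theta> * derivative_mart \<xi> x \<beta> (Suc n) \<omega>)) \<partial>M) =
    (\<integral>\<^sup>+s. \<integral>\<^sup>+\<omega>. ennreal (exp (- (scale * \<theta>) * derivative_mart (subtree \<xi> False) (x + s - \<beta>) \<beta> n \<omega>)) \<partial>M \<partial>stdN) *
    (\<integral>\<^sup>+s. \<integral>\<^sup>+\<omega>. ennreal (exp (- (scale * \<theta>) * derivative_mart (subtree \<xi> True) (x + s - \<beta>) \<beta> n \<omega>)) \<partial>M \<partial>stdN)"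
proof -
  interpret gaussian_labels M \<xi> by fact
  define G where "G = (\<lambda>(w::real, d). ennreal (exp (- (scale * \<theta>) * d)))"
  have G: "G \<in> borel_measurable (borel \<Otimes>\<^sub>M borel)" unfolding G_def by measurable
  have e: "ennreal (exp (- \<theta> * derivative_mart \<xi> x \<beta> (Suc n) \<omega>)) =
     G (additive_mart (subtree \<xi> False) (x + \<xi> [False] \<omega> - \<beta>) \<beta> n \<omega>, derivative_mart (subtree \<xi> False) (x + \<xi> [False] \<omega> - \<beta>) \<beta> n \<omega>) *
     G (additive_mart (subtree \<xi> True) (x + \<xi> [True] \<omega> - \<beta>) \<beta> n \<omega>, derivative_mart (subtree \<xi> True) (x + \<xi> [True] \<omega> - \<beta>) \<beta> n \<omega>)" for \<omega>
    unfolding G_def mart_Suc scale_def[symmetric]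
    by (simp add: ennreal_mult'[symmetric] exp_add[symmetric] algebra_simps)
  show ?thesis unfolding e nn_integral_branching[OF G] by (simp add: G_def)
qed

lemma laplace_derivative_le:
  assumes "gaussian_labels M \<xi>" "admissible \<theta>"
  shows "(\<integral>\<^sup>+\<omega>. ennreal (exp (- \<theta> * derivative_mart \<xi> x \<beta> n \<omega>)) \<partial>M) \<le> ennreal (exp (- exponent \<theta> x))"
  using assms
proof (induction n arbitrary: \<xi> \<theta> x)
  case 0
  interpret gaussian_labels M \<xi> by fact
  have "exponent \<theta> x \<le> \<theta> * (x * exp (\<beta> * x))" using 0 by (intro exponent_le_initial) (simp add: admissible_def)
  thus ?case by (simp add: emeasure_space_1)
next
  case (Suc n)
  interpret gaussian_labels M \<xi> by fact
  have pos: "0 < \<theta>" using Suc.prems by (simp add: admissible_def)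
  have admissible: "admissible (scale * \<theta>)"
    using scale_pos scale_less_1 pos by (intro admissible_mono[OF Suc.prems(2)]) auto
  have "(\<integral>\<^sup>+s. \<integral>\<^sup>+\<omega>. ennreal (exp (- (scale * \<theta>) * derivative_mart (subtree \<xi> b) (x + s - \<beta>) \<beta> n \<omega>)) \<partial>M \<partial>stdN)
     \<le> ennreal (exp (- exponent \<theta> x / 2))" for b
  proof -
    have "(\<integral>\<^sup>+s. \<integral>\<^sup>+\<omega>. ennreal (exp (- (scale * \<theta>) * derivative_mart (subtree \<xi> b) (x + s - \<beta>) \<beta> n \<omega>)) \<partial>M \<partial>stdN)
      \<le> (\<integral>\<^sup>+s. ennreal (exp (- exponent (scale * \<theta>) (x + s - \<beta>))) \<partial>stdN)"
      by (intro nn_integral_mono Suc.IH gaussian_labels_subtree admissible)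
    also note exponent_step[OF Suc.prems(2)]
    finally show ?thesis .
  qed
  hence "(\<integral>\<^sup>+\<omega>. ennreal (exp (- \<theta> * derivative_mart \<xi> x \<beta> (Suc n) \<omega>)) \<partial>M) \<le>
    ennreal (exp (- exponent \<theta> x / 2)) * ennreal (exp (- exponent \<theta> x / 2))"
    unfolding laplace_derivative_Suc[OF Suc.prems(1)] by (intro mult_mono) auto
  also have "\<dots> = ennreal (exp (- exponent \<theta> x))"
    by (simp add: ennreal_mult'[symmetric] exp_add[symmetric])
  finally show ?case .
qed

text \<open>Each generation squares the bound and multiplies \<open>\<theta>\<close> by \<open>scale\<close>, until the admissible range is reached; this is where the growth \<open>exp (2\<^sup>k)\<close> comes from.\<close>

lemma laplace_derivative_uniform:
  assumes "gaussian_labels M \<xi>" "admissible \<theta>\<^sub>0" "0 < \<theta>" "scale ^ k * \<theta> \<le> \<theta>\<^sub>0"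
  shows "(\<integral>\<^sup>+\<omega>. ennreal (exp (- \<theta> * derivative_mart \<xi> x \<beta> (n + k) \<omega>)) \<partial>M) \<le> ennreal (exp (2 ^ k))"
  using assms
proof (induction k arbitrary: \<xi> \<theta> x)
  case 0
  have admissible: "admissible \<theta>" using 0 by (auto intro: admissible_mono)
  have "(\<integral>\<^sup>+\<omega>. ennreal (exp (- \<theta> * derivative_mart \<xi> x \<beta> n \<omega>)) \<partial>M) \<le> ennreal (exp (- exponent \<theta> x))"
    by (rule laplace_derivative_le[OF 0(1) admissible])
  also have "\<dots> \<le> ennreal (exp 1)" using exponent_ge[OF admissible, of x] by (intro ennreal_leI) simp
  finally show ?case by simp
next
  case (Suc k)
  interpret gaussian_labels M \<xi> by fact
  interpret N: prob_space stdN by (rule prob_space_stdN)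
  have "(\<integral>\<^sup>+s. \<integral>\<^sup>+\<omega>. ennreal (exp (- (scale * \<theta>) * derivative_mart (subtree \<xi> b) (x + s - \<beta>) \<beta> (n + k) \<omega>)) \<partial>M \<partial>stdN)
     \<le> ennreal (exp (2 ^ k))" for b
  proof -
    have "(\<integral>\<^sup>+s. \<integral>\<^sup>+\<omega>. ennreal (exp (- (scale * \<theta>) * derivative_mart (subtree \<xi> b) (x + s - \<beta>) \<beta> (n + k) \<omega>)) \<partial>M \<partial>stdN)
      \<le> (\<integral>\<^sup>+s. ennreal (exp (2 ^ k)) \<partial>stdN)"
      using Suc.prems scale_pos by (intro nn_integral_mono Suc.IH gaussian_labels_subtree) (auto simp: mult_ac)
    also have "\<dots> = ennreal (exp (2 ^ k))" using N.emeasure_space_1 by simp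
    finally show ?thesis .
  qed
  hence "(\<integral>\<^sup>+\<omega>. ennreal (exp (- \<theta> * derivative_mart \<xi> x \<beta> (Suc (n + k)) \<omega>)) \<partial>M) \<le>
    ennreal (exp (2 ^ k)) * ennreal (exp (2 ^ k))"
    unfolding laplace_derivative_Suc[OF Suc.prems(1)] by (intro mult_mono) auto
  also have "\<dots> = ennreal (exp (2 ^ Suc k))"
    by (simp add: ennreal_mult'[symmetric] exp_add[symmetric])
  finally show ?case by simp
qed

lemma derivative_left_tail_exp:
  assumes "gaussian_labels M \<xi>" "admissible \<theta>"
  shows "measure M {\<omega> \<in> space M. derivative_mart \<xi> x \<beta> n \<omega> < - y} \<le> exp (1 - \<theta> * y)"
proof -
  interpret gaussian_labels M \<xi> by fact
  have "measure M {\<omega> \<in> space M. derivative_mart \<xi> x \<beta> n \<omega> < - y} \<le> exp (- \<theta> * y) * exp 1"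
    using laplace_derivative_uniform[OF assms, of \<theta> 0 x n] assms(2)
    by (intro chernoff_lower) (auto simp: admissible_def)
  thus ?thesis by (simp add: exp_add[symmetric])
qed

text \<open>Chernoff's bound is used with \<open>k\<close> generations such that \<open>y\<close> is of order \<open>(2 * scale)\<^sup>k\<close>; then \<open>2\<^sup>k\<close>, the cost of the
  event, is of order \<open>y powr \<gamma>\<close>. As \<open>k\<close> depends on \<open>y\<close>, the bound is available from generation \<open>k\<close> on.\<close>

lemma derivative_left_tail:
  assumes \<gamma>: "\<gamma> = (beta_c / \<beta>)\<^sup>2"
  shows "\<exists>C>0. \<exists>c>0. \<forall>(M :: 'a measure) \<xi> x y. gaussian_labels M \<xi> \<longrightarrow> 1 \<le> y \<longrightarrow>
    (\<exists>k. \<forall>n. measure M {\<omega> \<in> space M. derivative_mart \<xi> x \<beta> (n + k) \<omega> < - y} \<le> C * exp (- c * y powr \<gamma>))"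
proof -
  obtain \<theta> where \<theta>: "admissible \<theta>" using admissible_exists by blast
  hence \<theta>0: "0 < \<theta>" by (simp add: admissible_def)
  have bc: "beta_c\<^sup>2 = 2 * ln 2" by (simp add: beta_c_def)
  have \<gamma>': "\<gamma> = 2 * ln 2 / \<beta>\<^sup>2" by (simp add: \<gamma> power_divide bc)
  have \<gamma>0: "0 < \<gamma>" using \<beta>_pos by (simp add: \<gamma>')
  have two: "(2 * scale) powr \<gamma> = 2"
  proof -
    have "2 * scale = exp (\<beta>\<^sup>2 / 2)" by (simp add: scale_def)
    hence "(2 * scale) powr \<gamma> = exp (\<gamma> * (\<beta>\<^sup>2 / 2))" by (simp add: powr_def)
    also have "\<gamma> * (\<beta>\<^sup>2 / 2) = ln 2" using \<beta>_pos by (simp add: \<gamma>')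
    finally show ?thesis by simp
  qed
  have s1: "1 < 2 * scale" using \<beta>_pos by (simp add: scale_def)
  \<comment> \<open>Chosen so that the Chernoff gain is at least twice the logarithm of the Laplace bound.\<close>
  define A where "A = 2 / \<theta>"
  have A0: "A > 0" using \<theta>0 by (simp add: A_def)
  define c where "c = 1 / (2 * A powr \<gamma>)"
  have c0: "c > 0" using A0 by (simp add: c_def)
  have main: "\<exists>k. \<forall>n. measure M {\<omega> \<in> space M. derivative_mart \<xi> x \<beta> (n + k) \<omega> < - y} \<le> exp 1 * exp (- c * y powr \<gamma>)"
    if g: "gaussian_labels M \<xi>" and y: "1 \<le> y" for M :: "'a measure" and \<xi> x y
  proof (cases "y < A")
    case True
    interpret gaussian_labels M \<xi> by fact
    have "c * y powr \<gamma> \<le> c * A powr \<gamma>" using True y \<gamma>0 c0 by (intro mult_left_mono powr_mono2) auto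
    also have "\<dots> = 1 / 2" using A0 by (simp add: c_def)
    finally have "1 \<le> exp 1 * exp (- c * y powr \<gamma>)" by (simp add: exp_add[symmetric])
    hence "\<forall>n. measure M {\<omega> \<in> space M. derivative_mart \<xi> x \<beta> (n + 0) \<omega> < - y} \<le> exp 1 * exp (- c * y powr \<gamma>)"
      using prob_le_1 order_trans by blast
    thus ?thesis by blast
  next
    case False
    interpret gaussian_labels M \<xi> by fact
    obtain k where k: "A * (2 * scale) ^ k \<le> y" "y < A * (2 * scale) ^ Suc k"
      using False power_bracket[OF s1 A0, of y] by auto
    define \<eta> where "\<eta> = \<theta> / scale ^ k"
    have \<eta>: "0 < \<eta>" "scale ^ k * \<eta> \<le> \<theta>" using \<theta>0 scale_pos by (auto simp: \<eta>_def)
    have "\<eta> * y \<ge> \<eta> * (A * (2 * scale) ^ k)" using k \<eta> by (intro mult_left_mono) auto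
    also have "\<eta> * (A * (2 * scale) ^ k) = 2 * 2 ^ k"
      using \<theta>0 scale_pos by (simp add: \<eta>_def A_def power_mult_distrib)
    finally have 1: "2 * 2 ^ k \<le> \<eta> * y" .
    have "y powr \<gamma> \<le> (A * (2 * scale) ^ Suc k) powr \<gamma>" using k y \<gamma>0 by (intro powr_mono2) auto
    also have "\<dots> = A powr \<gamma> * ((2 * scale) ^ Suc k) powr \<gamma>" using A0 scale_pos by (intro powr_mult) 
    also have "((2 * scale) ^ Suc k) powr \<gamma> = ((2 * scale) powr \<gamma>) ^ Suc k"
      using scale_pos by (intro power_powr) auto
    also have "\<dots> = 2 * 2 ^ k" by (simp add: two)
    finally have 2: "c * y powr \<gamma> \<le> 2 ^ k" using A0 by (simp add: c_def field_simps)
    have "measure M {\<omega> \<in> space M. derivative_mart \<xi> x \<beta> (n + k) \<omega> < - y} \<le> exp 1 * exp (- c * y powr \<gamma>)" for n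
    proof -
      have "measure M {\<omega> \<in> space M. derivative_mart \<xi> x \<beta> (n + k) \<omega> < - y} \<le> exp (- \<eta> * y) * exp (2 ^ k)"
        using laplace_derivative_uniform[OF g \<theta> \<eta>] \<eta> by (intro chernoff_lower) auto
      also have "\<dots> = exp (2 ^ k - \<eta> * y)" by (simp add: exp_add[symmetric])
      also have "\<dots> \<le> exp (1 + - c * y powr \<gamma>)" using 1 2 by simp
      also have "\<dots> = exp 1 * exp (- c * y powr \<gamma>)" by (rule exp_add)
      finally show ?thesis .
    qed
    thus ?thesis by blast
  qed
  show ?thesis using main c0 by (intro exI[of _ "exp 1"] exI[of _ c] conjI) auto
qed

end

section \<open>Lower tail of the additive martingale\<close>

context subcritical
begin

lemma laplace_additive_Suc:
  assumes "gaussian_labels M \<xi>"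
  shows "(\<integral>\<^sup>+\<omega>. ennreal (exp (- l * additive_mart \<xi> x \<beta> (Suc n) \<omega>)) \<partial>M) =
    (\<integral>\<^sup>+s. \<integral>\<^sup>+\<omega>. ennreal (exp (- (scale * l) * additive_mart (subtree \<xi> False) (x + s - \<beta>) \<beta> n \<omega>)) \<partial>M \<partial>stdN) *
    (\<integral>\<^sup>+s. \<integral>\<^sup>+\<omega>. ennreal (exp (- (scale * l) * additive_mart (subtree \<xi> True) (x + s - \<beta>) \<beta> n \<omega>)) \<partial>M \<partial>stdN)"
proof -
  interpret gaussian_labels M \<xi> by fact
  define G where "G = (\<lambda>(w, d::real). ennreal (exp (- (scale * l) * w)))"
  have G: "G \<in> borel_measurable (borel \<Otimes>\<^sub>M borel)" unfolding G_def by measurable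
  have e: "ennreal (exp (- l * additive_mart \<xi> x \<beta> (Suc n) \<omega>)) =
     G (additive_mart (subtree \<xi> False) (x + \<xi> [False] \<omega> - \<beta>) \<beta> n \<omega>, derivative_mart (subtree \<xi> False) (x + \<xi> [False] \<omega> - \<beta>) \<beta> n \<omega>) *
     G (additive_mart (subtree \<xi> True) (x + \<xi> [True] \<omega> - \<beta>) \<beta> n \<omega>, derivative_mart (subtree \<xi> True) (x + \<xi> [True] \<omega> - \<beta>) \<beta> n \<omega>)" for \<omega>
    unfolding G_def mart_Suc scale_def[symmetric]
    by (simp add: ennreal_mult'[symmetric] exp_add[symmetric] algebra_simps)
  show ?thesis unfolding e nn_integral_branching[OF G] by (simp add: G_def)
qed

lemma laplace_additive_le_1:
  assumes "gaussian_labels M \<xi>" "0 \<le> l"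
  shows "(\<integral>\<^sup>+\<omega>. ennreal (exp (- l * additive_mart \<xi> x \<beta> n \<omega>)) \<partial>M) \<le> 1"
proof -
  interpret gaussian_labels M \<xi> by fact
  have "(\<integral>\<^sup>+\<omega>. ennreal (exp (- l * additive_mart \<xi> x \<beta> n \<omega>)) \<partial>M) \<le> (\<integral>\<^sup>+\<omega>. 1 \<partial>M)"
    using additive_mart_pos[of \<xi> x \<beta> n] assms(2) by (intro nn_integral_mono) (simp add: less_imp_le)
  thus ?thesis by (simp add: emeasure_space_1)
qed

lemma rate_ge_p: "2 * scale powr p * exp (p\<^sup>2 * \<beta>\<^sup>2 / 2 - p * \<beta>\<^sup>2) \<le> rate"
proof -
  define r where "r = p + \<epsilon>"
  have "p\<^sup>2 * \<beta>\<^sup>2 / 2 - p * \<beta>\<^sup>2 = \<beta>\<^sup>2 * (p\<^sup>2 / 2 - p)" by (simp add: field_simps)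
  also have "\<dots> \<le> \<beta>\<^sup>2 * (r\<^sup>2 / 2 - r)"
  proof (rule mult_left_mono)
    have "r\<^sup>2 / 2 - r - (p\<^sup>2 / 2 - p) = \<epsilon> * (p - 1) + \<epsilon>\<^sup>2 / 2"
      by (simp add: r_def power2_eq_square field_simps)
    moreover have "0 \<le> \<epsilon> * (p - 1) + \<epsilon>\<^sup>2 / 2" using \<epsilon>_pos p_gt_1 by simp
    ultimately show "p\<^sup>2 / 2 - p \<le> r\<^sup>2 / 2 - r" by linarith
  qed simp
  finally have "2 * scale powr p * exp (p\<^sup>2 * \<beta>\<^sup>2 / 2 - p * \<beta>\<^sup>2) \<le> 2 * scale powr p * exp (\<beta>\<^sup>2 * (r\<^sup>2 / 2 - r))"
    by (intro mult_left_mono) auto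
  also have "\<dots> \<le> rate" by (rule rate_ge) (simp add: r_def)
  finally show ?thesis .
qed

definition additive_const :: real where "additive_const = 1 / (1 - rate)"

lemma additive_const_ge_1: "1 \<le> additive_const" using rate_pos rate_less by (simp add: additive_const_def field_simps)

text \<open>The lower bound \<open>\<lambda> - C \<lambda>\<^sup>p\<close> for one minus the Laplace transform is preserved by the recursion. It says that the mass does
  not escape to zero, uniformly in \<open>n\<close>.\<close>

lemma laplace_additive_le:
  assumes "gaussian_labels M \<xi>" "0 < l"
  shows "(\<integral>\<^sup>+\<omega>. ennreal (exp (- l * additive_mart \<xi> x \<beta> n \<omega>)) \<partial>M) \<le>
    ennreal (1 - l * exp (\<beta> * x) + additive_const * (l * exp (\<beta> * x)) powr p)"
  using assms
proof (induction n arbitrary: \<xi> l x)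
  case 0
  interpret gaussian_labels M \<xi> by fact
  define m where "m = l * exp (\<beta> * x)"
  have m: "m > 0" using 0 by (simp add: m_def)
  have "exp (- m) \<le> 1 - m + \<bar>m\<bar> powr p" using m p_gt_1 p_le_2 by (intro exp_minus_le_powr) auto
  also have "\<bar>m\<bar> powr p \<le> additive_const * m powr p" using m additive_const_ge_1 mult_right_mono[of 1 "additive_const" "m powr p"] by simp
  finally show ?case by (simp add: emeasure_space_1 m_def ennreal_leI)
next
  case (Suc n)
  interpret gaussian_labels M \<xi> by fact
  interpret N: prob_space stdN by (rule prob_space_stdN)
  define m where "m = l * exp (\<beta> * x)"
  have m: "m > 0" using Suc.prems by (simp add: m_def)
  show ?case
  \<comment> \<open>Otherwise the claimed bound is at least 1.\<close>
  proof (cases "m \<le> additive_const * m powr p")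
    case True
    have "(\<integral>\<^sup>+\<omega>. ennreal (exp (- l * additive_mart \<xi> x \<beta> (Suc n) \<omega>)) \<partial>M) \<le> 1"
      using Suc.prems by (intro laplace_additive_le_1) auto
    also have "1 \<le> ennreal (1 - m + additive_const * m powr p)" using True by simp
    finally show ?thesis by (simp add: m_def)
  next
    case False
    have m1: "m < 1"
    proof (rule ccontr)
      assume "\<not> m < 1"
      hence "m powr 1 \<le> m powr p" using p_gt_1 by (intro powr_mono) auto
      also have "\<dots> \<le> additive_const * m powr p" using additive_const_ge_1 mult_right_mono[of 1 "additive_const" "m powr p"] by simp
      finally show False using False m by simp
    qed
    define z where "z = m / 2 - additive_const * rate * m powr p / 2"
    have z: "0 \<le> z" "z \<le> m / 2"
    proof -
      have "rate * (additive_const * m powr p) \<le> 1 * (additive_const * m powr p)" using rate_less additive_const_ge_1 by (intro mult_right_mono) auto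
      thus "0 \<le> z" using False by (simp add: z_def mult_ac)
      show "z \<le> m / 2" using additive_const_ge_1 rate_pos by (simp add: z_def)
    qed
    define Y where "Y = (\<lambda>s. scale * l * exp (\<beta> * (x + s - \<beta>)))"
    define R where "R = (\<lambda>s. 1 - Y s + additive_const * Y s powr p)"
    have Yp: "Y s powr p = scale powr p * l powr p * exp (p * \<beta> * (x + s - \<beta>))" for s
      using scale_pos Suc.prems by (simp add: Y_def powr_mult) (simp add: powr_def mult_ac)
    have Y0: "Y s > 0" for s using scale_pos Suc.prems by (simp add: Y_def)
    have i: "integrable stdN Y" "integrable stdN (\<lambda>s. additive_const * Y s powr p)"
      unfolding Yp unfolding Y_def by (intro integrable_mult_right tilted_gauss)+
    have Ri: "integrable stdN R"
      unfolding R_def using i by (intro Bochner_Integration.integrable_add Bochner_Integration.integrable_diff) auto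
    have R0: "0 \<le> R s" for s
    proof -
      have "exp (- Y s) \<le> 1 - Y s + Y s powr p" using exp_minus_le_powr[of "Y s" p] Y0[of s] p_gt_1 p_le_2 by simp
      moreover have "1 * Y s powr p \<le> additive_const * Y s powr p" using additive_const_ge_1 by (intro mult_right_mono) auto
      ultimately show ?thesis using exp_ge_zero[of "- Y s"] unfolding R_def by linarith
    qed
    have IY: "(\<integral>s. Y s \<partial>stdN) = m / 2"
      unfolding Y_def integral_mult_right_zero tilted_gauss
      by (simp add: m_def scale_def exp_diff exp_minus power2_eq_square field_simps)
    have IYp: "(\<integral>s. additive_const * Y s powr p \<partial>stdN) \<le> additive_const * rate * m powr p / 2"
    proof -
      have "(\<integral>s. additive_const * Y s powr p \<partial>stdN) = additive_const * (l powr p * exp (p * \<beta> * x)) / 2 * (2 * scale powr p * exp (p\<^sup>2 * \<beta>\<^sup>2 / 2 - p * \<beta>\<^sup>2))"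
        unfolding Yp integral_mult_right_zero tilted_gauss by (simp add: power_mult_distrib power2_eq_square mult_ac)
      also have "\<dots> \<le> additive_const * (l powr p * exp (p * \<beta> * x)) / 2 * rate"
        using additive_const_ge_1 by (intro mult_left_mono rate_ge_p) auto
      also have "l powr p * exp (p * \<beta> * x) = m powr p"
        using Suc.prems by (simp add: m_def powr_mult) (simp add: powr_def mult_ac)
      finally show ?thesis by (simp add: mult_ac)
    qed
    have "(\<integral>s. R s \<partial>stdN) = 1 - m / 2 + (\<integral>s. additive_const * Y s powr p \<partial>stdN)"
      unfolding R_def using i
      by (subst Bochner_Integration.integral_add, simp, simp, subst Bochner_Integration.integral_diff) (simp_all add: IY N.prob_space[simplified])
    hence RI: "(\<integral>s. R s \<partial>stdN) \<le> 1 - z" using IYp by (simp add: z_def)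
    have "(\<integral>\<^sup>+s. \<integral>\<^sup>+\<omega>. ennreal (exp (- (scale * l) * additive_mart (subtree \<xi> b) (x + s - \<beta>) \<beta> n \<omega>)) \<partial>M \<partial>stdN)
      \<le> ennreal (1 - z)" for b
    proof -
      have "(\<integral>\<^sup>+s. \<integral>\<^sup>+\<omega>. ennreal (exp (- (scale * l) * additive_mart (subtree \<xi> b) (x + s - \<beta>) \<beta> n \<omega>)) \<partial>M \<partial>stdN)
        \<le> (\<integral>\<^sup>+s. ennreal (R s) \<partial>stdN)"
        unfolding R_def Y_def using Suc.prems scale_pos
        by (intro nn_integral_mono Suc.IH gaussian_labels_subtree) auto
      also have "\<dots> = ennreal (\<integral>s. R s \<partial>stdN)" using Ri R0 by (intro nn_integral_eq_integral) auto
      also have "\<dots> \<le> ennreal (1 - z)" by (rule ennreal_leI[OF RI])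
      finally show ?thesis .
    qed
    hence "(\<integral>\<^sup>+\<omega>. ennreal (exp (- l * additive_mart \<xi> x \<beta> (Suc n) \<omega>)) \<partial>M) \<le> ennreal (1 - z) * ennreal (1 - z)"
      unfolding laplace_additive_Suc[OF Suc.prems(1)] by (intro mult_mono) auto
    also have "\<dots> = ennreal ((1 - z) * (1 - z))" using z m1 by (intro ennreal_mult[symmetric]) auto
    also have "\<dots> \<le> ennreal (1 - m + additive_const * m powr p)"
    proof (rule ennreal_leI)
      have "z * z \<le> m powr p"
      proof -
        have "z * z \<le> m * m" using z by (intro mult_mono) auto
        also have "\<dots> = m powr 2" using m by (simp add: power2_eq_square)
        also have "\<dots> \<le> m powr p" using m m1 p_le_2 by (intro powr_mono') auto
        finally show ?thesis .
      qed
      also have "m powr p = additive_const * m powr p - additive_const * rate * m powr p"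
      proof -
        have "additive_const - additive_const * rate = 1" using rate_less by (simp add: additive_const_def field_simps)
        thus ?thesis by (metis left_diff_distrib mult_1)
      qed
      finally show "(1 - z) * (1 - z) \<le> 1 - m + additive_const * m powr p"
        by (simp add: z_def algebra_simps)
    qed
    finally show ?thesis by (simp add: m_def)
  qed
qed

text \<open>A bound uniform in the sample space, the labels and the generation. The type argument fixes the type of the sample points.\<close>

definition laplace_bound :: "'a itself \<Rightarrow> real \<Rightarrow> real \<Rightarrow> bool" where
  "laplace_bound _ b l \<longleftrightarrow> 0 \<le> b \<and> 0 < l \<and> (\<forall>(M :: 'a measure) \<xi> n. gaussian_labels M \<xi> \<longrightarrow>
     (\<integral>\<^sup>+\<omega>. ennreal (exp (- l * additive_mart \<xi> 0 \<beta> n \<omega>)) \<partial>M) \<le> ennreal b)"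

lemma laplace_bound_mono:
  assumes "laplace_bound TYPE('a) b l" "b \<le> b'" "l \<le> l'"
  shows "laplace_bound TYPE('a) b' l'"
  unfolding laplace_bound_def
proof (intro conjI allI impI)
  show "0 \<le> b'" "0 < l'" using assms by (auto simp: laplace_bound_def)
  fix M :: "'a measure" and \<xi> n assume g: "gaussian_labels M \<xi>"
  have "(\<integral>\<^sup>+\<omega>. ennreal (exp (- l' * additive_mart \<xi> 0 \<beta> n \<omega>)) \<partial>M) \<le> (\<integral>\<^sup>+\<omega>. ennreal (exp (- l * additive_mart \<xi> 0 \<beta> n \<omega>)) \<partial>M)"
    using additive_mart_pos[of \<xi> 0 \<beta> n] assms(3) by (intro nn_integral_mono ennreal_leI) (simp add: less_imp_le)
  also have "\<dots> \<le> ennreal b" using assms(1) g by (auto simp: laplace_bound_def)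
  also have "\<dots> \<le> ennreal b'" using assms(2) by (rule ennreal_leI)
  finally show "(\<integral>\<^sup>+\<omega>. ennreal (exp (- l' * additive_mart \<xi> 0 \<beta> n \<omega>)) \<partial>M) \<le> ennreal b'" .
qed

text \<open>The factor \<open>exp T\<close> survives a first step \<open>s\<close> as long as \<open>s \<ge> - (T - T\<^sub>0) / \<beta>\<close>.\<close>

definition T\<^sub>0 :: real where "T\<^sub>0 = ln 2 + \<beta>\<^sup>2 / 2"

lemma T\<^sub>0_pos: "0 < T\<^sub>0" using \<beta>_pos by (simp add: T\<^sub>0_def add_pos_pos)

text \<open>Each child contributes unless its first step is so low that it destroys the gain \<open>exp T\<close>, which has Gaussian probability in \<open>T\<close>.
  In generation zero, where no branching is available, \<open>exp T \<ge> 2\<close> squares the bound instead.\<close>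

lemma laplace_bound_step:
  assumes "laplace_bound TYPE('a) b l" "2 * T\<^sub>0 \<le> T"
  shows "laplace_bound TYPE('a) ((b + exp (- T\<^sup>2 / (8 * \<beta>\<^sup>2)))\<^sup>2) (l * exp T)"
  unfolding laplace_bound_def
proof (intro conjI allI impI)
  have b: "0 \<le> b" "0 < l" using assms by (auto simp: laplace_bound_def)
  show "0 \<le> (b + exp (- T\<^sup>2 / (8 * \<beta>\<^sup>2)))\<^sup>2" "0 < l * exp T" using b by auto
  fix M :: "'a measure" and \<xi> n assume g: "gaussian_labels M \<xi>"
  interpret gaussian_labels M \<xi> by (rule g)
  interpret N: prob_space stdN by (rule prob_space_stdN)
  define \<tau> where "\<tau> = exp (- T\<^sup>2 / (8 * \<beta>\<^sup>2))"
  have \<tau>: "\<tau> > 0" by (simp add: \<tau>_def)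
  show "(\<integral>\<^sup>+\<omega>. ennreal (exp (- (l * exp T) * additive_mart \<xi> 0 \<beta> n \<omega>)) \<partial>M) \<le> ennreal ((b + exp (- T\<^sup>2 / (8 * \<beta>\<^sup>2)))\<^sup>2)"
  proof (cases n)
    case 0
    have "(\<integral>\<^sup>+\<omega>. ennreal (exp (- l * additive_mart \<xi> 0 \<beta> 0 \<omega>)) \<partial>M) \<le> ennreal b"
      using assms(1) g unfolding laplace_bound_def by blast
    hence "exp (- l) \<le> b" using b by (simp add: emeasure_space_1)
    hence "exp (- l) * exp (- l) \<le> (b + \<tau>) * (b + \<tau>)" using \<tau> b by (intro mult_mono) auto
    moreover have "exp (- (l * exp T)) \<le> exp (- l) * exp (- l)"
    proof -
      have "2 = exp (ln (2::real))" by simp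
      also have "\<dots> \<le> exp T"
      proof (subst exp_le_cancel_iff)
        have "ln 2 \<le> T\<^sub>0" by (simp add: T\<^sub>0_def)
        thus "ln 2 \<le> T" using assms(2) T\<^sub>0_pos by linarith
      qed
      finally have "l * 2 \<le> l * exp T" using b by (intro mult_left_mono) auto
      thus ?thesis by (simp add: exp_add[symmetric])
    qed
    ultimately show ?thesis using 0 by (simp add: emeasure_space_1 \<tau>_def power2_eq_square)
  next
    case (Suc k)
    define L where "L = {s. scale * exp (\<beta> * (s - \<beta>)) < exp (- T)}"
    have [measurable]: "L \<in> sets borel" unfolding L_def by measurable
    have L: "measure stdN L \<le> \<tau>"
    proof -
      have "measure stdN L \<le> measure stdN {s. s \<le> - (T / (2 * \<beta>))}"
      proof (rule N.finite_measure_mono)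
        show "L \<subseteq> {s. s \<le> - (T / (2 * \<beta>))}"
        proof
          fix s assume "s \<in> L"
          hence "ln (scale * exp (\<beta> * (s - \<beta>))) < ln (exp (- T))"
            unfolding L_def using scale_pos by (subst ln_less_cancel_iff) auto
          hence "\<beta>\<^sup>2 / 2 - ln 2 + \<beta> * (s - \<beta>) < - T"
            using scale_pos by (simp add: ln_mult ln_div scale_def)
          hence "\<beta> * s < - T + T\<^sub>0" by (simp add: T\<^sub>0_def power2_eq_square algebra_simps)
          also have "\<dots> \<le> - T / 2" using assms(2) by simp
          finally show "s \<in> {s. s \<le> - (T / (2 * \<beta>))}" using \<beta>_pos by (simp add: field_simps)
        qed
      qed simp
      also have "\<dots> \<le> exp (- (T / (2 * \<beta>))\<^sup>2 / 2)"
        using assms(2) T\<^sub>0_pos \<beta>_pos by (intro gauss_lower_tail) auto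
      also have "\<dots> = \<tau>" by (simp add: \<tau>_def power_divide power_mult_distrib)
      finally show ?thesis .
    qed
    have "(\<integral>\<^sup>+s. \<integral>\<^sup>+\<omega>. ennreal (exp (- (scale * (l * exp T)) * additive_mart (subtree \<xi> c) (0 + s - \<beta>) \<beta> k \<omega>)) \<partial>M \<partial>stdN)
      \<le> ennreal (b + \<tau>)" for c
    proof -
      have "(\<integral>\<^sup>+s. \<integral>\<^sup>+\<omega>. ennreal (exp (- (scale * (l * exp T)) * additive_mart (subtree \<xi> c) (0 + s - \<beta>) \<beta> k \<omega>)) \<partial>M \<partial>stdN)
        \<le> (\<integral>\<^sup>+s. ennreal b + indicator L s \<partial>stdN)"
      proof (rule nn_integral_mono)
        fix s
        define r where "r = scale * exp T * exp (\<beta> * (s - \<beta>))"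
        have e: "- (scale * (l * exp T)) * additive_mart (subtree \<xi> c) (0 + s - \<beta>) \<beta> k \<omega> = - (l * r) * additive_mart (subtree \<xi> c) 0 \<beta> k \<omega>" for \<omega>
          using mart_shift(1)[of "subtree \<xi> c" 0 "s - \<beta>" \<beta> k \<omega>] by (simp add: r_def)
        have r0: "0 < r" using scale_pos by (simp add: r_def)
        show "(\<integral>\<^sup>+\<omega>. ennreal (exp (- (scale * (l * exp T)) * additive_mart (subtree \<xi> c) (0 + s - \<beta>) \<beta> k \<omega>)) \<partial>M) \<le> ennreal b + indicator L s"
        proof (cases "s \<in> L")
          case True
          have "(\<integral>\<^sup>+\<omega>. ennreal (exp (- (l * r) * additive_mart (subtree \<xi> c) 0 \<beta> k \<omega>)) \<partial>M) \<le> 1"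
            using r0 b by (intro laplace_additive_le_1 gaussian_labels_subtree) auto
          also have "1 \<le> ennreal b + indicator L s" using True by simp
          finally show ?thesis unfolding e .
        next
          case False
          hence "1 \<le> r" by (simp add: L_def r_def exp_minus field_simps)
          hence "laplace_bound TYPE('a) b (l * r)" using b by (intro laplace_bound_mono[OF assms(1)]) auto
          thus ?thesis unfolding e using False gaussian_labels_subtree by (auto simp: laplace_bound_def)
        qed
      qed
      also have "\<dots> = ennreal b + emeasure stdN L"
        using N.emeasure_space_1 by (subst nn_integral_add) auto
      also have "\<dots> \<le> ennreal b + ennreal \<tau>" using L by (intro add_left_mono) (simp add: N.emeasure_eq_measure ennreal_leI)
      also have "\<dots> = ennreal (b + \<tau>)" using b \<tau> by simp
      finally show ?thesis .
    qed
    hence "(\<integral>\<^sup>+\<omega>. ennreal (exp (- (l * exp T) * additive_mart \<xi> 0 \<beta> n \<omega>)) \<partial>M) \<le> ennreal (b + \<tau>) * ennreal (b + \<tau>)"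
      unfolding Suc laplace_additive_Suc[OF g] by (intro mult_mono) auto
    also have "\<dots> = ennreal ((b + \<tau>)\<^sup>2)" unfolding power2_eq_square using b \<tau> by (intro ennreal_mult[symmetric]) auto
    finally show ?thesis by (simp add: \<tau>_def)
  qed
qed

text \<open>Starting from a Laplace bound below 1, squaring with a small error strictly decreases it until it falls below any given level.\<close>

lemma laplace_bound_eighth: "\<exists>l. laplace_bound TYPE('a) (1 / 8) l"
proof -
  define l where "l = (1 / (2 * additive_const)) powr (1 / (p - 1))"
  have l: "0 < l" using additive_const_ge_1 by (simp add: l_def)
  have lp: "additive_const * l powr p = l / 2"
  proof -
    have "l powr (p - 1) = 1 / (2 * additive_const)" using p_gt_1 additive_const_ge_1 by (simp add: l_def powr_powr)
    hence "l powr p = l / (2 * additive_const)" using l by (simp add: powr_diff field_simps)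
    thus ?thesis using additive_const_ge_1 by simp
  qed
  define d where "d = l / 2"
  have d0: "0 < d" using l by (simp add: d_def)
  have l1: "l \<le> 1" using p_gt_1 additive_const_ge_1 unfolding l_def by (intro powr_le1) auto
  have d1: "d \<le> 1 / 2" using l1 by (simp add: d_def)
  have base: "laplace_bound TYPE('a) (1 - d) l"
    unfolding laplace_bound_def
  proof (intro conjI allI impI)
    fix M :: "'a measure" and \<xi> n assume "gaussian_labels M \<xi>"
    from laplace_additive_le[OF this l, of 0 n]
    show "(\<integral>\<^sup>+\<omega>. ennreal (exp (- l * additive_mart \<xi> 0 \<beta> n \<omega>)) \<partial>M) \<le> ennreal (1 - d)"
      using lp by (simp add: d_def)
  qed (use l d1 in auto)
  define t where "t = d / 20"
  have t: "0 < t" "t \<le> 1 / 40" using d0 d1 by (auto simp: t_def)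
  obtain T where T: "2 * T\<^sub>0 \<le> T" "exp (- T\<^sup>2 / (8 * \<beta>\<^sup>2)) \<le> t"
  proof -
    define T where "T = max (2 * T\<^sub>0) (max 1 (8 * \<beta>\<^sup>2 * ln (1 / t)))"
    have "8 * \<beta>\<^sup>2 * ln (1 / t) \<le> T" by (simp add: T_def)
    also have "T \<le> T\<^sup>2" using power_increasing[of 1 2 T] by (simp add: T_def)
    finally have "ln (1 / t) \<le> T\<^sup>2 / (8 * \<beta>\<^sup>2)" using \<beta>_pos by (simp add: field_simps)
    hence "- T\<^sup>2 / (8 * \<beta>\<^sup>2) \<le> ln t" using t by (simp add: ln_div)
    hence "exp (- T\<^sup>2 / (8 * \<beta>\<^sup>2)) \<le> exp (ln t)" by (subst exp_le_cancel_iff)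
    also have "exp (ln t) = t" using t by simp
    finally show ?thesis using that[of T] by (simp add: T_def)
  qed
  have step: "\<exists>l'. laplace_bound TYPE('a) (max (1 / 8) (c * (1 - d / 2))) l'"
    if c: "laplace_bound TYPE('a) c l'" "1 / 8 \<le> c" "c \<le> 1 - d" for c l'
  proof -
    have "(c + exp (- T\<^sup>2 / (8 * \<beta>\<^sup>2)))\<^sup>2 \<le> (c + t)\<^sup>2" using T c by (intro power_mono) auto
    also have "(c + t)\<^sup>2 = c * c + 2 * c * t + t * t" by (simp add: power2_eq_square algebra_simps)
    also have "\<dots> \<le> c * (1 - d) + 2 * c * t + (8 * c) * t"
    proof -
      have "c * c \<le> c * (1 - d)" using c by (intro mult_left_mono) auto
      moreover have "t * t \<le> (8 * c) * t" using c t by (intro mult_right_mono) auto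
      ultimately show ?thesis by linarith
    qed
    also have "\<dots> = c * (1 - d / 2)" by (simp add: t_def algebra_simps)
    also have "\<dots> \<le> max (1 / 8) (c * (1 - d / 2))" by simp
    finally show ?thesis using laplace_bound_mono[OF laplace_bound_step[OF c(1) T(1)] _ order_refl] by blast
  qed
  have "\<exists>l'. laplace_bound TYPE('a) (max (1 / 8) ((1 - d) * (1 - d / 2) ^ k)) l'" for k
  proof (induction k)
    case 0
    show ?case using laplace_bound_mono[OF base, of "max (1 / 8) (1 - d)"] by auto
  next
    case (Suc k)
    then obtain l' where l': "laplace_bound TYPE('a) (max (1 / 8) ((1 - d) * (1 - d / 2) ^ k)) l'" by blast
    have pw: "(1 - d / 2) ^ k \<le> 1" using d0 d1 by (intro power_le_one) auto
    have le: "max (1 / 8) ((1 - d) * (1 - d / 2) ^ k) \<le> 1 - d"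
      using d1 mult_left_mono[OF pw, of "1 - d"] by simp
    obtain l'' where l'': "laplace_bound TYPE('a) (max (1 / 8) (max (1 / 8) ((1 - d) * (1 - d / 2) ^ k) * (1 - d / 2))) l''"
      using step[OF l' _ le] by auto
    have "max (1 / 8) (max (1 / 8) ((1 - d) * (1 - d / 2) ^ k) * (1 - d / 2)) \<le> max (1 / 8) ((1 - d) * (1 - d / 2) ^ Suc k)"
      using d0 d1 by (simp add: max_def mult_ac)
    from laplace_bound_mono[OF l'' this] show ?case by auto
  qed
  moreover obtain k where "(1 - d / 2) ^ k < 1 / 8" using real_arch_pow_inv[of "1/8" "1 - d/2"] d0 by auto
  ultimately obtain l' where l': "laplace_bound TYPE('a) (max (1 / 8) ((1 - d) * (1 - d / 2) ^ k)) l'" "(1 - d / 2) ^ k < 1 / 8" by blast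
  have "(1 - d) * (1 - d / 2) ^ k \<le> 1 * (1 - d / 2) ^ k" using d0 d1 by (intro mult_right_mono) auto
  hence "max (1 / 8) ((1 - d) * (1 - d / 2) ^ k) \<le> 1 / 8" using l' by simp
  from laplace_bound_mono[OF l'(1) this] show ?thesis by blast
qed

text \<open>With \<open>T\<close> one third of the current logarithmic scale, the scale grows by \<open>4/3\<close> while squaring doubles the Gaussian exponent;
  \<open>2 \<ge> (4/3)\<^sup>2\<close> leaves the Gaussian form intact. The factor \<open>1/4\<close> absorbs the doubling of the sum before it is squared.\<close>

lemma laplace_bound_gauss:
  "\<exists>L>0. \<exists>c>0. \<forall>k. laplace_bound TYPE('a) (exp (- c * (L * (4 / 3) ^ k)\<^sup>2) / 4) (exp (L * (4 / 3) ^ k))"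
proof -
  obtain l where l: "laplace_bound TYPE('a) (1 / 8) l" using laplace_bound_eighth by blast
  have l0: "0 < l" using l by (simp add: laplace_bound_def)
  define D where "D = 144 * \<beta>\<^sup>2"
  have D: "0 < D" using \<beta>_pos by (simp add: D_def)
  define L where "L = max (max 1 (ln l)) (max (6 * T\<^sub>0) (D * ln 4))"
  have L: "1 \<le> L" "ln l \<le> L" "6 * T\<^sub>0 \<le> L" "D * ln 4 \<le> L" by (auto simp: L_def)
  define c where "c = min (1 / D) (ln 2 / L\<^sup>2)"
  have c: "0 < c" "c \<le> 1 / D" "c \<le> ln 2 / L\<^sup>2" using D L by (auto simp: c_def)
  have "laplace_bound TYPE('a) (exp (- c * (L * (4 / 3) ^ k)\<^sup>2) / 4) (exp (L * (4 / 3) ^ k))" for k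
  proof (induction k)
    case 0
    have "c * L\<^sup>2 \<le> ln 2" using c L by (simp add: field_simps)
    hence "exp (- ln 2) \<le> exp (- (c * L\<^sup>2))" by simp
    hence "1 / 8 \<le> exp (- (c * L\<^sup>2)) / 4" by (simp add: exp_minus)
    moreover have "l \<le> exp L" using L(2) l0 by (metis exp_le_cancel_iff exp_ln)
    ultimately show ?case using laplace_bound_mono[OF l] by simp
  next
    case (Suc k)
    define m where "m = L * (4 / 3) ^ k"
    have m: "L \<le> m" using L one_le_power[of "4/3::real" k] mult_left_mono[of 1 "(4/3)^k" L] by (simp add: m_def)
    have IH: "laplace_bound TYPE('a) (exp (- c * m\<^sup>2) / 4) (exp m)" using Suc by (simp add: m_def)
    have T: "2 * T\<^sub>0 \<le> m / 3" using m L by simp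
    have \<tau>: "exp (- (m / 3)\<^sup>2 / (8 * \<beta>\<^sup>2)) \<le> exp (- c * m\<^sup>2) / 4"
    proof -
      have "ln 4 \<le> m\<^sup>2 / D"
      proof -
        have "D * ln 4 \<le> m" using m L by simp
        also have "m \<le> m\<^sup>2" using m L power_increasing[of 1 2 m] by simp
        finally show ?thesis using D by (simp add: field_simps)
      qed
      moreover have "c * m\<^sup>2 \<le> 1 / D * m\<^sup>2" using c by (intro mult_right_mono) auto
      moreover have "- (m / 3)\<^sup>2 / (8 * \<beta>\<^sup>2) = - (2 * (m\<^sup>2 / D))" using \<beta>_pos by (simp add: D_def field_simps)
      ultimately have "- (m / 3)\<^sup>2 / (8 * \<beta>\<^sup>2) \<le> - c * m\<^sup>2 - ln 4" by simp
      hence "exp (- (m / 3)\<^sup>2 / (8 * \<beta>\<^sup>2)) \<le> exp (- c * m\<^sup>2 - ln 4)" by (subst exp_le_cancel_iff)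
      also have "\<dots> = exp (- c * m\<^sup>2) / 4" by (simp add: exp_diff)
      finally show ?thesis .
    qed
    have "(exp (- c * m\<^sup>2) / 4 + exp (- (m / 3)\<^sup>2 / (8 * \<beta>\<^sup>2)))\<^sup>2 \<le> (exp (- c * m\<^sup>2) / 4 + exp (- c * m\<^sup>2) / 4)\<^sup>2"
      using \<tau> by (intro power_mono) auto
    also have "\<dots> = exp (- (2 * c * m\<^sup>2)) / 4" by (simp add: power2_eq_square exp_add[symmetric])
    also have "\<dots> \<le> exp (- c * (m * (4 / 3))\<^sup>2) / 4" using c by (simp add: power_mult_distrib power_divide)
    finally have "laplace_bound TYPE('a) (exp (- c * (m * (4 / 3))\<^sup>2) / 4) (exp m * exp (m / 3))"
      by (intro laplace_bound_mono[OF laplace_bound_step[OF IH T]]) auto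
    moreover have "exp m * exp (m / 3) = exp (m * (4 / 3))" by (simp add: exp_add[symmetric])
    ultimately show ?case by (simp add: m_def mult_ac)
  qed
  thus ?thesis using c L by (intro exI[of _ L] exI[of _ c] conjI) auto
qed

lemma additive_lower_tail:
  "\<exists>C>0. \<exists>c>0. \<forall>(M :: 'a measure) \<xi> n s. gaussian_labels M \<xi> \<longrightarrow> 0 \<le> s \<longrightarrow>
     measure M {\<omega> \<in> space M. additive_mart \<xi> 0 \<beta> n \<omega> < exp (- s)} \<le> C * exp (- c * s\<^sup>2)"
proof -
  obtain L c where L: "0 < L" and c: "0 < c"
    and lap: "\<And>k. laplace_bound TYPE('a) (exp (- c * (L * (4 / 3) ^ k)\<^sup>2) / 4) (exp (L * (4 / 3) ^ k))"
    using laplace_bound_gauss[where 'a = 'a] by blast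
  define c' where "c' = c * (9 / 16)"
  define C where "C = exp 1 + exp (c' * L\<^sup>2)"
  have c'0: "c' > 0" using c by (simp add: c'_def)
  have "measure M {\<omega> \<in> space M. additive_mart \<xi> 0 \<beta> n \<omega> < exp (- s)} \<le> C * exp (- c' * s\<^sup>2)"
    if g: "gaussian_labels M \<xi>" and s: "0 \<le> s" for M :: "'a measure" and \<xi> n s
  proof -
    interpret gaussian_labels M \<xi> by (rule g)
    show ?thesis
    proof (cases "s < L")
      case True
      have "c' * s\<^sup>2 \<le> c' * L\<^sup>2" using True s c'0 by (intro mult_left_mono power_mono) auto
      hence "1 \<le> exp (c' * L\<^sup>2) * exp (- c' * s\<^sup>2)" by (simp add: exp_add[symmetric])
      also have "\<dots> \<le> C * exp (- c' * s\<^sup>2)" by (intro mult_right_mono) (auto simp: C_def)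
      finally show ?thesis using prob_le_1 order_trans by blast
    next
      case False
      obtain k where k: "L * (4 / 3) ^ k \<le> s" "s < L * (4 / 3) ^ Suc k"
        using False L power_bracket[of "4 / 3" L s] by auto
      define m where "m = L * (4 / 3) ^ k"
      have m: "m \<le> s" "s \<le> m * (4 / 3)" "0 < m" using k L by (auto simp: m_def)
      have "measure M {\<omega> \<in> space M. additive_mart \<xi> 0 \<beta> n \<omega> < exp (- s)} \<le> measure M {\<omega> \<in> space M. additive_mart \<xi> 0 \<beta> n \<omega> < - (- exp (- m))}"
        using m by (intro finite_measure_mono) (auto intro: less_le_trans)
      also have "\<dots> \<le> exp (- exp m * - exp (- m)) * (exp (- c * m\<^sup>2) / 4)"
        using lap[of k] g by (intro chernoff_lower) (auto simp: laplace_bound_def m_def)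
      also have "- exp m * - exp (- m) = 1" by (simp add: exp_add[symmetric])
      also have "exp 1 * (exp (- c * m\<^sup>2) / 4) \<le> exp 1 * exp (- c' * s\<^sup>2)"
      proof -
        have "s\<^sup>2 \<le> (m * (4 / 3))\<^sup>2" using m s by (intro power_mono) auto
        hence "c' * s\<^sup>2 \<le> c' * (m * (4 / 3))\<^sup>2" using c'0 by (intro mult_left_mono) auto
        also have "\<dots> = c * m\<^sup>2" by (simp add: c'_def power_mult_distrib power_divide)
        finally have "exp (- c * m\<^sup>2) \<le> exp (- c' * s\<^sup>2)" by simp
        moreover have "exp (- c * m\<^sup>2) / 4 \<le> exp (- c * m\<^sup>2)" by simp
        ultimately show ?thesis by (meson exp_ge_zero mult_left_mono order_trans)
      qed
      also have "\<dots> \<le> C * exp (- c' * s\<^sup>2)" by (intro mult_right_mono) (auto simp: C_def)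
      finally show ?thesis by simp
    qed
  qed
  moreover have "C > 0" by (simp add: C_def add_pos_pos)
  ultimately show ?thesis using c'0 by blast
qed

end

section \<open>The von Bahr--Esseen inequality\<close>

text \<open>A tangent-line bound with remainder of order \<open>p\<close>; near the origin it reduces to Bernoulli's inequality for the exponent \<open>p - 1 \<le> 1\<close>.\<close>

lemma powr_add_le_tangent:
  fixes a b p :: real
  assumes p: "1 < p" "p \<le> 2"
  shows "\<bar>a + b\<bar> powr p \<le> \<bar>a\<bar> powr p + p * (sgn a * \<bar>a\<bar> powr (p - 1)) * b + 6 * \<bar>b\<bar> powr p"
proof (cases "a = 0")
  case False
  define t where "t = b / a"
  have b: "b = a * t" using False by (simp add: t_def)
  have "\<bar>1 + t\<bar> powr p \<le> 1 + p * t + 6 * \<bar>t\<bar> powr p"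
  proof (cases "\<bar>t\<bar> \<le> 1")
    case True
    show ?thesis
    proof (cases "t = -1")
      case True
      thus ?thesis using p by simp
    next
      case False
      hence t: "1 + t > 0" using True by (simp add: abs_le_iff)
      have "(1 + t) powr (p - 1) * 1 powr (2 - p) \<le> (p - 1) * (1 + t) + (2 - p) * 1"
        using p t by (intro Youngs_inequality_0) auto
      hence 1: "(1 + t) powr (p - 1) \<le> 1 + (p - 1) * t" by (simp add: algebra_simps)
      have "(1 + t) powr p = (1 + t) * (1 + t) powr (p - 1)" using t by (simp add: powr_diff)
      also have "\<dots> \<le> (1 + t) * (1 + (p - 1) * t)" using t by (intro mult_left_mono 1) auto
      also have "\<dots> = 1 + p * t + (p - 1) * (t * t)" by (simp add: algebra_simps)
      also have "(p - 1) * (t * t) \<le> 1 * \<bar>t\<bar> powr p"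
      proof (intro mult_mono)
        show "t * t \<le> \<bar>t\<bar> powr p"
        proof (cases "t = 0")
          case False
          have "t * t = \<bar>t\<bar> powr 2" using False by (simp add: power2_eq_square)
          also have "\<dots> \<le> \<bar>t\<bar> powr p" using p True by (intro powr_mono') auto
          finally show ?thesis .
        qed simp
      qed (use p in auto)
      finally have "(1 + t) powr p \<le> 1 + p * t + 1 * \<bar>t\<bar> powr p" by simp
      moreover have "0 \<le> \<bar>t\<bar> powr p" by simp
      ultimately have "(1 + t) powr p \<le> 1 + p * t + 6 * \<bar>t\<bar> powr p" by linarith
      thus ?thesis using t by simp
    qed
  next
    case False
    have 1: "\<bar>t\<bar> \<le> \<bar>t\<bar> powr p"
    proof -
      have "\<bar>t\<bar> powr 1 \<le> \<bar>t\<bar> powr p" using False p by (intro powr_mono) auto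
      thus ?thesis using False by simp
    qed
    have "\<bar>1 + t\<bar> powr p \<le> (2 * \<bar>t\<bar>) powr p" using False p by (intro powr_mono2) auto
    also have "\<dots> = 2 powr p * \<bar>t\<bar> powr p" by (simp add: powr_mult)
    also have "\<dots> \<le> 4 * \<bar>t\<bar> powr p"
    proof (rule mult_right_mono)
      have "(2::real) powr p \<le> 2 powr 2" using p by (intro powr_mono) auto
      thus "(2::real) powr p \<le> 4" by simp
    qed simp
    also have "- (p * t) \<le> 2 * \<bar>t\<bar>" using p mult_right_mono[of p 2 "\<bar>t\<bar>"] abs_ge_minus_self[of "p * t"] by (simp add: abs_mult)
    ultimately show ?thesis using 1 by linarith
  qed
  hence "\<bar>a\<bar> powr p * \<bar>1 + t\<bar> powr p \<le> \<bar>a\<bar> powr p * (1 + p * t + 6 * \<bar>t\<bar> powr p)"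
    by (intro mult_left_mono) auto
  moreover have "\<bar>a + b\<bar> powr p = \<bar>a\<bar> powr p * \<bar>1 + t\<bar> powr p"
  proof -
    have "a + b = a * (1 + t)" by (simp add: b algebra_simps)
    thus ?thesis by (simp add: abs_mult powr_mult)
  qed
  moreover have "\<bar>b\<bar> powr p = \<bar>a\<bar> powr p * \<bar>t\<bar> powr p" by (simp add: b abs_mult powr_mult)
  moreover have "p * (sgn a * \<bar>a\<bar> powr (p - 1)) * b = \<bar>a\<bar> powr p * (p * t)"
    using False by (simp add: b powr_diff sgn_real_def)
  moreover have "\<bar>a\<bar> powr p * (1 + p * t + 6 * \<bar>t\<bar> powr p) = \<bar>a\<bar> powr p + \<bar>a\<bar> powr p * (p * t) + 6 * (\<bar>a\<bar> powr p * \<bar>t\<bar> powr p)"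
    by (simp add: algebra_simps)
  ultimately show ?thesis by linarith
qed simp

text \<open>Adding one summand at a time, the linear term of the tangent bound vanishes by independence and centring.\<close>

lemma (in prob_space) von_Bahr_Esseen:
  fixes Y :: "'i \<Rightarrow> 'a \<Rightarrow> real"
  assumes p: "1 < p" "p \<le> 2" and A: "finite A" and ind: "indep_vars (\<lambda>_. borel) Y A"
    and int: "\<And>i. i \<in> A \<Longrightarrow> integrable M (Y i)" and zero: "\<And>i. i \<in> A \<Longrightarrow> expectation (Y i) = 0"
    and pint: "\<And>i. i \<in> A \<Longrightarrow> integrable M (\<lambda>\<omega>. \<bar>Y i \<omega>\<bar> powr p)"
  shows "integrable M (\<lambda>\<omega>. \<bar>\<Sum>i\<in>A. Y i \<omega>\<bar> powr p) \<and>
    expectation (\<lambda>\<omega>. \<bar>\<Sum>i\<in>A. Y i \<omega>\<bar> powr p) \<le> 6 * (\<Sum>i\<in>A. expectation (\<lambda>\<omega>. \<bar>Y i \<omega>\<bar> powr p))"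
  using A ind int zero pint
proof (induction A rule: finite_induct)
  case (insert i A)
  define S where "S = (\<lambda>\<omega>. \<Sum>i\<in>A. Y i \<omega>)"
  have IH: "integrable M (\<lambda>\<omega>. \<bar>S \<omega>\<bar> powr p)" "expectation (\<lambda>\<omega>. \<bar>S \<omega>\<bar> powr p) \<le> 6 * (\<Sum>i\<in>A. expectation (\<lambda>\<omega>. \<bar>Y i \<omega>\<bar> powr p))"
    unfolding S_def using insert.IH insert.prems indep_vars_subset[OF insert.prems(1), of A] by blast+
  have ind: "indep_var borel (Y i) borel S"
    unfolding S_def by (rule indep_vars_sum) (use insert in auto)
  have [measurable]: "S \<in> borel_measurable M" "Y i \<in> borel_measurable M"
    using indep_var_rv1[OF ind] indep_var_rv2[OF ind] by auto
  define c where "c = (\<lambda>s::real. sgn s * \<bar>s\<bar> powr (p - 1))"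
  have c[measurable]: "c \<in> borel_measurable borel" unfolding c_def by measurable
  have cint: "integrable M (\<lambda>\<omega>. c (S \<omega>))"
  proof (rule Bochner_Integration.integrable_bound)
    show "integrable M (\<lambda>\<omega>. 1 + \<bar>S \<omega>\<bar> powr p)" using IH by auto
    show "AE \<omega> in M. norm (c (S \<omega>)) \<le> norm (1 + \<bar>S \<omega>\<bar> powr p)"
    proof (rule AE_I2)
      fix \<omega>
      have "\<bar>S \<omega>\<bar> powr (p - 1) \<le> 1 + \<bar>S \<omega>\<bar> powr p"
      proof (cases "\<bar>S \<omega>\<bar> \<le> 1")
        case True
        have "\<bar>S \<omega>\<bar> powr (p - 1) \<le> 1" using True p by (intro powr_le1) auto
        thus ?thesis by (simp add: add_increasing2)
      next
        case False
        have "\<bar>S \<omega>\<bar> powr (p - 1) \<le> \<bar>S \<omega>\<bar> powr p" using False by (intro powr_mono) auto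
        thus ?thesis by simp
      qed
      moreover have "\<bar>c (S \<omega>)\<bar> \<le> \<bar>S \<omega>\<bar> powr (p - 1)" by (simp add: c_def abs_mult sgn_real_def)
      ultimately show "norm (c (S \<omega>)) \<le> norm (1 + \<bar>S \<omega>\<bar> powr p)" by simp
    qed
  qed measurable
  have "indep_var borel ((\<lambda>y. y) \<circ> Y i) borel (c \<circ> S)" by (rule indep_var_compose[OF ind]) auto
  hence ind': "indep_var borel (Y i) borel (\<lambda>\<omega>. c (S \<omega>))" by (simp add: comp_def)
  have Yi: "integrable M (Y i)" "expectation (Y i) = 0" "integrable M (\<lambda>\<omega>. \<bar>Y i \<omega>\<bar> powr p)" using insert.prems by auto
  have cross: "integrable M (\<lambda>\<omega>. p * c (S \<omega>) * Y i \<omega>)" "expectation (\<lambda>\<omega>. p * c (S \<omega>) * Y i \<omega>) = 0"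
    using indep_var_integrable[OF ind' Yi(1) cint] indep_var_lebesgue_integral[OF ind' Yi(1) cint] Yi(2)
    by (simp_all add: mult_ac)
  have sum: "(\<Sum>j\<in>insert i A. Y j \<omega>) = S \<omega> + Y i \<omega>" for \<omega>
    using insert.hyps by (simp add: S_def)
  have int1: "integrable M (\<lambda>\<omega>. \<bar>S \<omega> + Y i \<omega>\<bar> powr p)"
  proof (rule Bochner_Integration.integrable_bound)
    show "integrable M (\<lambda>\<omega>. \<bar>S \<omega>\<bar> powr p + p * c (S \<omega>) * Y i \<omega> + 6 * \<bar>Y i \<omega>\<bar> powr p)"
      using IH cross Yi by auto
    show "AE \<omega> in M. norm (\<bar>S \<omega> + Y i \<omega>\<bar> powr p) \<le> norm (\<bar>S \<omega>\<bar> powr p + p * c (S \<omega>) * Y i \<omega> + 6 * \<bar>Y i \<omega>\<bar> powr p)"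
    proof (rule AE_I2)
      fix \<omega>
      from powr_add_le_tangent[OF p, of "S \<omega>" "Y i \<omega>"]
      show "norm (\<bar>S \<omega> + Y i \<omega>\<bar> powr p) \<le> norm (\<bar>S \<omega>\<bar> powr p + p * c (S \<omega>) * Y i \<omega> + 6 * \<bar>Y i \<omega>\<bar> powr p)"
        unfolding c_def by simp
    qed
  qed measurable
  have "expectation (\<lambda>\<omega>. \<bar>S \<omega> + Y i \<omega>\<bar> powr p) \<le> expectation (\<lambda>\<omega>. \<bar>S \<omega>\<bar> powr p + p * c (S \<omega>) * Y i \<omega> + 6 * \<bar>Y i \<omega>\<bar> powr p)"
    using powr_add_le_tangent[OF p] int1 IH cross Yi by (intro integral_mono) (auto simp: c_def)
  also have "\<dots> = expectation (\<lambda>\<omega>. \<bar>S \<omega>\<bar> powr p) + 6 * expectation (\<lambda>\<omega>. \<bar>Y i \<omega>\<bar> powr p)"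
    using IH cross Yi by simp
  finally show ?case
    using int1 IH(2) insert.hyps unfolding sum by simp
qed simp

section \<open>Almost sure convergence\<close>

lemma coordinate_brw_measurable:
  assumes "\<And>v. v \<noteq> [] \<Longrightarrow> prefix v u \<Longrightarrow> v \<in> A"
  shows "(\<lambda>f. brw_pos (\<lambda>v f. f v) u f) \<in> borel_measurable (PiM A (\<lambda>_. borel))"
  unfolding brw_pos_def by (intro borel_measurable_sum measurable_component_singleton) (auto intro: assms)

context gaussian_labels
begin

text \<open>Conditioning on the first \<open>n\<close> generations, written as an integral over two independent copies of the sample space.\<close>

lemma nn_integral_last_generation:
  fixes F :: "(vertex \<Rightarrow> real) \<Rightarrow> (vertex \<Rightarrow> real) \<Rightarrow> ennreal" and n :: nat
  defines "A \<equiv> {v :: vertex. length v \<le> n}" and "B \<equiv> {v :: vertex. length v = Suc n}"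
  assumes F: "(\<lambda>(f, g). F f g) \<in> borel_measurable (PiM A (\<lambda>_. borel) \<Otimes>\<^sub>M PiM B (\<lambda>_. borel))"
  shows "(\<integral>\<^sup>+\<omega>. F (restrict (\<lambda>v. \<xi> v \<omega>) A) (restrict (\<lambda>v. \<xi> v \<omega>) B) \<partial>M) =
    (\<integral>\<^sup>+\<eta>. \<integral>\<^sup>+\<omega>. F (restrict (\<lambda>v. \<xi> v \<eta>) A) (restrict (\<lambda>v. \<xi> v \<omega>) B) \<partial>M \<partial>M)"
proof -
  have ind: "indep_var (PiM A (\<lambda>_. borel)) (\<lambda>\<omega>. restrict (\<lambda>v. \<xi> v \<omega>) A) (PiM B (\<lambda>_. borel)) (\<lambda>\<omega>. restrict (\<lambda>v. \<xi> v \<omega>) B)"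
    by (rule indep_var_restrict[OF indep_labels]) (auto simp: A_def B_def)
  have [measurable]: "(\<lambda>\<omega>. restrict (\<lambda>v. \<xi> v \<omega>) A) \<in> measurable M (PiM A (\<lambda>_. borel))"
     "(\<lambda>\<omega>. restrict (\<lambda>v. \<xi> v \<omega>) B) \<in> measurable M (PiM B (\<lambda>_. borel))"
    using indep_var_rv1[OF ind] indep_var_rv2[OF ind] .
  note F[measurable]
  show ?thesis
    using nn_integral_indep_var[OF ind F] by (simp add: nn_integral_distr)
qed

end

text \<open>Geometric decay of the \<open>p\<close>-th moments of the increments gives geometric decay of their first moments, hence absolute summability almost surely.\<close>

lemma AE_convergent_of_powr_moments:
  fixes X :: "nat \<Rightarrow> 'a \<Rightarrow> real"
  assumes "prob_space M" and [measurable]: "\<And>n. X n \<in> borel_measurable M"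
    and p: "1 < p" and C: "0 \<le> C" and q: "0 < q" "q < 1"
    and le: "\<And>n. (\<integral>\<^sup>+\<omega>. ennreal (\<bar>X (Suc n) \<omega> - X n \<omega>\<bar> powr p) \<partial>M) \<le> ennreal (C * q ^ n)"
  shows "AE \<omega> in M. convergent (\<lambda>n. X n \<omega>)"
proof -
  interpret prob_space M by fact
  \<comment> \<open>Split the increment at the level \<open>r\<^sup>n\<close>; this choice of \<open>r\<close> balances the two parts.\<close>
  define r where "r = q powr (1 / p)"
  have r0: "0 < r" using q by (simp add: r_def)
  have r1: "r < 1" using q p powr_less_mono2[of "1/p" q 1] by (simp add: r_def)
  have rp: "r powr p = q" using q p by (simp add: r_def powr_powr)
  have rr: "(r ^ n) powr (1 - p) * q ^ n = r ^ n" for n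
  proof -
    have "(r ^ n) powr (1 - p) * (r ^ n) powr p = (r ^ n) powr 1"
      by (subst powr_add[symmetric]) simp
    moreover have "(r ^ n) powr p = q ^ n" using r0 by (simp add: power_powr rp)
    ultimately show ?thesis using r0 by simp
  qed
  have bound: "(\<integral>\<^sup>+\<omega>. ennreal \<bar>X (Suc n) \<omega> - X n \<omega>\<bar> \<partial>M) \<le> ennreal ((1 + C) * r ^ n)" for n
  proof -
    have "(\<integral>\<^sup>+\<omega>. ennreal \<bar>X (Suc n) \<omega> - X n \<omega>\<bar> \<partial>M) \<le>
      (\<integral>\<^sup>+\<omega>. ennreal (r ^ n) + ennreal ((r ^ n) powr (1 - p)) * ennreal (\<bar>X (Suc n) \<omega> - X n \<omega>\<bar> powr p) \<partial>M)"
    proof (rule nn_integral_mono)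
      fix \<omega>
      define d where "d = \<bar>X (Suc n) \<omega> - X n \<omega>\<bar>"
      have "d \<le> r ^ n + (r ^ n) powr (1 - p) * d powr p"
      proof (cases "d \<le> r ^ n")
        case True thus ?thesis using r0 by (simp add: add_increasing2)
      next
        case False
        have d0: "0 < d" using False r0 by (meson le_less_trans not_le zero_less_power less_trans)
        have "d powr (1 - p) \<le> (r ^ n) powr (1 - p)" using False r0 p by (intro powr_mono2') auto
        hence "d powr (1 - p) * d powr p \<le> (r ^ n) powr (1 - p) * d powr p" by (intro mult_right_mono) auto
        moreover have "d powr (1 - p) * d powr p = d" using d0 by (simp add: powr_add[symmetric])
        ultimately show ?thesis using r0 zero_less_power[OF r0, of n] by linarith
      qed
      hence "ennreal d \<le> ennreal (r ^ n + (r ^ n) powr (1 - p) * d powr p)" by (rule ennreal_leI)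
      also have "\<dots> = ennreal (r ^ n) + ennreal ((r ^ n) powr (1 - p)) * ennreal (d powr p)"
        using r0 by (simp add: ennreal_mult)
      finally show "ennreal \<bar>X (Suc n) \<omega> - X n \<omega>\<bar> \<le> ennreal (r ^ n) + ennreal ((r ^ n) powr (1 - p)) * ennreal (\<bar>X (Suc n) \<omega> - X n \<omega>\<bar> powr p)"
        by (simp add: d_def)
    qed
    also have "\<dots> = ennreal (r ^ n) + ennreal ((r ^ n) powr (1 - p)) * (\<integral>\<^sup>+\<omega>. ennreal (\<bar>X (Suc n) \<omega> - X n \<omega>\<bar> powr p) \<partial>M)"
      by (subst nn_integral_add) (simp_all add: nn_integral_cmult emeasure_space_1)
    also have "\<dots> \<le> ennreal (r ^ n) + ennreal ((r ^ n) powr (1 - p)) * ennreal (C * q ^ n)"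
      by (intro add_left_mono mult_left_mono le) auto
    also have "\<dots> = ennreal (r ^ n + C * ((r ^ n) powr (1 - p) * q ^ n))"
      using r0 C q by (simp add: ennreal_mult[symmetric] ennreal_plus[symmetric] mult_ac del: ennreal_plus)
    finally show ?thesis unfolding rr by (simp add: algebra_simps)
  qed
  have "(\<integral>\<^sup>+\<omega>. (\<Sum>n. ennreal \<bar>X (Suc n) \<omega> - X n \<omega>\<bar>) \<partial>M) = (\<Sum>n. \<integral>\<^sup>+\<omega>. ennreal \<bar>X (Suc n) \<omega> - X n \<omega>\<bar> \<partial>M)"
    by (rule nn_integral_suminf) measurable
  also have "\<dots> \<le> (\<Sum>n. ennreal ((1 + C) * r ^ n))" by (intro suminf_le bound) auto
  also have "\<dots> = ennreal (\<Sum>n. (1 + C) * r ^ n)"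
    using r0 r1 C by (intro suminf_ennreal2 summable_mult summable_geometric) auto
  also have "\<dots> < \<infinity>" by simp
  finally have fin: "(\<integral>\<^sup>+\<omega>. (\<Sum>n. ennreal \<bar>X (Suc n) \<omega> - X n \<omega>\<bar>) \<partial>M) \<noteq> \<infinity>" by simp
  have "AE \<omega> in M. (\<Sum>n. ennreal \<bar>X (Suc n) \<omega> - X n \<omega>\<bar>) \<noteq> \<infinity>"
    by (rule nn_integral_PInf_AE[OF _ fin]) measurable
  thus ?thesis
  proof eventually_elim
    case (elim \<omega>)
    hence "summable (\<lambda>n. \<bar>X (Suc n) \<omega> - X n \<omega>\<bar>)" by (intro summable_suminf_not_top) auto
    hence "summable (\<lambda>n. X (Suc n) \<omega> - X n \<omega>)" by (rule summable_rabs_cancel)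
    hence "(\<lambda>n. \<Sum>i<n. X (Suc i) \<omega> - X i \<omega>) \<longlonglongrightarrow> (\<Sum>i. X (Suc i) \<omega> - X i \<omega>)" by (rule summable_LIMSEQ)
    hence "(\<lambda>n. (X n \<omega> - X 0 \<omega>) + X 0 \<omega>) \<longlonglongrightarrow> (\<Sum>i. X (Suc i) \<omega> - X i \<omega>) + X 0 \<omega>"
      unfolding sum_lessThan_telescope[of "\<lambda>i. X i \<omega>"] by (intro tendsto_add tendsto_const)
    thus ?case by (auto simp: convergent_def)
  qed
qed

context subcritical
begin

definition drifted :: "(vertex \<Rightarrow> 'a \<Rightarrow> real) \<Rightarrow> real \<Rightarrow> vertex \<Rightarrow> 'a \<Rightarrow> real" where
  "drifted \<xi> x u \<omega> = x + brw_pos \<xi> u \<omega> - \<beta> * real (length u)"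

lemma drifted_snoc: "drifted \<xi> x (u @ [b]) \<omega> = drifted \<xi> x u \<omega> + \<xi> (u @ [b]) \<omega> - \<beta>"
  by (simp add: drifted_def brw_pos_snoc algebra_simps)

text \<open>The mean of the derivative martingale started at \<open>x\<close>.\<close>

definition mean_D :: "real \<Rightarrow> real" where "mean_D x = x * exp (\<beta> * x)"

lemma derivative_mart_drifted:
  "derivative_mart \<xi> x \<beta> n \<omega> = scale ^ n * (\<Sum>u | length u = n. mean_D (drifted \<xi> x u \<omega>))"
proof -
  have "(x + brw_pos \<xi> u \<omega> - \<beta> * real n) * exp (\<beta> * (x + brw_pos \<xi> u \<omega>) - \<beta>\<^sup>2 / 2 * real n) =
    exp (\<beta>\<^sup>2 / 2) ^ n * mean_D (drifted \<xi> x u \<omega>)" if "length u = n" for u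
  proof -
    have "exp (\<beta>\<^sup>2 / 2) ^ n * exp (\<beta> * (x + brw_pos \<xi> u \<omega> - \<beta> * real n)) = exp (\<beta> * (x + brw_pos \<xi> u \<omega>) - \<beta>\<^sup>2 / 2 * real n)"
      by (simp add: exp_of_nat_mult[symmetric] exp_add[symmetric] power2_eq_square algebra_simps)
    thus ?thesis using that by (simp add: mean_D_def drifted_def)
  qed
  hence "derivative_mart \<xi> x \<beta> n \<omega> = 1 / 2 ^ n * (\<Sum>u | length u = n. exp (\<beta>\<^sup>2 / 2) ^ n * mean_D (drifted \<xi> x u \<omega>))"
    unfolding derivative_mart_def by simp
  thus ?thesis by (simp add: sum_distrib_left[symmetric] scale_def power_divide)
qed

text \<open>Halving the contribution of a vertex between its children makes the increment a sum of centred terms, one for each vertex of the new generation.\<close>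

lemma derivative_mart_increment:
  "derivative_mart \<xi> x \<beta> (Suc n) \<omega> - derivative_mart \<xi> x \<beta> n \<omega> =
    scale ^ n * (\<Sum>w | length w = Suc n. scale * mean_D (drifted \<xi> x (butlast w) \<omega> + \<xi> w \<omega> - \<beta>) - mean_D (drifted \<xi> x (butlast w) \<omega>) / 2)"
  unfolding derivative_mart_drifted sum_words_Suc_snoc
  by (simp add: drifted_snoc sum_distrib_left sum_subtractf[symmetric] algebra_simps)

lemma mean_D_moment:
  "integrable stdN (\<lambda>s. scale * mean_D (x + s - \<beta>) - mean_D x / 2)"
  "(\<integral>s. scale * mean_D (x + s - \<beta>) - mean_D x / 2 \<partial>stdN) = 0"
  "integrable stdN (\<lambda>s. \<bar>scale * mean_D (x + s - \<beta>) - mean_D x / 2\<bar> powr p)"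
  "(\<integral>s. \<bar>scale * mean_D (x + s - \<beta>) - mean_D x / 2\<bar> powr p \<partial>stdN) \<le> 8 * moment_const * tilt x"
proof -
  interpret prob_space stdN by (rule prob_space_stdN)
  have i: "integrable stdN (\<lambda>s. scale * mean_D (x + s - \<beta>))"
    unfolding mean_D_def by (intro integrable_mult_right tilted_gauss_id)
  show "integrable stdN (\<lambda>s. scale * mean_D (x + s - \<beta>) - mean_D x / 2)"
    by (intro Bochner_Integration.integrable_diff i) auto
  have "(\<integral>s. scale * mean_D (x + s - \<beta>) - mean_D x / 2 \<partial>stdN) = scale * (x * exp (\<beta> * x) * exp (- \<beta>\<^sup>2 / 2)) - mean_D x / 2"
    using i by (subst Bochner_Integration.integral_diff) (auto simp: mean_D_def tilted_gauss_id prob_space[simplified])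
  also have "\<dots> = 0" by (simp add: scale_def mean_D_def exp_minus)
  finally show "(\<integral>s. scale * mean_D (x + s - \<beta>) - mean_D x / 2 \<partial>stdN) = 0" .
  define R where "R = (\<lambda>s. 4 * moment_const * (scale powr p * tilt (x + s - \<beta>)) + 4 * moment_const * tilt x)"
  have gp: "\<bar>mean_D y\<bar> powr p \<le> moment_const * tilt y" for y
    using x_exp_powr_le_tilt[of y] by (simp add: mean_D_def moment_const_def)
  have le: "\<bar>scale * mean_D (x + s - \<beta>) - mean_D x / 2\<bar> powr p \<le> R s" for s
  proof -
    have "\<bar>scale * mean_D (x + s - \<beta>) - mean_D x / 2\<bar> powr p \<le> (\<bar>scale * mean_D (x + s - \<beta>)\<bar> + \<bar>mean_D x\<bar>) powr p"
      using p_gt_1 by (intro powr_mono2) auto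
    also have "\<dots> \<le> 4 * (\<bar>scale * mean_D (x + s - \<beta>)\<bar> powr p + \<bar>mean_D x\<bar> powr p)"
      using p_gt_1 p_le_2 by (intro powr_add_le) auto
    also have "\<bar>scale * mean_D (x + s - \<beta>)\<bar> powr p = scale powr p * \<bar>mean_D (x + s - \<beta>)\<bar> powr p"
      using scale_pos by (simp add: abs_mult powr_mult)
    also have "\<dots> \<le> scale powr p * (moment_const * tilt (x + s - \<beta>))" by (intro mult_left_mono gp) auto
    finally show ?thesis using gp[of x] by (simp add: R_def algebra_simps)
  qed
  have Ri: "integrable stdN R" unfolding R_def
    by (intro Bochner_Integration.integrable_add integrable_mult_right tilt_step) auto
  have m: "(\<lambda>s. \<bar>scale * mean_D (x + s - \<beta>) - mean_D x / 2\<bar> powr p) \<in> borel_measurable stdN"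
    unfolding mean_D_def by measurable
  show pi: "integrable stdN (\<lambda>s. \<bar>scale * mean_D (x + s - \<beta>) - mean_D x / 2\<bar> powr p)"
    by (rule Bochner_Integration.integrable_bound[OF Ri m], rule AE_I2) (use le in \<open>simp add: order_trans[OF _ abs_ge_self]\<close>)
  have "(\<integral>s. \<bar>scale * mean_D (x + s - \<beta>) - mean_D x / 2\<bar> powr p \<partial>stdN) \<le> (\<integral>s. R s \<partial>stdN)"
    by (intro integral_mono pi Ri le)
  also have "\<dots> = 4 * moment_const * (scale powr p * (\<integral>s. tilt (x + s - \<beta>) \<partial>stdN)) + 4 * moment_const * tilt x"
    unfolding R_def by (subst Bochner_Integration.integral_add) (auto intro!: integrable_mult_right tilt_step simp: prob_space[simplified])
  also have "\<dots> \<le> 4 * moment_const * tilt x + 4 * moment_const * tilt x"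
  proof -
    have "0 \<le> (\<integral>s. tilt (x + s - \<beta>) \<partial>stdN)" by (intro integral_nonneg_AE AE_I2) (simp add: tilt_pos less_imp_le)
    hence "scale powr p * (\<integral>s. tilt (x + s - \<beta>) \<partial>stdN) \<le> 2 * scale powr p * (\<integral>s. tilt (x + s - \<beta>) \<partial>stdN)" by simp
    also have "\<dots> \<le> rate * tilt x" by (rule tilt_step)
    also have "\<dots> \<le> 1 * tilt x" using rate_less tilt_pos[of x] by (intro mult_right_mono) auto
    finally show ?thesis using moment_const_pos by (intro add_right_mono mult_left_mono) auto
  qed
  finally show "(\<integral>s. \<bar>scale * mean_D (x + s - \<beta>) - mean_D x / 2\<bar> powr p \<partial>stdN) \<le> 8 * moment_const * tilt x" by simp
qed

lemma drifted_measurable: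
  assumes "gaussian_labels M \<xi>" shows "drifted \<xi> x u \<in> borel_measurable M"
proof -
  interpret gaussian_labels M \<xi> by fact
  show ?thesis unfolding drifted_def[abs_def] by measurable
qed

lemma tilt_measurable [measurable]: "tilt \<in> borel_measurable borel" unfolding tilt_def by measurable

lemma tilt_drifted_measurable:
  "gaussian_labels M \<xi> \<Longrightarrow> (\<lambda>\<omega>. ennreal (tilt (drifted \<xi> x u \<omega>))) \<in> borel_measurable M"
  by (rule measurable_compose[OF drifted_measurable]) measurable

lemma mean_D_measurable [measurable]: "mean_D \<in> borel_measurable borel" unfolding mean_D_def by measurable

lemma coordinate_drifted:
  assumes "length u \<le> n"
  shows "(\<lambda>f. drifted (\<lambda>v f. f v) x u f) \<in> borel_measurable (PiM {v. length v \<le> n} (\<lambda>_. borel))"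
    "drifted (\<lambda>v f. f v) x u (restrict (\<lambda>v. \<xi> v \<omega>) {v. length v \<le> n}) = drifted \<xi> x u \<omega>"
proof -
  have [measurable]: "(\<lambda>f. brw_pos (\<lambda>v f. f v) u f) \<in> borel_measurable (PiM {v. length v \<le> n} (\<lambda>_. borel))"
    using assms by (intro coordinate_brw_measurable) (auto dest: prefix_length_le)
  show "(\<lambda>f. drifted (\<lambda>v f. f v) x u f) \<in> borel_measurable (PiM {v. length v \<le> n} (\<lambda>_. borel))"
    unfolding drifted_def by measurable
  have "brw_pos (\<lambda>v f. f v) u (restrict (\<lambda>v. \<xi> v \<omega>) {v. length v \<le> n}) = brw_pos \<xi> u \<omega>"
    unfolding brw_pos_def using assms by (intro sum.cong) (auto dest: prefix_length_le)
  thus "drifted (\<lambda>v f. f v) x u (restrict (\<lambda>v. \<xi> v \<omega>) {v. length v \<le> n}) = drifted \<xi> x u \<omega>"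
    by (simp add: drifted_def)
qed

lemma tilt_drifted_moment:
  assumes "gaussian_labels M \<xi>"
  shows "(\<integral>\<^sup>+\<omega>. ennreal (tilt (drifted \<xi> x u \<omega>)) \<partial>M) \<le> ennreal ((rate / (2 * scale powr p)) ^ length u * tilt x)"
proof (induction u rule: rev_induct)
  case Nil
  interpret gaussian_labels M \<xi> by fact
  show ?case by (simp add: drifted_def emeasure_space_1)
next
  case (snoc b u)
  interpret gaussian_labels M \<xi> by fact
  define n where "n = length u"
  define A where "A = {v :: vertex. length v \<le> n}"
  define B where "B = {v :: vertex. length v = Suc n}"
  define F where "F = (\<lambda>f g. ennreal (tilt (drifted (\<lambda>v f. f v) x u f + g (u @ [b]) - \<beta>)))"
  have [measurable]: "(\<lambda>f. drifted (\<lambda>v f. f v) x u f) \<in> borel_measurable (PiM A (\<lambda>_. borel))"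
    unfolding A_def by (rule coordinate_drifted) (simp add: n_def)
  have [measurable]: "(\<lambda>f. f (u @ [b])) \<in> borel_measurable (PiM B (\<lambda>_. borel))"
    by (rule measurable_component_singleton) (simp add: B_def n_def)
  have F: "(\<lambda>(f, g). F f g) \<in> borel_measurable (PiM A (\<lambda>_. borel) \<Otimes>\<^sub>M PiM B (\<lambda>_. borel))"
    unfolding F_def by measurable
  have Fe: "F (restrict (\<lambda>v. \<xi> v \<eta>) A) (restrict (\<lambda>v. \<xi> v \<omega>) B) = ennreal (tilt (drifted \<xi> x u \<eta> + \<xi> (u @ [b]) \<omega> - \<beta>))" for \<eta> \<omega>
    unfolding F_def A_def by (subst coordinate_drifted) (auto simp: n_def B_def)
  define c where "c = rate / (2 * scale powr p)"
  have c: "0 \<le> c" using rate_pos by (simp add: c_def)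
  have "(\<integral>\<^sup>+\<omega>. ennreal (tilt (drifted \<xi> x (u @ [b]) \<omega>)) \<partial>M) = (\<integral>\<^sup>+\<eta>. \<integral>\<^sup>+\<omega>. ennreal (tilt (drifted \<xi> x u \<eta> + \<xi> (u @ [b]) \<omega> - \<beta>)) \<partial>M \<partial>M)"
    using nn_integral_last_generation[OF F[unfolded A_def B_def]] unfolding A_def[symmetric] B_def[symmetric] Fe drifted_snoc .
  also have "\<dots> \<le> (\<integral>\<^sup>+\<eta>. ennreal c * ennreal (tilt (drifted \<xi> x u \<eta>)) \<partial>M)"
  proof (rule nn_integral_mono)
    fix \<eta>
    define y where "y = drifted \<xi> x u \<eta>"
    have "(\<integral>\<^sup>+\<omega>. ennreal (tilt (y + \<xi> (u @ [b]) \<omega> - \<beta>)) \<partial>M) = (\<integral>\<^sup>+s. ennreal (tilt (y + s - \<beta>)) \<partial>distr M borel (\<xi> (u @ [b])))"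
      by (subst nn_integral_distr) auto
    also have "\<dots> = ennreal (\<integral>s. tilt (y + s - \<beta>) \<partial>stdN)"
      unfolding distr_label using tilt_step tilt_pos by (intro nn_integral_eq_integral) (auto simp: less_imp_le)
    also have "\<dots> \<le> ennreal (c * tilt y)"
      using tilt_step(2)[of y] scale_pos by (intro ennreal_leI) (simp add: c_def field_simps)
    also have "\<dots> = ennreal c * ennreal (tilt y)" using c tilt_pos[of y] by (simp add: ennreal_mult)
    finally show "(\<integral>\<^sup>+\<omega>. ennreal (tilt (drifted \<xi> x u \<eta> + \<xi> (u @ [b]) \<omega> - \<beta>)) \<partial>M) \<le> ennreal c * ennreal (tilt (drifted \<xi> x u \<eta>))"
      by (simp add: y_def)
  qed
  also have "\<dots> = ennreal c * (\<integral>\<^sup>+\<eta>. ennreal (tilt (drifted \<xi> x u \<eta>)) \<partial>M)"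
    by (intro nn_integral_cmult tilt_drifted_measurable assms)
  also have "\<dots> \<le> ennreal c * ennreal (c ^ length u * tilt x)" using snoc.IH by (intro mult_left_mono) (auto simp: c_def)
  also have "\<dots> = ennreal (c ^ length (u @ [b]) * tilt x)" using c tilt_pos[of x] by (simp add: ennreal_mult[symmetric] mult_ac)
  finally show ?case by (simp add: c_def)
qed

lemma card_words: "card {w :: bool list. length w = n} = 2 ^ n"
  using card_lists_length_eq[of "UNIV :: bool set" n] by simp

text \<open>Given the first \<open>n\<close> generations, the increment is a sum of independent centred terms, so its \<open>p\<close>-th moment is additive up to a constant; \<open>tilt\<close> then contracts by \<open>rate\<close> in each earlier generation.\<close>

lemma derivative_increment_moment:
  assumes "gaussian_labels M \<xi>"
  shows "(\<integral>\<^sup>+\<omega>. ennreal (\<bar>derivative_mart \<xi> x \<beta> (Suc n) \<omega> - derivative_mart \<xi> x \<beta> n \<omega>\<bar> powr p) \<partial>M) \<le>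
    ennreal (96 * moment_const * tilt x * rate ^ n)"
proof -
  interpret gaussian_labels M \<xi> by fact
  define A where "A = {v :: vertex. length v \<le> n}"
  define B where "B = {v :: vertex. length v = Suc n}"
  define \<psi> where "\<psi> = (\<lambda>y s. scale * mean_D (y + s - \<beta>) - mean_D y / 2)"
  have \<psi>m[measurable]: "(\<lambda>(y, s). \<psi> y s) \<in> borel_measurable (borel \<Otimes>\<^sub>M borel)" unfolding \<psi>_def by measurable
  define F where "F = (\<lambda>f g. ennreal (\<bar>scale ^ n * (\<Sum>w\<in>B. \<psi> (drifted (\<lambda>v f. f v) x (butlast w) f) (g w))\<bar> powr p))"
  have bl: "length (butlast w) \<le> n" if "w \<in> B" for w using that by (simp add: B_def)
  have fB: "finite B" unfolding B_def by simp
  have [measurable]: "(\<lambda>f. drifted (\<lambda>v f. f v) x (butlast w) f) \<in> borel_measurable (PiM A (\<lambda>_. borel))" if "w \<in> B" for w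
    unfolding A_def by (rule coordinate_drifted) (rule bl[OF that])
  have [measurable]: "(\<lambda>f. f w) \<in> borel_measurable (PiM B (\<lambda>_. borel))" if "w \<in> B" for w
    by (rule measurable_component_singleton) (rule that)
  have F: "(\<lambda>(f, g). F f g) \<in> borel_measurable (PiM A (\<lambda>_. borel) \<Otimes>\<^sub>M PiM B (\<lambda>_. borel))"
    unfolding F_def by measurable
  have Fe: "F (restrict (\<lambda>v. \<xi> v \<eta>) A) (restrict (\<lambda>v. \<xi> v \<omega>) B) = ennreal (\<bar>scale ^ n * (\<Sum>w\<in>B. \<psi> (drifted \<xi> x (butlast w) \<eta>) (\<xi> w \<omega>))\<bar> powr p)" for \<eta> \<omega>
  proof -
    have "(\<Sum>w\<in>B. \<psi> (drifted (\<lambda>v f. f v) x (butlast w) (restrict (\<lambda>v. \<xi> v \<eta>) A)) (restrict (\<lambda>v. \<xi> v \<omega>) B w)) = (\<Sum>w\<in>B. \<psi> (drifted \<xi> x (butlast w) \<eta>) (\<xi> w \<omega>))"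
      unfolding A_def by (intro sum.cong refl, subst coordinate_drifted) (auto simp: B_def)
    thus ?thesis by (simp add: F_def)
  qed
  have inc: "derivative_mart \<xi> x \<beta> (Suc n) \<omega> - derivative_mart \<xi> x \<beta> n \<omega> = scale ^ n * (\<Sum>w\<in>B. \<psi> (drifted \<xi> x (butlast w) \<omega>) (\<xi> w \<omega>))" for \<omega>
    unfolding derivative_mart_increment B_def \<psi>_def ..
  define k where "k = scale powr p"
  have k0: "k > 0" using scale_pos by (simp add: k_def)
  have kn: "(scale ^ n) powr p = k ^ n" using scale_pos by (simp add: k_def power_powr)
  define c where "c = rate / (2 * k)"
  have c: "0 \<le> c" using rate_pos k0 by (simp add: c_def)
  have "(\<integral>\<^sup>+\<omega>. ennreal (\<bar>derivative_mart \<xi> x \<beta> (Suc n) \<omega> - derivative_mart \<xi> x \<beta> n \<omega>\<bar> powr p) \<partial>M) =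
    (\<integral>\<^sup>+\<eta>. \<integral>\<^sup>+\<omega>. ennreal (\<bar>scale ^ n * (\<Sum>w\<in>B. \<psi> (drifted \<xi> x (butlast w) \<eta>) (\<xi> w \<omega>))\<bar> powr p) \<partial>M \<partial>M)"
    using nn_integral_last_generation[OF F[unfolded A_def B_def]] unfolding A_def[symmetric] B_def[symmetric] Fe inc .
  also have "\<dots> \<le> (\<integral>\<^sup>+\<eta>. ennreal (k ^ n * 48 * moment_const) * (\<Sum>w\<in>B. ennreal (tilt (drifted \<xi> x (butlast w) \<eta>))) \<partial>M)"
  proof (rule nn_integral_mono)
    fix \<eta>
    define y where "y = (\<lambda>w. drifted \<xi> x (butlast w) \<eta>)"
    define Y where "Y = (\<lambda>w \<omega>. \<psi> (y w) (\<xi> w \<omega>))"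
    have ind: "indep_vars (\<lambda>_. borel) Y B"
      unfolding Y_def by (rule indep_vars_compose2[OF indep_vars_subset[OF indep_labels]]) auto
    have to_stdN: "integrable M (\<lambda>\<omega>. f (\<xi> w \<omega>)) \<longleftrightarrow> integrable stdN f" "expectation (\<lambda>\<omega>. f (\<xi> w \<omega>)) = (\<integral>s. f s \<partial>stdN)"
      if [measurable]: "f \<in> borel_measurable borel" for f :: "real \<Rightarrow> real" and w
      unfolding distr_label[of w, symmetric] by (simp_all add: integrable_distr_eq integral_distr)
    have m: "(\<lambda>s. \<psi> (y w) s) \<in> borel_measurable borel" "(\<lambda>s. \<bar>\<psi> (y w) s\<bar> powr p) \<in> borel_measurable borel" for w by measurable
    have "integrable M (\<lambda>\<omega>. \<bar>\<Sum>w\<in>B. Y w \<omega>\<bar> powr p) \<and>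
      expectation (\<lambda>\<omega>. \<bar>\<Sum>w\<in>B. Y w \<omega>\<bar> powr p) \<le> 6 * (\<Sum>w\<in>B. expectation (\<lambda>\<omega>. \<bar>Y w \<omega>\<bar> powr p))"
    proof (rule von_Bahr_Esseen[OF p_gt_1 p_le_2 fB ind])
      fix w
      show "integrable M (Y w)" "expectation (Y w) = 0" "integrable M (\<lambda>\<omega>. \<bar>Y w \<omega>\<bar> powr p)"
        unfolding Y_def using to_stdN[OF m(1)] to_stdN[OF m(2)] mean_D_moment by (simp_all add: \<psi>_def)
    qed
    moreover
    have "expectation (\<lambda>\<omega>. \<bar>Y w \<omega>\<bar> powr p) \<le> 8 * moment_const * tilt (y w)" for w
      unfolding Y_def using to_stdN(2)[OF m(2)] mean_D_moment(4) by (simp add: \<psi>_def)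
    hence "6 * (\<Sum>w\<in>B. expectation (\<lambda>\<omega>. \<bar>Y w \<omega>\<bar> powr p)) \<le> 6 * (\<Sum>w\<in>B. 8 * moment_const * tilt (y w))"
      by (intro mult_left_mono sum_mono) auto
    ultimately have i: "integrable M (\<lambda>\<omega>. \<bar>\<Sum>w\<in>B. Y w \<omega>\<bar> powr p)" and
      e: "expectation (\<lambda>\<omega>. \<bar>\<Sum>w\<in>B. Y w \<omega>\<bar> powr p) \<le> 6 * (\<Sum>w\<in>B. 8 * moment_const * tilt (y w))"
      by linarith+
    have "(\<integral>\<^sup>+\<omega>. ennreal (\<bar>scale ^ n * (\<Sum>w\<in>B. Y w \<omega>)\<bar> powr p) \<partial>M) = (\<integral>\<^sup>+\<omega>. ennreal (k ^ n * \<bar>\<Sum>w\<in>B. Y w \<omega>\<bar> powr p) \<partial>M)"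
      using scale_pos by (simp add: abs_mult powr_mult kn)
    also have "\<dots> = ennreal (k ^ n * expectation (\<lambda>\<omega>. \<bar>\<Sum>w\<in>B. Y w \<omega>\<bar> powr p))"
      using i k0 by (subst nn_integral_eq_integral) auto
    also have "\<dots> \<le> ennreal (k ^ n * 48 * moment_const * (\<Sum>w\<in>B. tilt (y w)))"
    proof (rule ennreal_leI)
      have "k ^ n * expectation (\<lambda>\<omega>. \<bar>\<Sum>w\<in>B. Y w \<omega>\<bar> powr p) \<le> k ^ n * (6 * (\<Sum>w\<in>B. 8 * moment_const * tilt (y w)))"
        using k0 by (intro mult_left_mono e) auto
      also have "\<dots> = k ^ n * 48 * moment_const * (\<Sum>w\<in>B. tilt (y w))" by (simp add: sum_distrib_left[symmetric])
      finally show "k ^ n * expectation (\<lambda>\<omega>. \<bar>\<Sum>w\<in>B. Y w \<omega>\<bar> powr p) \<le> k ^ n * 48 * moment_const * (\<Sum>w\<in>B. tilt (y w))" .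
    qed
    also have "\<dots> = ennreal (k ^ n * 48 * moment_const) * (\<Sum>w\<in>B. ennreal (tilt (y w)))"
      using k0 moment_const_pos by (simp add: ennreal_mult sum_nonneg sum_ennreal tilt_pos less_imp_le)
    finally show "(\<integral>\<^sup>+\<omega>. ennreal (\<bar>scale ^ n * (\<Sum>w\<in>B. \<psi> (drifted \<xi> x (butlast w) \<eta>) (\<xi> w \<omega>))\<bar> powr p) \<partial>M) \<le> ennreal (k ^ n * 48 * moment_const) * (\<Sum>w\<in>B. ennreal (tilt (drifted \<xi> x (butlast w) \<eta>)))"
      by (simp add: Y_def y_def)
  qed
  also have "\<dots> = ennreal (k ^ n * 48 * moment_const) * (\<Sum>w\<in>B. \<integral>\<^sup>+\<eta>. ennreal (tilt (drifted \<xi> x (butlast w) \<eta>)) \<partial>M)"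
    using tilt_drifted_measurable[OF assms] by (subst nn_integral_cmult) (auto simp: nn_integral_sum)
  also have "\<dots> \<le> ennreal (k ^ n * 48 * moment_const) * (\<Sum>w\<in>B. ennreal (c ^ n * tilt x))"
  proof (intro mult_left_mono sum_mono)
    fix w assume "w \<in> B"
    thus "(\<integral>\<^sup>+\<eta>. ennreal (tilt (drifted \<xi> x (butlast w) \<eta>)) \<partial>M) \<le> ennreal (c ^ n * tilt x)"
      using tilt_drifted_moment[OF assms, of x "butlast w"] by (simp add: B_def c_def k_def)
  qed auto
  also have "(\<Sum>w\<in>B. ennreal (c ^ n * tilt x)) = ennreal (2 ^ Suc n * (c ^ n * tilt x))"
    using c tilt_pos[of x] by (simp add: B_def card_words ennreal_mult ennreal_power[symmetric])
  also have "ennreal (k ^ n * 48 * moment_const) * \<dots> = ennreal (k ^ n * 48 * moment_const * (2 ^ Suc n * (c ^ n * tilt x)))"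
    using c tilt_pos[of x] k0 moment_const_pos by (intro ennreal_mult[symmetric]) auto
  also have "k ^ n * 48 * moment_const * (2 ^ Suc n * (c ^ n * tilt x)) = 96 * moment_const * tilt x * rate ^ n"
    using k0 by (simp add: c_def power_divide power_mult_distrib)
  finally show ?thesis .
qed

lemma derivative_mart_converges:
  assumes "gaussian_labels M \<xi>"
  shows "AE \<omega> in M. (\<lambda>n. derivative_mart \<xi> x \<beta> n \<omega>) \<longlonglongrightarrow> derivative_limit \<xi> x \<beta> \<omega>"
proof -
  interpret gaussian_labels M \<xi> by fact
  have "AE \<omega> in M. convergent (\<lambda>n. derivative_mart \<xi> x \<beta> n \<omega>)"
    using moment_const_pos tilt_pos[of x] rate_pos rate_less
    by (intro AE_convergent_of_powr_moments[OF prob_space_axioms _ p_gt_1 _ _ _ derivative_increment_moment[OF assms]]) auto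
  thus ?thesis by eventually_elim (simp add: derivative_limit_def convergent_LIMSEQ_iff)
qed

text \<open>By the shift identity, \<open>W[x]\<close> is a linear combination of \<open>D[x]\<close> and \<open>D[x + 1]\<close>.\<close>

lemma additive_mart_converges:
  assumes "gaussian_labels M \<xi>"
  shows "AE \<omega> in M. (\<lambda>n. additive_mart \<xi> x \<beta> n \<omega>) \<longlonglongrightarrow> additive_limit \<xi> x \<beta> \<omega>"
proof -
  have e: "additive_mart \<xi> x \<beta> n \<omega> = exp (- \<beta>) * derivative_mart \<xi> (x + 1) \<beta> n \<omega> - derivative_mart \<xi> x \<beta> n \<omega>" for n \<omega>
    using mart_shift(2)[of \<xi> x 1 \<beta> n \<omega>] by (simp add: exp_minus field_simps)
  show ?thesis
    using derivative_mart_converges[OF assms, of x] derivative_mart_converges[OF assms, of "x + 1"]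
  proof eventually_elim
    case (elim \<omega>)
    hence "(\<lambda>n. additive_mart \<xi> x \<beta> n \<omega>) \<longlonglongrightarrow> exp (- \<beta>) * derivative_limit \<xi> (x + 1) \<beta> \<omega> - derivative_limit \<xi> x \<beta> \<omega>"
      unfolding e by (intro tendsto_intros)
    hence "convergent (\<lambda>n. additive_mart \<xi> x \<beta> n \<omega>)" by (auto simp: convergent_def)
    thus ?case by (simp add: additive_limit_def convergent_LIMSEQ_iff)
  qed
qed

end

section \<open>Tails of the limits\<close>

text \<open>The event is open, so its indicator is below the lower limit of the indicators along the sequence, and Fatou's lemma applies.\<close>

lemma (in prob_space) limit_tail_le:
  fixes Y :: "nat \<Rightarrow> 'a \<Rightarrow> real"
  assumes [measurable]: "\<And>n. Y n \<in> borel_measurable M" "Z \<in> borel_measurable M"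
    and lim: "AE \<omega> in M. (\<lambda>n. Y n \<omega>) \<longlonglongrightarrow> Z \<omega>"
    and B: "\<And>n. measure M {\<omega> \<in> space M. Y (n + k) \<omega> < t} \<le> B"
  shows "measure M {\<omega> \<in> space M. Z \<omega> < t} \<le> B"
proof -
  have B0: "0 \<le> B" using B[of 0] measure_nonneg order_trans by blast
  have "emeasure M {\<omega> \<in> space M. Z \<omega> < t} = (\<integral>\<^sup>+\<omega>. indicator {\<omega> \<in> space M. Z \<omega> < t} \<omega> \<partial>M)" by simp
  also have "\<dots> \<le> (\<integral>\<^sup>+\<omega>. liminf (\<lambda>n. indicator {\<omega> \<in> space M. Y (n + k) \<omega> < t} \<omega>) \<partial>M)"
  proof (rule nn_integral_mono_AE)
    show "AE \<omega> in M. indicator {\<omega> \<in> space M. Z \<omega> < t} \<omega> \<le> liminf (\<lambda>n. indicator {\<omega> \<in> space M. Y (n + k) \<omega> < t} \<omega> :: ennreal)"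
      using lim AE_space
    proof eventually_elim
      case (elim \<omega>)
      show ?case
      proof (cases "Z \<omega> < t")
        case True
        have "(\<lambda>n. Y (n + k) \<omega>) \<longlonglongrightarrow> Z \<omega>" using elim(1) by (rule LIMSEQ_ignore_initial_segment)
        hence "eventually (\<lambda>n. Y (n + k) \<omega> < t) sequentially" using True by (rule order_tendstoD)
        hence "1 \<le> liminf (\<lambda>n. indicator {\<omega> \<in> space M. Y (n + k) \<omega> < t} \<omega> :: ennreal)"
          using elim(2) by (intro Liminf_bounded) (auto elim!: eventually_mono)
        moreover have "indicator {\<omega> \<in> space M. Z \<omega> < t} \<omega> \<le> (1 :: ennreal)" by (simp add: indicator_def)
        ultimately show ?thesis by (rule order_trans[rotated])
      qed simp
    qed
  qed
  also have "\<dots> \<le> liminf (\<lambda>n. \<integral>\<^sup>+\<omega>. indicator {\<omega> \<in> space M. Y (n + k) \<omega> < t} \<omega> \<partial>M)"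
    by (rule nn_integral_liminf) measurable
  also have "\<dots> \<le> liminf (\<lambda>n. ennreal B)"
    using B by (intro Liminf_mono always_eventually allI) (simp add: emeasure_eq_measure ennreal_leI)
  also have "\<dots> = ennreal B" by (simp add: Liminf_const)
  finally show ?thesis using B0 by (simp add: emeasure_eq_measure)
qed

lemma (in prob_space) integrable_exp_of_gauss_tail:
  fixes R :: "'a \<Rightarrow> real"
  assumes [measurable]: "R \<in> borel_measurable M" and c: "0 < c" and K: "0 < K"
    and tail: "\<And>y. 1 \<le> y \<Longrightarrow> measure M {\<omega> \<in> space M. R \<omega> < - y} \<le> exp (- c * y\<^sup>2)"
  shows "integrable M (\<lambda>\<omega>. exp (- K * R \<omega>))"
proof -
  \<comment> \<open>Layers of the left tail; a Gaussian weight beats any exponential one.\<close>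
  define A where "A = (\<lambda>k::nat. {\<omega> \<in> space M. R \<omega> < - (real k + 1)})"
  have [measurable]: "A k \<in> sets M" for k unfolding A_def by measurable
  define D where "D = exp (K + (K + 1)\<^sup>2 / (4 * c))"
  have bound: "exp (K * (real k + 2)) * measure M (A k) \<le> D * exp (-1) ^ k" for k
  proof -
    have "exp (K * (real k + 2)) * measure M (A k) \<le> exp (K * (real k + 2)) * exp (- c * (real k + 1)\<^sup>2)"
      unfolding A_def by (intro mult_left_mono tail) auto
    also have "\<dots> = exp (K * (real k + 2) - c * (real k + 1)\<^sup>2)" by (simp add: exp_add[symmetric])
    also have "\<dots> \<le> exp (K + (K + 1)\<^sup>2 / (4 * c) - real k)"
    proof (subst exp_le_cancel_iff)
      define t where "t = real k + 1"
      have "0 \<le> (2 * c * t - (K + 1))\<^sup>2 / (4 * c)" using c by simp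
      also have "\<dots> = c * t\<^sup>2 - (K + 1) * t + (K + 1)\<^sup>2 / (4 * c)"
        using c by (simp add: power2_eq_square field_simps)
      finally show "K * (real k + 2) - c * (real k + 1)\<^sup>2 \<le> K + (K + 1)\<^sup>2 / (4 * c) - real k"
        by (simp add: t_def algebra_simps)
    qed
    also have "\<dots> = D * exp (-1) ^ k"
      by (simp add: D_def exp_of_nat_mult[symmetric] exp_add[symmetric])
    finally show ?thesis .
  qed
  have "(\<integral>\<^sup>+\<omega>. ennreal (exp (- K * R \<omega>)) \<partial>M) \<le>
    (\<integral>\<^sup>+\<omega>. ennreal (exp K) + (\<Sum>k. ennreal (exp (K * (real k + 2))) * indicator (A k) \<omega>) \<partial>M)"
  proof (rule nn_integral_mono)
    fix \<omega> assume \<omega>: "\<omega> \<in> space M"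
    show "ennreal (exp (- K * R \<omega>)) \<le> ennreal (exp K) + (\<Sum>k. ennreal (exp (K * (real k + 2))) * indicator (A k) \<omega>)"
    proof (cases "-1 \<le> R \<omega>")
      case True
      have "K * - R \<omega> \<le> K * 1" using True K by (intro mult_left_mono) auto
      hence "ennreal (exp (- K * R \<omega>)) \<le> ennreal (exp K)" by (intro ennreal_leI) simp
      thus ?thesis by (simp add: add_increasing2)
    next
      case False
      define f where "f = (\<lambda>k. ennreal (exp (K * (real k + 2))) * indicator (A k) \<omega>)"
      define k where "k = nat (\<lceil>- R \<omega>\<rceil> - 2)"
      have k: "real k + 1 < - R \<omega>" "- R \<omega> \<le> real k + 2" using False unfolding k_def by linarith+
      have "K * - R \<omega> \<le> K * (real k + 2)" using k K by (intro mult_left_mono) auto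
      hence "ennreal (exp (- K * R \<omega>)) \<le> ennreal (exp (K * (real k + 2)))" by (intro ennreal_leI) simp
      also have "\<dots> = ennreal (exp (K * (real k + 2))) * indicator (A k) \<omega>" using k \<omega> by (simp add: A_def indicator_def)
      also have "\<dots> = f k" by (simp add: f_def)
      also have "\<dots> \<le> (\<Sum>k. f k)" using sum_le_suminf[of f "{k}"] by auto
      finally show ?thesis unfolding f_def by (simp add: add_increasing)
    qed
  qed
  also have "\<dots> = ennreal (exp K) + (\<Sum>k. ennreal (exp (K * (real k + 2)) * measure M (A k)))"
    by (subst nn_integral_add) (simp_all add: nn_integral_suminf nn_integral_cmult emeasure_eq_measure ennreal_mult prob_space)
  also have "\<dots> \<le> ennreal (exp K) + (\<Sum>k. ennreal (D * exp (-1) ^ k))"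
    by (intro add_left_mono suminf_le ennreal_leI bound) auto
  also have "(\<Sum>k. ennreal (D * exp (-1) ^ k)) = ennreal (\<Sum>k. D * exp (-1) ^ k)"
    by (intro suminf_ennreal2 summable_mult summable_geometric) (auto simp: D_def)
  also have "ennreal (exp K) + \<dots> < \<infinity>" by simp
  finally show ?thesis by (intro integrableI_nonneg) auto
qed

context subcritical
begin

text \<open>Starting from \<open>z/2\<close> instead of \<open>z\<close>, the sign of \<open>D[z]\<close> is that of \<open>D[z/2] + (z/2) W[z/2]\<close>, so a negative sign needs a small \<open>W\<close> or a very negative \<open>D[z/2]\<close>.\<close>

lemma derivative_negative_tail:
  "\<exists>C\<ge>1. \<exists>c>0. \<forall>(M :: 'a measure) \<xi> n z. gaussian_labels M \<xi> \<longrightarrow> 0 \<le> z \<longrightarrow>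
     measure M {\<omega> \<in> space M. derivative_mart \<xi> z \<beta> n \<omega> < 0} \<le> C * exp (- c * z\<^sup>2)"
proof -
  obtain C c where C: "0 < C" and c: "0 < c" and W: "\<And>(M :: 'a measure) \<xi> n s. gaussian_labels M \<xi> \<Longrightarrow> 0 \<le> s \<Longrightarrow>
     measure M {\<omega> \<in> space M. additive_mart \<xi> 0 \<beta> n \<omega> < exp (- s)} \<le> C * exp (- c * s\<^sup>2)"
    using additive_lower_tail[where 'a = 'a] by blast
  obtain \<theta> where \<theta>: "admissible \<theta>" using admissible_exists by blast
  hence \<theta>0: "0 < \<theta>" by (simp add: admissible_def)
  define c' where "c' = min (c * \<beta>\<^sup>2 / 16) (\<theta> * \<beta> / 8)"
  have c': "0 < c'" "c' \<le> c * \<beta>\<^sup>2 / 16" "c' \<le> \<theta> * \<beta> / 8" using c \<theta>0 \<beta>_pos by (auto simp: c'_def)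
  have "measure M {\<omega> \<in> space M. derivative_mart \<xi> z \<beta> n \<omega> < 0} \<le> (C + exp 1) * exp (- c' * z\<^sup>2)"
    if g: "gaussian_labels M \<xi>" and z: "0 \<le> z" for M :: "'a measure" and \<xi> n z
  proof -
    interpret gaussian_labels M \<xi> by (rule g)
    define s where "s = \<beta> * z / 4"
    define y where "y = z / 2 * exp s"
    define E1 where "E1 = {\<omega> \<in> space M. additive_mart \<xi> 0 \<beta> n \<omega> < exp (- s)}"
    define E2 where "E2 = {\<omega> \<in> space M. derivative_mart \<xi> (z / 2) \<beta> n \<omega> < - y}"
    have [measurable]: "E1 \<in> sets M" "E2 \<in> sets M" unfolding E1_def E2_def by measurable
    have "{\<omega> \<in> space M. derivative_mart \<xi> z \<beta> n \<omega> < 0} \<subseteq> E1 \<union> E2"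
    proof (intro subsetI UnCI)
      fix \<omega> assume \<omega>: "\<omega> \<in> {\<omega> \<in> space M. derivative_mart \<xi> z \<beta> n \<omega> < 0}" "\<omega> \<notin> E2"
      show "\<omega> \<in> E1"
      proof (rule ccontr)
        assume "\<omega> \<notin> E1"
        hence W0: "exp (- s) \<le> additive_mart \<xi> 0 \<beta> n \<omega>" using \<omega> by (auto simp: E1_def)
        have "exp s = exp (\<beta> * (z / 2)) * exp (- s)" by (simp add: s_def exp_add[symmetric])
        also have "\<dots> \<le> exp (\<beta> * (z / 2)) * additive_mart \<xi> 0 \<beta> n \<omega>" using W0 by (intro mult_left_mono) auto
        also have "\<dots> = additive_mart \<xi> (z / 2) \<beta> n \<omega>" using mart_shift(1)[of \<xi> 0 "z / 2"] by simp
        finally have "y \<le> z / 2 * additive_mart \<xi> (z / 2) \<beta> n \<omega>" using z unfolding y_def by (intro mult_left_mono) auto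
        moreover have "- y \<le> derivative_mart \<xi> (z / 2) \<beta> n \<omega>" using \<omega> by (auto simp: E2_def)
        ultimately have "0 \<le> derivative_mart \<xi> (z / 2) \<beta> n \<omega> + z / 2 * additive_mart \<xi> (z / 2) \<beta> n \<omega>" by linarith
        hence "0 \<le> derivative_mart \<xi> (z / 2 + z / 2) \<beta> n \<omega>" unfolding mart_shift by simp
        thus False using \<omega> by simp
      qed
    qed
    hence "measure M {\<omega> \<in> space M. derivative_mart \<xi> z \<beta> n \<omega> < 0} \<le> measure M (E1 \<union> E2)"
      by (intro finite_measure_mono) auto
    also have "\<dots> \<le> measure M E1 + measure M E2" by (rule measure_Un_le) auto
    also have "\<dots> \<le> C * exp (- c * s\<^sup>2) + exp (1 - \<theta> * y)"
      unfolding E1_def E2_def using z \<beta>_pos by (intro add_mono W derivative_left_tail_exp g \<theta>) (auto simp: s_def)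
    also have "\<dots> \<le> C * exp (- c' * z\<^sup>2) + exp 1 * exp (- c' * z\<^sup>2)"
    proof (intro add_mono mult_left_mono)
      have "c' * z\<^sup>2 \<le> c * \<beta>\<^sup>2 / 16 * z\<^sup>2" using c' by (intro mult_right_mono) auto
      thus "exp (- c * s\<^sup>2) \<le> exp (- c' * z\<^sup>2)" by (simp add: s_def power_mult_distrib power_divide)
      have "c' * z\<^sup>2 \<le> \<theta> * \<beta> / 8 * z\<^sup>2" using c' by (intro mult_right_mono) auto
      also have "\<dots> = \<theta> * (z / 2 * s)" by (simp add: s_def power2_eq_square)
      also have "s \<le> exp s" using exp_ge_add_one_self[of s] by linarith
      hence "\<theta> * (z / 2 * s) \<le> \<theta> * y" unfolding y_def using z \<theta>0 by (intro mult_left_mono) auto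
      finally have "exp (1 - \<theta> * y) \<le> exp (1 + - c' * z\<^sup>2)" by simp
      thus "exp (1 - \<theta> * y) \<le> exp 1 * exp (- c' * z\<^sup>2)" by (simp only: exp_add)
    qed (use C in auto)
    finally show ?thesis by (simp add: distrib_right)
  qed
  moreover have "1 \<le> C + exp 1" using C one_le_exp_iff[of 1] by linarith
  ultimately show ?thesis using c' by blast
qed

text \<open>If both first steps lead far to the right, the derivative martingales of both subtrees are nonnegative with probability at least one half each.\<close>

lemma derivative_nonneg_likely:
  "\<exists>\<delta>>0. \<forall>(M :: 'a measure) \<xi> n z. gaussian_labels M \<xi> \<longrightarrow> z\<^sub>0 \<le> z \<longrightarrow>
     measure M {\<omega> \<in> space M. derivative_mart \<xi> z \<beta> (Suc n) \<omega> < 0} \<le> 1 - \<delta>"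
proof -
  obtain C c where C: "1 \<le> C" and c: "0 < c" and tail: "\<And>(M :: 'a measure) \<xi> n z. gaussian_labels M \<xi> \<Longrightarrow> 0 \<le> z \<Longrightarrow>
     measure M {\<omega> \<in> space M. derivative_mart \<xi> z \<beta> n \<omega> < 0} \<le> C * exp (- c * z\<^sup>2)"
    using derivative_negative_tail[where 'a = 'a] by blast
  define z1 where "z1 = max 1 (ln (2 * C) / c)"
  have half: "measure M {\<omega> \<in> space M. derivative_mart \<xi> z \<beta> n \<omega> < 0} \<le> 1 / 2"
    if "gaussian_labels M \<xi>" "z1 \<le> z" for M :: "'a measure" and \<xi> n z
  proof -
    have z: "1 \<le> z" "ln (2 * C) / c \<le> z" using that by (auto simp: z1_def)
    have "ln (2 * C) \<le> c * z" using z c by (simp add: field_simps)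
    also have "\<dots> \<le> c * z\<^sup>2" using z c power_increasing[of 1 2 z] by simp
    finally have "exp (- c * z\<^sup>2) \<le> exp (- ln (2 * C))" by simp
    also have "\<dots> = 1 / (2 * C)" using C by (simp add: exp_minus inverse_eq_divide)
    finally have "C * exp (- c * z\<^sup>2) \<le> C * (1 / (2 * C))" using C by (intro mult_left_mono) auto
    thus ?thesis using tail[OF that(1), of z n] z C by simp
  qed
  define a where "a = z1 - z\<^sub>0 + \<beta>"
  interpret N: prob_space stdN by (rule prob_space_stdN)
  define q where "q = measure stdN {a..}"
  have q: "0 < q"
  proof -
    have "0 < exp (- (\<bar>a\<bar> + 1)\<^sup>2 / 2) / sqrt (2 * pi)" by simp
    also have "\<dots> \<le> measure stdN {a..a + 1}" by (rule gauss_window) auto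
    also have "\<dots> \<le> q" unfolding q_def by (intro N.finite_measure_mono) auto
    finally show ?thesis .
  qed
  define \<delta> where "\<delta> = (q / 2)\<^sup>2"
  have "measure M {\<omega> \<in> space M. derivative_mart \<xi> z \<beta> (Suc n) \<omega> < 0} \<le> 1 - \<delta>"
    if g: "gaussian_labels M \<xi>" and z: "z\<^sub>0 \<le> z" for M :: "'a measure" and \<xi> n z
  proof -
    interpret gaussian_labels M \<xi> by (rule g)
    define G where "G = (\<lambda>(w::real, d). indicator {0..} (d::real) :: ennreal)"
    have G: "G \<in> borel_measurable (borel \<Otimes>\<^sub>M borel)" unfolding G_def by measurable
    have ge: "ennreal (q / 2) \<le> (\<integral>\<^sup>+s. \<integral>\<^sup>+\<omega>. G (additive_mart (subtree \<xi> b) (z + s - \<beta>) \<beta> n \<omega>, derivative_mart (subtree \<xi> b) (z + s - \<beta>) \<beta> n \<omega>) \<partial>M \<partial>stdN)" for b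
    proof -
      have "ennreal (q / 2) = ennreal (1 / 2 * q)" by simp
      also have "\<dots> = ennreal (1 / 2) * ennreal q" using q by (intro ennreal_mult) auto
      also have "ennreal q = emeasure stdN {a..}" by (simp add: q_def N.emeasure_eq_measure)
      also have "ennreal (1 / 2) * \<dots> = (\<integral>\<^sup>+s. ennreal (1 / 2) * indicator {a..} s \<partial>stdN)"
        by (subst nn_integral_cmult_indicator) auto
      also have "\<dots> \<le> (\<integral>\<^sup>+s. \<integral>\<^sup>+\<omega>. G (additive_mart (subtree \<xi> b) (z + s - \<beta>) \<beta> n \<omega>, derivative_mart (subtree \<xi> b) (z + s - \<beta>) \<beta> n \<omega>) \<partial>M \<partial>stdN)"
      proof (rule nn_integral_mono)
        fix s
        show "ennreal (1 / 2) * indicator {a..} s \<le> (\<integral>\<^sup>+\<omega>. G (additive_mart (subtree \<xi> b) (z + s - \<beta>) \<beta> n \<omega>, derivative_mart (subtree \<xi> b) (z + s - \<beta>) \<beta> n \<omega>) \<partial>M)"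
        proof (cases "a \<le> s")
          case True
          interpret S: gaussian_labels M "subtree \<xi> b" by (rule gaussian_labels_subtree)
          define E where "E = {\<omega> \<in> space M. derivative_mart (subtree \<xi> b) (z + s - \<beta>) \<beta> n \<omega> < 0}"
          have E[measurable]: "E \<in> sets M" unfolding E_def by measurable
          have "measure M E \<le> 1 / 2" unfolding E_def using True z by (intro half gaussian_labels_subtree) (simp add: a_def)
          hence "1 / 2 \<le> measure M (space M - E)" by (simp add: prob_compl)
          hence "ennreal (1 / 2) \<le> emeasure M (space M - E)" unfolding emeasure_eq_measure by (rule ennreal_leI)
          also have "\<dots> = (\<integral>\<^sup>+\<omega>. indicator (space M - E) \<omega> \<partial>M)" by simp
          also have "\<dots> = (\<integral>\<^sup>+\<omega>. G (additive_mart (subtree \<xi> b) (z + s - \<beta>) \<beta> n \<omega>, derivative_mart (subtree \<xi> b) (z + s - \<beta>) \<beta> n \<omega>) \<partial>M)"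
            by (intro nn_integral_cong) (auto simp: G_def E_def indicator_def)
          finally show ?thesis using True by simp
        qed simp
      qed
      finally show ?thesis .
    qed
    define E where "E = {\<omega> \<in> space M. derivative_mart \<xi> z \<beta> (Suc n) \<omega> < 0}"
    have E[measurable]: "E \<in> sets M" unfolding E_def by measurable
    have "ennreal \<delta> = ennreal (q / 2) * ennreal (q / 2)" using q by (simp add: \<delta>_def power2_eq_square ennreal_mult'[symmetric])
    also have "\<dots> \<le> (\<integral>\<^sup>+s. \<integral>\<^sup>+\<omega>. G (additive_mart (subtree \<xi> False) (z + s - \<beta>) \<beta> n \<omega>, derivative_mart (subtree \<xi> False) (z + s - \<beta>) \<beta> n \<omega>) \<partial>M \<partial>stdN) *
      (\<integral>\<^sup>+s. \<integral>\<^sup>+\<omega>. G (additive_mart (subtree \<xi> True) (z + s - \<beta>) \<beta> n \<omega>, derivative_mart (subtree \<xi> True) (z + s - \<beta>) \<beta> n \<omega>) \<partial>M \<partial>stdN)"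
      by (intro mult_mono ge) auto
    also have "\<dots> = (\<integral>\<^sup>+\<omega>. G (additive_mart (subtree \<xi> False) (z + \<xi> [False] \<omega> - \<beta>) \<beta> n \<omega>, derivative_mart (subtree \<xi> False) (z + \<xi> [False] \<omega> - \<beta>) \<beta> n \<omega>) *
       G (additive_mart (subtree \<xi> True) (z + \<xi> [True] \<omega> - \<beta>) \<beta> n \<omega>, derivative_mart (subtree \<xi> True) (z + \<xi> [True] \<omega> - \<beta>) \<beta> n \<omega>) \<partial>M)"
      by (rule nn_integral_branching[OF G, symmetric])
    also have "\<dots> \<le> (\<integral>\<^sup>+\<omega>. indicator (space M - E) \<omega> \<partial>M)"
      by (intro nn_integral_mono) (auto simp: G_def E_def mart_Suc indicator_def not_less split: if_splits)
    also have "\<dots> = emeasure M (space M - E)" by simp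
    finally have "\<delta> \<le> measure M (space M - E)" by (simp add: emeasure_eq_measure)
    thus ?thesis unfolding E_def[symmetric] by (simp add: prob_compl)
  qed
  moreover have "0 < \<delta>" using q by (simp add: \<delta>_def)
  ultimately show ?thesis by blast
qed

lemma limits_measurable:
  assumes "gaussian_labels M \<xi>"
  shows "derivative_limit \<xi> x \<beta> \<in> borel_measurable M" "additive_limit \<xi> x \<beta> \<in> borel_measurable M"
proof -
  interpret gaussian_labels M \<xi> by fact
  show "derivative_limit \<xi> x \<beta> \<in> borel_measurable M" "additive_limit \<xi> x \<beta> \<in> borel_measurable M"
    unfolding derivative_limit_def[abs_def] additive_limit_def[abs_def] by measurable
qed

text \<open>If \<open>W[x]\<close> vanishes in the limit, the quotient is \<open>0\<close> by convention and not below \<open>- y\<close>. So on the event the limit of \<open>W[x]\<close> is positive, and the event says that \<open>D[x] + y W[x] < 0\<close> in the limit.\<close>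

lemma ratio_tail_le:
  assumes "gaussian_labels M \<xi>" and y: "0 \<le> y"
    and B: "\<And>n. measure M {\<omega> \<in> space M. derivative_mart \<xi> (x + y) \<beta> (Suc n) \<omega> < 0} \<le> B"
  shows "measure M {\<omega> \<in> space M. derivative_limit \<xi> x \<beta> \<omega> / additive_limit \<xi> x \<beta> \<omega> < - y} \<le> B"
proof -
  interpret gaussian_labels M \<xi> by fact
  note [measurable] = limits_measurable[OF assms(1)]
  define Y where "Y = (\<lambda>n \<omega>. derivative_mart \<xi> x \<beta> n \<omega> + y * additive_mart \<xi> x \<beta> n \<omega>)"
  define Z where "Z = (\<lambda>\<omega>. derivative_limit \<xi> x \<beta> \<omega> + y * additive_limit \<xi> x \<beta> \<omega>)"
  have [measurable]: "Y n \<in> borel_measurable M" "Z \<in> borel_measurable M" for n unfolding Y_def Z_def by measurable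
  have "measure M {\<omega> \<in> space M. derivative_limit \<xi> x \<beta> \<omega> / additive_limit \<xi> x \<beta> \<omega> < - y} \<le> measure M {\<omega> \<in> space M. Z \<omega> < 0}"
  proof (rule finite_measure_mono_AE)
    show "AE \<omega> in M. \<omega> \<in> {\<omega> \<in> space M. derivative_limit \<xi> x \<beta> \<omega> / additive_limit \<xi> x \<beta> \<omega> < - y} \<longrightarrow> \<omega> \<in> {\<omega> \<in> space M. Z \<omega> < 0}"
      using additive_mart_converges[OF assms(1), of x]
    proof eventually_elim
      case (elim \<omega>)
      have W: "0 \<le> additive_limit \<xi> x \<beta> \<omega>"
        by (rule LIMSEQ_le_const[OF elim]) (auto simp: additive_mart_pos less_imp_le)
      define d where "d = derivative_limit \<xi> x \<beta> \<omega>"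
      define w where "w = additive_limit \<xi> x \<beta> \<omega>"
      have "d + y * w < 0" if "d / w < - y"
      proof -
        have "w \<noteq> 0" using that y by auto
        thus ?thesis using that W by (simp add: w_def field_simps)
      qed
      thus ?case by (simp add: Z_def d_def w_def)
    qed
  qed measurable
  also have "\<dots> \<le> B"
  proof (rule limit_tail_le[where Y = Y and k = 1])
    show "AE \<omega> in M. (\<lambda>n. Y n \<omega>) \<longlonglongrightarrow> Z \<omega>"
      using additive_mart_converges[OF assms(1), of x] derivative_mart_converges[OF assms(1), of x]
      unfolding Y_def Z_def by eventually_elim (intro tendsto_intros)
    fix n
    have "derivative_mart \<xi> (x + y) \<beta> (Suc n) \<omega> < 0 \<longleftrightarrow> Y (Suc n) \<omega> < 0" for \<omega>
      unfolding mart_shift Y_def by (simp add: mult_less_0_iff)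
    thus "measure M {\<omega> \<in> space M. Y (n + 1) \<omega> < 0} \<le> B" using B[of n] by simp
  qed measurable
  finally show ?thesis .
qed

text \<open>For large \<open>y\<close> half of the Gaussian exponent pays for the prefactor; for bounded \<open>y\<close> the probability is bounded away from 1.\<close>

lemma ratio_tail:
  "\<exists>c>0. \<forall>(M :: 'a measure) \<xi> y. gaussian_labels M \<xi> \<longrightarrow> 1 \<le> y \<longrightarrow>
    measure M {\<omega> \<in> space M. derivative_limit \<xi> x \<beta> \<omega> / additive_limit \<xi> x \<beta> \<omega> < - y} \<le> exp (- c * y\<^sup>2)"
proof -
  obtain C c where C: "1 \<le> C" and c: "0 < c" and tail: "\<And>(M :: 'a measure) \<xi> n z. gaussian_labels M \<xi> \<Longrightarrow> 0 \<le> z \<Longrightarrow>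
     measure M {\<omega> \<in> space M. derivative_mart \<xi> z \<beta> n \<omega> < 0} \<le> C * exp (- c * z\<^sup>2)"
    using derivative_negative_tail[where 'a = 'a] by blast
  obtain \<delta> where \<delta>: "0 < \<delta>" and likely: "\<And>(M :: 'a measure) \<xi> n z. gaussian_labels M \<xi> \<Longrightarrow> x + 1 \<le> z \<Longrightarrow>
     measure M {\<omega> \<in> space M. derivative_mart \<xi> z \<beta> (Suc n) \<omega> < 0} \<le> 1 - \<delta>"
    using derivative_nonneg_likely[where 'a = 'a and z\<^sub>0 = "x + 1"] by blast
  define y0 where "y0 = max (max 1 (2 * \<bar>x\<bar>)) (8 * ln C / c)"
  have y0: "1 \<le> y0" "2 * \<bar>x\<bar> \<le> y0" "8 * ln C / c \<le> y0" by (auto simp: y0_def)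
  define c' where "c' = min (c / 8) (\<delta> / y0\<^sup>2)"
  have c': "0 < c'" "c' \<le> c / 8" "c' \<le> \<delta> / y0\<^sup>2"
    using c \<delta> y0 unfolding c'_def by (simp_all only: min.cobounded1 min.cobounded2) auto
  have "measure M {\<omega> \<in> space M. derivative_limit \<xi> x \<beta> \<omega> / additive_limit \<xi> x \<beta> \<omega> < - y} \<le> exp (- c' * y\<^sup>2)"
    if g: "gaussian_labels M \<xi>" and y: "1 \<le> y" for M :: "'a measure" and \<xi> y
  proof (rule ratio_tail_le[OF g])
    show "0 \<le> y" using y by simp
    fix n
    show "measure M {\<omega> \<in> space M. derivative_mart \<xi> (x + y) \<beta> (Suc n) \<omega> < 0} \<le> exp (- c' * y\<^sup>2)"
    proof (cases "y \<le> y0")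
      case True
      have "c' * y\<^sup>2 \<le> c' * y0\<^sup>2" using True y c' by (intro mult_left_mono power_mono) auto
      also have "\<dots> \<le> \<delta>" using c'(3) y0 by (simp add: field_simps)
      finally have "1 - \<delta> \<le> 1 + - c' * y\<^sup>2" by simp
      also have "\<dots> \<le> exp (- c' * y\<^sup>2)" by (rule exp_ge_add_one_self)
      finally show ?thesis using likely[OF g, of "x + y" n] y by simp
    next
      case False
      have z: "y / 2 \<le> x + y" "0 \<le> y / 2" using False y0 y by (auto simp: abs_le_iff)
      have "measure M {\<omega> \<in> space M. derivative_mart \<xi> (x + y) \<beta> (Suc n) \<omega> < 0} \<le> C * exp (- c * (x + y)\<^sup>2)"
        using z by (intro tail g) auto
      also have "\<dots> = exp (ln C - c * (x + y)\<^sup>2)" using C by (simp add: exp_diff exp_minus field_simps)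
      also have "\<dots> \<le> exp (- c' * y\<^sup>2)"
      proof (subst exp_le_cancel_iff)
        have "(y / 2)\<^sup>2 \<le> (x + y)\<^sup>2" using z by (intro power_mono) auto
        hence "c * (y / 2)\<^sup>2 \<le> c * (x + y)\<^sup>2" using c by (intro mult_left_mono) auto
        moreover have "ln C \<le> c * y\<^sup>2 / 8"
        proof -
          have "8 * ln C / c \<le> y" using False y0 by simp
          also have "y \<le> y\<^sup>2" using y power_increasing[of 1 2 y] by simp
          finally show ?thesis using c by (simp add: field_simps)
        qed
        moreover have "c' * y\<^sup>2 \<le> c / 8 * y\<^sup>2" using c' by (intro mult_right_mono) auto
        ultimately show "ln C - c * (x + y)\<^sup>2 \<le> - c' * y\<^sup>2" by (simp add: power_divide)
      qed
      finally show ?thesis .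
    qed
  qed
  thus ?thesis using c' by blast
qed

lemma derivative_limit_tail:
  assumes "\<gamma> = (beta_c / \<beta>)\<^sup>2"
  shows "\<exists>C>0. \<exists>c>0. \<forall>(M :: 'a measure) \<xi> x y. gaussian_labels M \<xi> \<longrightarrow> 1 \<le> y \<longrightarrow>
    measure M {\<omega> \<in> space M. derivative_limit \<xi> x \<beta> \<omega> < - y} \<le> C * exp (- c * y powr \<gamma>)"
proof -
  obtain C c where C: "0 < C" and c: "0 < c" and tail: "\<And>(M :: 'a measure) \<xi> x y. gaussian_labels M \<xi> \<Longrightarrow> 1 \<le> y \<Longrightarrow>
    (\<exists>k. \<forall>n. measure M {\<omega> \<in> space M. derivative_mart \<xi> x \<beta> (n + k) \<omega> < - y} \<le> C * exp (- c * y powr \<gamma>))"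
    using derivative_left_tail[OF assms, where 'a = 'a] by blast
  have "measure M {\<omega> \<in> space M. derivative_limit \<xi> x \<beta> \<omega> < - y} \<le> C * exp (- c * y powr \<gamma>)"
    if g: "gaussian_labels M \<xi>" and y: "1 \<le> y" for M :: "'a measure" and \<xi> x y
  proof -
    interpret gaussian_labels M \<xi> by (rule g)
    obtain k where "\<And>n. measure M {\<omega> \<in> space M. derivative_mart \<xi> x \<beta> (n + k) \<omega> < - y} \<le> C * exp (- c * y powr \<gamma>)"
      using tail[OF g y] by blast
    thus ?thesis
      by (rule limit_tail_le[OF derivative_mart_measurable limits_measurable(1)[OF g] derivative_mart_converges[OF g]])
  qed
  thus ?thesis using C c by blast
qed

end

theorem mainTheorem3:
  fixes \<beta> \<gamma> :: real
  assumes "0 < \<beta>" and "\<beta> < beta_c" and "\<gamma> = (beta_c / \<beta>)\<^sup>2"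
  shows
    "(\<exists>C>0. \<exists>c>0. \<forall>(M :: 'a measure) \<xi>. gaussian_labels M \<xi> \<longrightarrow>
        (\<forall>y\<ge>1. (SUP x. measure M {\<omega> \<in> space M. derivative_limit \<xi> x \<beta> \<omega> < - y})
                  \<le> C * exp (- c * y powr \<gamma>)))
     \<and>
     (\<forall>x. \<exists>c>0. \<forall>(M :: 'a measure) \<xi>. gaussian_labels M \<xi> \<longrightarrow>
        (\<forall>y\<ge>1. measure M {\<omega> \<in> space M.
                    derivative_limit \<xi> x \<beta> \<omega> / additive_limit \<xi> x \<beta> \<omega> < - y}
                  \<le> exp (- c * y powr (min \<gamma> 2))))
     \<and>
     (\<forall>x. \<forall>(M :: 'a measure) \<xi>. gaussian_labels M \<xi> \<longrightarrow>
        (\<forall>K>0. integrable M (\<lambda>\<omega>.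
                    exp (- K * (derivative_limit \<xi> x \<beta> \<omega> / additive_limit \<xi> x \<beta> \<omega>)))))"
proof -
  obtain p \<epsilon> where "subcritical \<beta> p \<epsilon>" using subcritical_exists[OF assms(1,2)] .
  then interpret subcritical \<beta> p \<epsilon> .
  show ?thesis
  proof (intro conjI allI impI)
    obtain C c where C: "0 < C" and c: "0 < c" and tail: "\<And>(M :: 'a measure) \<xi> x y. gaussian_labels M \<xi> \<Longrightarrow> 1 \<le> y \<Longrightarrow>
      measure M {\<omega> \<in> space M. derivative_limit \<xi> x \<beta> \<omega> < - y} \<le> C * exp (- c * y powr \<gamma>)"
      using derivative_limit_tail[OF assms(3), where 'a = 'a] by blast
    show "\<exists>C>0. \<exists>c>0. \<forall>(M :: 'a measure) \<xi>. gaussian_labels M \<xi> \<longrightarrow>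
        (\<forall>y\<ge>1. (SUP x. measure M {\<omega> \<in> space M. derivative_limit \<xi> x \<beta> \<omega> < - y}) \<le> C * exp (- c * y powr \<gamma>))"
      using C c tail by (intro exI[of _ C] exI[of _ c] conjI allI impI cSUP_least) auto
  next
    fix x
    obtain c where c: "0 < c" and tail: "\<And>(M :: 'a measure) \<xi> y. gaussian_labels M \<xi> \<Longrightarrow> 1 \<le> y \<Longrightarrow>
      measure M {\<omega> \<in> space M. derivative_limit \<xi> x \<beta> \<omega> / additive_limit \<xi> x \<beta> \<omega> < - y} \<le> exp (- c * y\<^sup>2)"
      using ratio_tail[where 'a = 'a and x = x] by blast
    have "measure M {\<omega> \<in> space M. derivative_limit \<xi> x \<beta> \<omega> / additive_limit \<xi> x \<beta> \<omega> < - y} \<le> exp (- c * y powr (min \<gamma> 2))"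
      if g: "gaussian_labels M \<xi>" and y: "1 \<le> y" for M :: "'a measure" and \<xi> y
    proof -
      have "y powr (min \<gamma> 2) \<le> y powr 2" using y by (intro powr_mono) auto
      hence "c * y powr (min \<gamma> 2) \<le> c * y\<^sup>2" using y c by simp
      thus ?thesis using tail[OF g y] by (simp add: order_trans)
    qed
    thus "\<exists>c>0. \<forall>(M :: 'a measure) \<xi>. gaussian_labels M \<xi> \<longrightarrow>
        (\<forall>y\<ge>1. measure M {\<omega> \<in> space M. derivative_limit \<xi> x \<beta> \<omega> / additive_limit \<xi> x \<beta> \<omega> < - y}
                  \<le> exp (- c * y powr (min \<gamma> 2)))"
      using c by blast
  next
    fix x K :: real and M :: "'a measure" and \<xi>
    assume g: "gaussian_labels M \<xi>" and K: "0 < K"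
    interpret gaussian_labels M \<xi> by (rule g)
    obtain c where "0 < c" and "\<And>y. 1 \<le> y \<Longrightarrow>
      measure M {\<omega> \<in> space M. derivative_limit \<xi> x \<beta> \<omega> / additive_limit \<xi> x \<beta> \<omega> < - y} \<le> exp (- c * y\<^sup>2)"
      using ratio_tail[where 'a = 'a and x = x] g by blast
    thus "integrable M (\<lambda>\<omega>. exp (- K * (derivative_limit \<xi> x \<beta> \<omega> / additive_limit \<xi> x \<beta> \<omega>)))"
      using limits_measurable[OF g] K by (intro integrable_exp_of_gauss_tail) auto
  qed
qed

end
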